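(* Let $n\ge 1$ and $k\ge 0$ be integers, and let $\mathrm{UConf}(n,2):=\mathrm{Conf}(n,2)/S_{n}$ denote the unordered configuration space of $n$ unit-diameter disks on the infinite strip of width $2$. Then \[ H_{k}\big(\mathrm{UConf}(n,2);\mathbb{Q}\big)\cong\mathbb{Q}^{\binom{n-k}{k}}, \] where $\binom{n-k}{k}$ is interpreted as $0$ when $n<2k$.
   Context: For positive integers $n,w$, $\mathrm{Conf}(n,w)$ is the ordered configuration space of $n$ open unit-diameter disks on the infinite strip of width $w$: \[ \mathrm{Conf}(n,w)=\Big\{(x_{1}, y_{1}, \dots, x_{n}, y_{n})\in \mathbb{R}^{2n}\ :\ (x_{i}-x_{j})^{2}+(y_{i}-y_{j})^{2}\ge 1\text{ for }i\neq j,\ \tfrac{1}{2}\le y_{i}\le w-\tfrac{1}{2} \text{ for all }i\Big\}, \] with the subspace topology. The symmetric group $S_n$ acts on it by relabeling the disks, and $\mathrm{UConf}(n,w)$ is the quotient space. *)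

theory Defs
  imports
    "HOL-Homology.Homology"
    "HOL-Combinatorics.Permutations"
    "Jordan_Normal_Form.VS_Connect"
begin

section \<open>Configuration spaces of unit-diameter disks on a strip\<close>

text \<open>
  A configuration assigns to each label in \<open>{..<n}\<close> the centre \<open>(x, y)\<close> of its disk; it is a point of
  the product of \<open>n\<close> copies of the Euclidean plane, and takes the value \<^term>\<open>undefined\<close> off \<open>{..<n}\<close>.
\<close>

definition conf_set :: "nat \<Rightarrow> nat \<Rightarrow> (nat \<Rightarrow> real \<times> real) set" where
  "conf_set n w =
     {c \<in> {..<n} \<rightarrow>\<^sub>E UNIV.
        (\<forall>i<n. \<forall>j<n. i \<noteq> j \<longrightarrow>
           (fst (c i) - fst (c j))\<^sup>2 + (snd (c i) - snd (c j))\<^sup>2 \<ge> 1) \<and>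
        (\<forall>i<n. 1 / 2 \<le> snd (c i) \<and> snd (c i) \<le> real w - 1 / 2)}"

definition Conf :: "nat \<Rightarrow> nat \<Rightarrow> (nat \<Rightarrow> real \<times> real) topology" where
  "Conf n w = subtopology (product_topology (\<lambda>_. euclidean) {..<n}) (conf_set n w)"

text \<open>
  A permutation fixes every index outside \<open>{..<n}\<close>, so relabelled configurations are again
  extensional.
\<close>

definition relabel_orbit :: "nat \<Rightarrow> (nat \<Rightarrow> 'a) \<Rightarrow> (nat \<Rightarrow> 'a) set" where
  "relabel_orbit n c = {c \<circ> \<sigma> | \<sigma>. \<sigma> permutes {..<n}}"

definition quotient_topology :: "'a topology \<Rightarrow> ('a \<Rightarrow> 'b) \<Rightarrow> 'b topology" where
  "quotient_topology X q =
     topology (\<lambda>U. U \<subseteq> q ` topspace X \<and> openin X {x \<in> topspace X. q x \<in> U})"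

lemma openin_quotient_topology:
  "openin (quotient_topology X q) U \<longleftrightarrow>
     U \<subseteq> q ` topspace X \<and> openin X {x \<in> topspace X. q x \<in> U}"
proof -
  let ?P = "\<lambda>U. U \<subseteq> q ` topspace X \<and> openin X {x \<in> topspace X. q x \<in> U}"
  have "istopology ?P"
    unfolding istopology_def
  proof (intro conjI allI impI)
    fix S T assume S: "?P S" and T: "?P T"
    have "{x \<in> topspace X. q x \<in> S \<inter> T} =
        {x \<in> topspace X. q x \<in> S} \<inter> {x \<in> topspace X. q x \<in> T}" by auto
    with S T show "openin X {x \<in> topspace X. q x \<in> S \<inter> T}" by (simp add: openin_Int)
    from S show "S \<inter> T \<subseteq> q ` topspace X" by auto
  next
    fix \<K> assume K: "\<forall>K\<in>\<K>. ?P K"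
    have "{x \<in> topspace X. q x \<in> \<Union>\<K>} = (\<Union>K\<in>\<K>. {x \<in> topspace X. q x \<in> K})" by auto
    with K show "openin X {x \<in> topspace X. q x \<in> \<Union>\<K>}" by auto
    from K show "\<Union>\<K> \<subseteq> q ` topspace X" by auto
  qed
  then show ?thesis
    unfolding quotient_topology_def by (simp add: topology_inverse')
qed

lemma topspace_quotient_topology [simp]:
  "topspace (quotient_topology X q) = q ` topspace X"
proof
  show "topspace (quotient_topology X q) \<subseteq> q ` topspace X"
    using openin_quotient_topology openin_topspace by metis
  have "{x \<in> topspace X. q x \<in> q ` topspace X} = topspace X" by auto
  then show "q ` topspace X \<subseteq> topspace (quotient_topology X q)"
    by (metis openin_quotient_topology openin_subset openin_topspace order_refl)
qed

lemma quotient_map_quotient_topology: "quotient_map X (quotient_topology X q) q"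
  by (auto simp: quotient_map_def openin_quotient_topology)

definition UConf :: "nat \<Rightarrow> nat \<Rightarrow> (nat \<Rightarrow> real \<times> real) set topology" where
  "UConf n w = quotient_topology (Conf n w) (relabel_orbit n)"


section \<open>Singular homology with rational coefficients\<close>

text \<open>
  The simplices and faces are those of the integral theory in \<^theory>\<open>HOL-Homology.Simplices\<close>; only
  the coefficients of the chains change. The ring fields \<open>mult\<close> and \<open>one\<close> of the module records below
  carry no meaning, as in \<^const>\<open>module_vec\<close>.
\<close>

type_synonym 'a rat_chain = "((nat \<Rightarrow> real) \<Rightarrow> 'a) \<Rightarrow>\<^sub>0 rat"

definition rat_chain_module :: "nat \<Rightarrow> 'a topology \<Rightarrow> (rat, 'a rat_chain) module" where
  "rat_chain_module p X =
     \<lparr>carrier = {c. Poly_Mapping.keys c \<subseteq> singular_simplex_set p X},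
      mult = undefined, one = undefined, zero = 0, add = (+),
      smult = (\<lambda>a. Poly_Mapping.map ((*) a))\<rparr>"

definition rat_chain_boundary :: "nat \<Rightarrow> 'a rat_chain \<Rightarrow> 'a rat_chain" where
  "rat_chain_boundary p c =
     (if p = 0 then 0 else
      \<Sum>f\<in>Poly_Mapping.keys c. \<Sum>i\<le>p.
        Poly_Mapping.single (singular_face p i f) ((-1) ^ i * Poly_Mapping.lookup c f))"

definition rat_cycle_module :: "nat \<Rightarrow> 'a topology \<Rightarrow> (rat, 'a rat_chain) module" where
  "rat_cycle_module p X =
     (rat_chain_module p X)
       \<lparr>carrier := {c \<in> carrier (rat_chain_module p X). rat_chain_boundary p c = 0}\<rparr>"

definition rat_boundaries :: "nat \<Rightarrow> 'a topology \<Rightarrow> 'a rat_chain set" where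
  "rat_boundaries p X = rat_chain_boundary (Suc p) ` carrier (rat_chain_module (Suc p) X)"

text \<open>
  The quotient of a module by a submodule. The scalar multiple of a coset is the union of the cosets
  of the multiples of its elements, so that \<open>0\<close> times a coset is \<open>N\<close> rather than a singleton.
\<close>

definition quotient_module :: "('r, 'm, 'x) module_scheme \<Rightarrow> 'm set \<Rightarrow> ('r, 'm set) module" where
  "quotient_module M N =
     \<lparr>carrier = a_rcosets\<^bsub>M\<^esub> N,
      mult = undefined, one = undefined, zero = N, add = set_add M,
      smult = (\<lambda>a C. \<Union>x\<in>C. N +>\<^bsub>M\<^esub> (a \<odot>\<^bsub>M\<^esub> x))\<rparr>"

definition rat_homology :: "nat \<Rightarrow> 'a topology \<Rightarrow> (rat, 'a rat_chain set) module" where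
  "rat_homology p X = quotient_module (rat_cycle_module p X) (rat_boundaries p X)"

definition module_isomorphic ::
  "('r, 'q) ring_scheme \<Rightarrow> ('r, 'm, 'x) module_scheme \<Rightarrow> ('r, 'n, 'y) module_scheme \<Rightarrow> bool" where
  "module_isomorphic R M N \<longleftrightarrow>
     (\<exists>f. f \<in> LinearCombinations.module_hom R M N \<and> bij_betw f (carrier M) (carrier N))"

end

theory Submission
  imports Defs
begin

text \<open>
  Forget the labels and record a configuration by the set of its centres; let \<open>C\<^sub>n\<close> be the space of such
  sets with the Hausdorff topology, which is homeomorphic to the orbit space
  (\<open>UConf_homeomorphic_config_space\<close>). The homology of \<open>C\<^sub>n\<close> is computed by looking at the rightmost
  disks.

  In a strip of width \<open>2\<close> at most two disks share a vertical line. So a configuration either has a unique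
  rightmost disk, or it ends in two stacked disks (\<open>configs_cover\<close>). Let \<open>A\<close> be the open set of
  configurations of the first kind, and let \<open>B\<close> be the neighbourhood of the others in which the last two
  disks have horizontal offset less than \<open>1/2\<close>. Nothing obstructs the rightmost disk of a configuration in
  \<open>A\<close> from moving away to the right, so \<open>A\<close> is homotopy equivalent to \<open>C\<^sub>n\<^sub>-\<^sub>1\<close> (\<open>last_split_homology\<close>). In
  the same way the last two disks of a configuration in \<open>B\<close> can be moved away together, so \<open>B\<close> is
  homotopy equivalent to \<open>C\<^sub>n\<^sub>-\<^sub>2\<close>, and so is each of the two parts of \<open>A \<inter> B\<close>, in which either the upper
  or the lower disk of the pair is further to the right (\<open>pair_split_homology\<close>). By excision
  \<open>H\<^sub>k(C\<^sub>n, A) = H\<^sub>k(B, A \<inter> B) = H\<^sub>k\<^sub>-\<^sub>1(C\<^sub>n\<^sub>-\<^sub>2)\<close> (\<open>relative_homology_two_sided\<close>).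

  The boundary map \<open>H\<^sub>k(C\<^sub>n, A) \<rightarrow> H\<^sub>k\<^sub>-\<^sub>1(A)\<close> is zero: a class of \<open>A \<inter> B\<close> that dies in \<open>B\<close> also dies in \<open>A\<close>,
  since the inclusion of \<open>A \<inter> B\<close> in \<open>A\<close> extends up to homotopy to \<open>B\<close>, by pulling the upper disk of the pair
  out to the right (\<open>homotopic_add_pair_spread_pos\<close>, \<open>homotopic_add_pair_spread_neg\<close>). Geometrically,
  the half turn that exchanges the last two disks is a loop because they are unlabelled. Hence there are short exact
  sequences \<open>0 \<rightarrow> H\<^sub>k(C\<^sub>n\<^sub>-\<^sub>1) \<rightarrow> H\<^sub>k(C\<^sub>n) \<rightarrow> H\<^sub>k\<^sub>-\<^sub>1(C\<^sub>n\<^sub>-\<^sub>2) \<rightarrow> 0\<close>. By induction all groups are free abelian, the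
  sequences split, and Pascal's rule shows that the rank is \<open>n - k\<close> over \<open>k\<close>
  (\<open>free_homology_configs\<close>).

  This computation is integral. A basis of a free integral homology group is a basis of the rational one,
  by clearing denominators (\<open>module_isomorphic_rat_homology\<close>).
\<close>

section \<open>Free abelian groups of finite rank\<close>


lemma free_Abelian_group_Un_decomposition:
  fixes c :: "'a \<Rightarrow>\<^sub>0 int"
  assumes "Poly_Mapping.keys c \<subseteq> S \<union> T"
  shows "\<exists>x y. Poly_Mapping.keys x \<subseteq> S \<and> Poly_Mapping.keys y \<subseteq> T \<and> c = x + y"
proof (rule free_Abelian_group_induct[OF assms])
  show "\<exists>x y. Poly_Mapping.keys x \<subseteq> S \<and> Poly_Mapping.keys y \<subseteq> T \<and> 0 = x + y"
    by (rule exI[of _ 0], rule exI[of _ 0]) simp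
next
  fix c d :: "'a \<Rightarrow>\<^sub>0 int"
  assume "\<exists>x y. Poly_Mapping.keys x \<subseteq> S \<and> Poly_Mapping.keys y \<subseteq> T \<and> c = x + y"
    "\<exists>x y. Poly_Mapping.keys x \<subseteq> S \<and> Poly_Mapping.keys y \<subseteq> T \<and> d = x + y"
  then obtain x y x' y' where *: "Poly_Mapping.keys x \<subseteq> S" "Poly_Mapping.keys y \<subseteq> T" "c = x + y"
    "Poly_Mapping.keys x' \<subseteq> S" "Poly_Mapping.keys y' \<subseteq> T" "d = x' + y'" by blast
  then have "Poly_Mapping.keys (x - x') \<subseteq> S" "Poly_Mapping.keys (y - y') \<subseteq> T"
    using keys_diff[of x x'] keys_diff[of y y'] by blast+
  moreover have "c - d = (x - x') + (y - y')" using * by simp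
  ultimately show "\<exists>x y. Poly_Mapping.keys x \<subseteq> S \<and> Poly_Mapping.keys y \<subseteq> T \<and> c - d = x + y" by blast
next
  fix a assume "a \<in> S \<union> T"
  then show "\<exists>x y. Poly_Mapping.keys x \<subseteq> S \<and> Poly_Mapping.keys y \<subseteq> T \<and> frag_of a = x + y"
  proof
    assume "a \<in> S"
    then have "Poly_Mapping.keys (frag_of a) \<subseteq> S \<and> Poly_Mapping.keys (0 :: 'a \<Rightarrow>\<^sub>0 int) \<subseteq> T \<and> frag_of a = frag_of a + 0"
      by simp
    then show ?thesis by blast
  next
    assume "a \<in> T"
    then have "Poly_Mapping.keys (0 :: 'a \<Rightarrow>\<^sub>0 int) \<subseteq> S \<and> Poly_Mapping.keys (frag_of a) \<subseteq> T \<and> frag_of a = 0 + frag_of a"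
      by simp
    then show ?thesis by blast
  qed
qed

lemma hom_eq_on_free_Abelian_group:
  fixes x :: "'c \<Rightarrow>\<^sub>0 int"
  assumes G: "group G" and h: "h \<in> hom (free_Abelian_group S) G" "h' \<in> hom (free_Abelian_group S) G"
    and eq: "\<And>i. i \<in> S \<Longrightarrow> h (frag_of i) = h' (frag_of i)"
    and x: "Poly_Mapping.keys x \<subseteq> S"
  shows "h x = h' x"
proof -
  interpret h: group_hom "free_Abelian_group S" G h
    using G h by (simp add: group_hom_def group_hom_axioms_def)
  interpret h': group_hom "free_Abelian_group S" G h'
    using G h by (simp add: group_hom_def group_hom_axioms_def)
  show ?thesis
  proof (rule free_Abelian_group_induct[OF x])
    show "h 0 = h' 0" using h.hom_one h'.hom_one by simp
  next
    fix x y :: "'c \<Rightarrow>\<^sub>0 int"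
    assume "Poly_Mapping.keys x \<subseteq> S" "Poly_Mapping.keys y \<subseteq> S" "h x = h' x" "h y = h' y"
    then show "h (x - y) = h' (x - y)"
      using h.hom_mult[of x "-y"] h'.hom_mult[of x "-y"] h.hom_inv[of y] h'.hom_inv[of y] by simp
  qed (use eq in auto)
qed

lemma iso_free_Abelian_group_disjoint_Un:
  assumes "S \<inter> T = {}"
  shows "(\<lambda>(x, y). x + y) \<in> iso (free_Abelian_group S \<times>\<times> free_Abelian_group T) (free_Abelian_group (S \<union> T))"
proof (rule isoI)
  show "(\<lambda>(x, y). x + y) \<in> hom (free_Abelian_group S \<times>\<times> free_Abelian_group T) (free_Abelian_group (S \<union> T))"
  proof (rule homI)
    fix z assume "z \<in> carrier (free_Abelian_group S \<times>\<times> free_Abelian_group T)"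
    then show "(case z of (x, y) \<Rightarrow> x + y) \<in> carrier (free_Abelian_group (S \<union> T))"
      using keys_add[of "fst z" "snd z"] by (simp add: DirProd_def case_prod_beta mem_Times_iff) blast
  qed (auto simp: DirProd_def)
  have "x = x' \<and> y = y'" if *: "Poly_Mapping.keys x \<subseteq> S" "Poly_Mapping.keys x' \<subseteq> S"
    "Poly_Mapping.keys y \<subseteq> T" "Poly_Mapping.keys y' \<subseteq> T" "x + y = x' + y'"
    for x y x' y' :: "'a \<Rightarrow>\<^sub>0 int"
  proof -
    have eq: "x - x' = y' - y" using *(5) by (simp add: algebra_simps)
    have "Poly_Mapping.keys (x - x') \<subseteq> S" "Poly_Mapping.keys (y' - y) \<subseteq> T"
      using * keys_diff[of x x'] keys_diff[of y' y] by blast+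
    then have "Poly_Mapping.keys (x - x') \<subseteq> S \<inter> T" unfolding eq by simp
    then have "x - x' = 0" using assms by simp
    then show ?thesis using eq by simp
  qed
  then have "inj_on (\<lambda>(x, y). x + y) (carrier (free_Abelian_group S \<times>\<times> free_Abelian_group T))"
    by (auto simp: inj_on_def DirProd_def)
  moreover have "(\<lambda>(x, y). x + y) ` carrier (free_Abelian_group S \<times>\<times> free_Abelian_group T)
      = carrier (free_Abelian_group (S \<union> T))"
  proof
    show "(\<lambda>(x, y). x + y) ` carrier (free_Abelian_group S \<times>\<times> free_Abelian_group T)
      \<subseteq> carrier (free_Abelian_group (S \<union> T))"
    proof (clarsimp simp: DirProd_def)
      fix a b x assume "Poly_Mapping.keys a \<subseteq> S" "Poly_Mapping.keys b \<subseteq> T" 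
         "x \<in> Poly_Mapping.keys (a + b)" "x \<notin> T"
      then show "x \<in> S" using keys_add[of a b] by blast
    qed
    show "carrier (free_Abelian_group (S \<union> T))
       \<subseteq> (\<lambda>(x, y). x + y) ` carrier (free_Abelian_group S \<times>\<times> free_Abelian_group T)"
    proof
      fix c assume "c \<in> carrier (free_Abelian_group (S \<union> T))"
      then obtain x y where "Poly_Mapping.keys x \<subseteq> S" "Poly_Mapping.keys y \<subseteq> T" "c = x + y"
        using free_Abelian_group_Un_decomposition[of c S T] by auto
      then show "c \<in> (\<lambda>(x, y). x + y) ` carrier (free_Abelian_group S \<times>\<times> free_Abelian_group T)"
        by (intro image_eqI[of _ _ "(x, y)"]) (auto simp: DirProd_def)
    qed
  qed
  ultimately show "bij_betw (\<lambda>(x, y). x + y) (carrier (free_Abelian_group S \<times>\<times> free_Abelian_group T))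
      (carrier (free_Abelian_group (S \<union> T)))"
    by (simp add: bij_betw_def)
qed

text \<open>
  The rank is part of the predicate, so that a chain of isomorphisms and extensions also computes
  the number of generators.
\<close>

definition free_of_rank :: "('a, 'b) monoid_scheme \<Rightarrow> nat \<Rightarrow> bool" where
  "free_of_rank G r \<longleftrightarrow> free_Abelian_group {..<r} \<cong> G"

lemma free_of_rank_iff:
  assumes "finite S" "card S = r"
  shows "free_of_rank G r \<longleftrightarrow> free_Abelian_group S \<cong> G"
proof -
  have "S \<approx> {..<r}" using assms by (metis card_lessThan eqpoll_iff_card finite_lessThan)
  then have "free_Abelian_group S \<cong> free_Abelian_group {..<r}" "free_Abelian_group {..<r} \<cong> free_Abelian_group S"
    by (simp_all add: isomorphic_free_Abelian_groups eqpoll_sym)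
  then show ?thesis
    unfolding free_of_rank_def using iso_trans[of "free_Abelian_group S" "free_Abelian_group {..<r}" G]
      iso_trans[of "free_Abelian_group {..<r}" "free_Abelian_group S" G] by argo
qed

lemma free_of_rank_iso: "free_of_rank G r \<Longrightarrow> G \<cong> H \<Longrightarrow> free_of_rank H r"
  unfolding free_of_rank_def by (rule iso_trans)

lemma free_of_rank_0:
  assumes "trivial_group G" shows "free_of_rank G 0"
proof -
  interpret G: group G using assms by (simp add: trivial_group_def)
  have "(\<lambda>_. \<one>\<^bsub>G\<^esub>) \<in> iso (free_Abelian_group ({} :: nat set)) G"
    using assms by (simp add: trivial_group_def iso_def hom_def bij_betw_def free_Abelian_group_def)
  then show ?thesis
    by (auto simp: free_of_rank_def is_iso_def)
qed

text \<open>
  A short exact sequence \<open>0 \<rightarrow> A \<rightarrow> U \<rightarrow> Q \<rightarrow> 0\<close> with \<open>Q\<close> free splits: lifting the basis of \<open>Q\<close> to \<open>U\<close>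
  gives a section \<open>s\<close>, and \<open>(x, y) \<mapsto> f x + s y\<close> identifies \<open>A \<oplus> Q\<close> with \<open>U\<close>. The basis of \<open>Q\<close> is
  indexed by \<open>{a..<a+b}\<close>, so that the two bases are disjoint and their union is \<open>{..<a+b}\<close>.
\<close>

lemma free_of_rank_short_exact:
  assumes U: "comm_group U" and Q: "comm_group Q"
    and f: "f \<in> hom A U" and g: "g \<in> hom U Q"
    and inj: "inj_on f (carrier A)" and surj: "g ` carrier U = carrier Q"
    and ex: "f ` carrier A = kernel U Q g"
    and rA: "free_of_rank A a" and rQ: "free_of_rank Q b"
  shows "free_of_rank U (a + b)"
proof -
  interpret U: comm_group U by fact
  interpret Q: comm_group Q by fact
  interpret g: group_hom U Q g using g by (simp add: group_hom_def group_hom_axioms_def)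
  let ?S = "{..<a}" and ?T = "{a..<a+b}"
  have "free_Abelian_group ?T \<cong> Q" using rQ free_of_rank_iff[of ?T b Q] by simp
  then obtain hQ where hQ: "hQ \<in> iso (free_Abelian_group ?T) Q" unfolding is_iso_def by blast
  obtain hA where hA: "hA \<in> iso (free_Abelian_group ?S) A" using rA unfolding free_of_rank_def is_iso_def by blast
  have "\<exists>u\<in>carrier U. g u = hQ (frag_of i)" if "i \<in> ?T" for i
  proof -
    have "hQ (frag_of i) \<in> carrier Q" using hQ that by (auto simp: iso_def hom_def)
    then show ?thesis using surj by (metis imageE)
  qed
  then obtain l where l: "\<And>i. i \<in> ?T \<Longrightarrow> l i \<in> carrier U" "\<And>i. i \<in> ?T \<Longrightarrow> g (l i) = hQ (frag_of i)"
    by metis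
  obtain s where s: "s \<in> hom (free_Abelian_group ?T) U" "\<And>i. i \<in> ?T \<Longrightarrow> s (frag_of i) = l i"
    using U.free_Abelian_group_universal[of l ?T] l(1) by blast
  interpret hQ: group_hom "free_Abelian_group ?T" Q hQ
    using hQ by (simp add: group_hom_def group_hom_axioms_def iso_def)
  interpret s: group_hom "free_Abelian_group ?T" U s
    using s by (simp add: group_hom_def group_hom_axioms_def)
  have gs: "g (s y) = hQ y" if "Poly_Mapping.keys y \<subseteq> ?T" for y
    using hom_eq_on_free_Abelian_group[of Q "g \<circ> s" ?T hQ y] hom_compose[OF s(1) g] s(2) l(2) hQ that
    by (auto simp: iso_def)
  let ?F = "free_Abelian_group ?S \<times>\<times> free_Abelian_group ?T"
  define \<phi> where "\<phi> = (\<lambda>(x, y). f (hA x) \<otimes>\<^bsub>U\<^esub> s y)"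
  have fh: "f \<circ> hA \<in> hom (free_Abelian_group ?S) U"
    using hA f by (auto simp: iso_def intro: hom_compose)
  interpret fh: group_hom "free_Abelian_group ?S" U "f \<circ> hA"
    using fh by (simp add: group_hom_def group_hom_axioms_def)
  have fhmem: "f (hA x) \<in> carrier U" if "Poly_Mapping.keys x \<subseteq> ?S" for x
    using fh.hom_closed[of x] that by simp
  have smem: "s x \<in> carrier U" if "Poly_Mapping.keys x \<subseteq> ?T" for x
    using s.hom_closed[of x] that by simp
  have gf: "g (f (hA x)) = \<one>\<^bsub>Q\<^esub>" if "Poly_Mapping.keys x \<subseteq> ?S" for x
  proof -
    have "hA x \<in> carrier A" using hA that by (auto simp: iso_def hom_def)
    then have "f (hA x) \<in> kernel U Q g" using ex by blast
    then show ?thesis by (simp add: kernel_def)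
  qed
  have hom: "\<phi> \<in> hom ?F U"
  proof (rule homI)
    show "\<phi> z \<in> carrier U" if "z \<in> carrier ?F" for z
      using that fhmem smem by (auto simp: \<phi>_def DirProd_def)
    show "\<phi> (z \<otimes>\<^bsub>?F\<^esub> w) = \<phi> z \<otimes>\<^bsub>U\<^esub> \<phi> w" if "z \<in> carrier ?F" "w \<in> carrier ?F" for z w
    proof -
      obtain x y x' y' where zw: "z = (x, y)" "w = (x', y')" by (metis surj_pair)
      then have k: "Poly_Mapping.keys x \<subseteq> ?S" "Poly_Mapping.keys y \<subseteq> ?T" 
        "Poly_Mapping.keys x' \<subseteq> ?S" "Poly_Mapping.keys y' \<subseteq> ?T"
        using that by (auto simp: DirProd_def)
      have "\<phi> (z \<otimes>\<^bsub>?F\<^esub> w) = f (hA (x + x')) \<otimes>\<^bsub>U\<^esub> s (y + y')"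
        by (simp add: \<phi>_def zw)
      also have "\<dots> = (f (hA x) \<otimes>\<^bsub>U\<^esub> f (hA x')) \<otimes>\<^bsub>U\<^esub> (s y \<otimes>\<^bsub>U\<^esub> s y')"
        using fh.hom_mult[of x x'] s.hom_mult[of y y'] k by simp
      also have "\<dots> = \<phi> z \<otimes>\<^bsub>U\<^esub> \<phi> w"
        using k fhmem smem by (simp add: \<phi>_def zw U.m_ac)
      finally show ?thesis .
    qed
  qed
  interpret \<phi>: group_hom ?F U \<phi>
    using hom by (simp add: group_hom_def group_hom_axioms_def DirProd_group)
  have "\<phi> \<in> iso ?F U"
    unfolding \<phi>.iso_iff
  proof (intro conjI ballI impI)
    show "carrier U \<subseteq> \<phi> ` carrier ?F"
      proof
        fix u assume u: "u \<in> carrier U"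
        then have "g u \<in> hQ ` carrier (free_Abelian_group ?T)"
          using hQ by (auto simp: iso_def bij_betw_def)
        then obtain y where y: "Poly_Mapping.keys y \<subseteq> ?T" "hQ y = g u"
          by (metis carrier_free_Abelian_group_iff imageE)
        then have "g (u \<otimes>\<^bsub>U\<^esub> inv\<^bsub>U\<^esub> s y) = \<one>\<^bsub>Q\<^esub>"
          using u smem gs by simp
        then have "u \<otimes>\<^bsub>U\<^esub> inv\<^bsub>U\<^esub> s y \<in> f ` carrier A"
          using ex u smem y(1) by (simp add: kernel_def)
        then obtain v where "v \<in> carrier A" "u \<otimes>\<^bsub>U\<^esub> inv\<^bsub>U\<^esub> s y = f v" by blast
        moreover have "hA ` carrier (free_Abelian_group ?S) = carrier A"
          using hA by (simp add: iso_def bij_betw_def)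
        then obtain x where "Poly_Mapping.keys x \<subseteq> ?S" "hA x = v"
          using \<open>v \<in> carrier A\<close> by (metis carrier_free_Abelian_group_iff imageE)
        ultimately have x: "Poly_Mapping.keys x \<subseteq> ?S" "f (hA x) = u \<otimes>\<^bsub>U\<^esub> inv\<^bsub>U\<^esub> s y"
          by simp_all
        then have "u = f (hA x) \<otimes>\<^bsub>U\<^esub> s y"
          using U.inv_solve_right[of "f (hA x)" u "s y"] u smem[OF y(1)] fhmem by simp
        then have "u = \<phi> (x, y)" "(x, y) \<in> carrier ?F"
          using x(1) y(1) by (simp_all add: \<phi>_def)
        then show "u \<in> \<phi> ` carrier ?F" by blast
      qed
  next
    fix z assume z: "z \<in> carrier ?F" "\<phi> z = \<one>\<^bsub>U\<^esub>"
    obtain x y where zxy: "z = (x, y)" by force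
    then have k: "Poly_Mapping.keys x \<subseteq> ?S" "Poly_Mapping.keys y \<subseteq> ?T" using z by (auto simp: DirProd_def)
    have e: "f (hA x) \<otimes>\<^bsub>U\<^esub> s y = \<one>\<^bsub>U\<^esub>" using z(2) by (simp add: zxy \<phi>_def)
    then have "g (f (hA x)) \<otimes>\<^bsub>Q\<^esub> g (s y) = \<one>\<^bsub>Q\<^esub>"
      using g.hom_mult[OF fhmem[OF k(1)] smem[OF k(2)]] by simp
    then have "hQ y = \<one>\<^bsub>Q\<^esub>" using gf gs k by simp
    moreover have "inj_on hQ (carrier (free_Abelian_group ?T))"
      using hQ by (simp add: iso_def bij_betw_def)
    ultimately have y: "y = 0"
      using k(2) hQ.hom_one inj_onD[of hQ "carrier (free_Abelian_group ?T)" y 0] by simp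
    then have "(f \<circ> hA) x = \<one>\<^bsub>U\<^esub>" using e s.hom_one fhmem[OF k(1)] by simp
    moreover have "inj_on (f \<circ> hA) (carrier (free_Abelian_group ?S))"
      using hA inj by (auto simp: iso_def bij_betw_def intro!: comp_inj_on)
    ultimately have "x = 0"
      using k(1) fh.hom_one inj_onD[of "f \<circ> hA" "carrier (free_Abelian_group ?S)" x 0] by simp
    then show "z = \<one>\<^bsub>?F\<^esub>" using y by (simp add: zxy)
  qed
  then have "?F \<cong> U" by (rule is_isoI)
  moreover have "free_Abelian_group (?S \<union> ?T) \<cong> ?F"
  proof (rule group.iso_sym)
    show "?F \<cong> free_Abelian_group (?S \<union> ?T)"
      by (rule is_isoI[OF iso_free_Abelian_group_disjoint_Un]) auto
  qed (simp add: DirProd_group)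
  ultimately have "free_Abelian_group (?S \<union> ?T) \<cong> U" by (rule iso_trans[rotated])
  moreover have "?S \<union> ?T = {..<a + b}" by auto
  ultimately show ?thesis by (simp add: free_of_rank_def)
qed

section \<open>From integral to rational homology\<close>


abbreviation rsmult :: "rat \<Rightarrow> 'a rat_chain \<Rightarrow> 'a rat_chain" where
  "rsmult a c \<equiv> Poly_Mapping.map ((*) a) c"

lemma lookup_rsmult [simp]: "Poly_Mapping.lookup (rsmult a c) f = a * Poly_Mapping.lookup c f"
  by (simp add: Poly_Mapping.map.rep_eq when_def)

lemma keys_rsmult: "Poly_Mapping.keys (rsmult a c) \<subseteq> Poly_Mapping.keys c"
  by (auto simp: in_keys_iff)

definition rat_of_chain :: "'a chain \<Rightarrow> 'a rat_chain" where
  "rat_of_chain c = Poly_Mapping.map rat_of_int c"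

lemma lookup_rat_of_chain [simp]: "Poly_Mapping.lookup (rat_of_chain c) f = rat_of_int (Poly_Mapping.lookup c f)"
  by (simp add: rat_of_chain_def Poly_Mapping.map.rep_eq when_def)

lemma keys_rat_of_chain [simp]: "Poly_Mapping.keys (rat_of_chain c) = Poly_Mapping.keys c"
  by (auto simp: in_keys_iff)

lemma rat_of_chain_inject: "rat_of_chain c = rat_of_chain d \<longleftrightarrow> c = d"
  by (metis lookup_rat_of_chain of_int_eq_iff poly_mapping_eqI)

lemma rat_of_chain_0 [simp]: "rat_of_chain 0 = 0"
  by (rule poly_mapping_eqI) simp

lemma rat_of_chain_add: "rat_of_chain (c + d) = rat_of_chain c + rat_of_chain d"
  by (rule poly_mapping_eqI) (simp add: lookup_add)

lemma rat_of_chain_sum: "rat_of_chain (sum c I) = (\<Sum>i\<in>I. rat_of_chain (c i))"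
  by (induction I rule: infinite_finite_induct) (simp_all add: rat_of_chain_add)

lemma rat_of_chain_cmul: "rat_of_chain (frag_cmul a c) = rsmult (rat_of_int a) (rat_of_chain c)"
  by (rule poly_mapping_eqI) simp

lemma rsmult_add: "rsmult a (c + d) = rsmult a c + rsmult a d"
  by (rule poly_mapping_eqI) (simp add: lookup_add algebra_simps)

lemma rsmult_diff: "rsmult a (c - d) = rsmult a c - rsmult a d"
  by (rule poly_mapping_eqI) (simp add: lookup_minus algebra_simps)

lemma rsmult_0 [simp]: "rsmult 0 c = 0" "rsmult a 0 = 0"
  by (rule poly_mapping_eqI, simp)+

lemma rsmult_sum: "rsmult a (sum c I) = (\<Sum>i\<in>I. rsmult a (c i))"
  by (induction I rule: infinite_finite_induct) (simp_all add: rsmult_add)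

lemma rsmult_rsmult: "rsmult a (rsmult b c) = rsmult (a * b) c"
  by (rule poly_mapping_eqI) simp

lemma rsmult_add_left: "rsmult (a + b) c = rsmult a c + rsmult b c"
  by (rule poly_mapping_eqI) (simp add: lookup_add algebra_simps)

lemma rsmult_1 [simp]: "rsmult 1 c = c"
  by (rule poly_mapping_eqI) simp

lemma rat_chain_boundary_superset:
  assumes "finite K" "Poly_Mapping.keys c \<subseteq> K" "p \<noteq> 0"
  shows "rat_chain_boundary p c =
    (\<Sum>f\<in>K. \<Sum>i\<le>p. Poly_Mapping.single (singular_face p i f) ((-1) ^ i * Poly_Mapping.lookup c f))"
  using assms unfolding rat_chain_boundary_def
  by (auto intro!: sum.mono_neutral_left simp: in_keys_iff)

lemma rat_chain_boundary_0 [simp]: "rat_chain_boundary p 0 = 0"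
  by (simp add: rat_chain_boundary_def)

lemma rat_chain_boundary_add:
  "rat_chain_boundary p (c + d) = rat_chain_boundary p c + rat_chain_boundary p d"
proof (cases "p = 0")
  case False
  let ?K = "Poly_Mapping.keys c \<union> Poly_Mapping.keys d"
  have "Poly_Mapping.keys (c + d) \<subseteq> ?K" by (rule keys_add)
  with False show ?thesis
    by (simp add: rat_chain_boundary_superset[of ?K] lookup_add distrib_left single_add sum.distrib)
qed (simp add: rat_chain_boundary_def)

lemma rsmult_single: "rsmult a (Poly_Mapping.single f b) = Poly_Mapping.single f (a * b)"
  by (rule poly_mapping_eqI) (simp add: lookup_single when_def)

lemma rat_chain_boundary_rsmult:
  "rat_chain_boundary p (rsmult a c) = rsmult a (rat_chain_boundary p c)"
proof (cases "p = 0")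
  case False
  have "rsmult a (\<Sum>i\<le>p. Poly_Mapping.single (singular_face p i f) ((-1) ^ i * Poly_Mapping.lookup c f))
     = (\<Sum>i\<le>p. Poly_Mapping.single (singular_face p i f) ((-1) ^ i * Poly_Mapping.lookup (rsmult a c) f))" for f
    by (simp add: rsmult_sum rsmult_single mult.left_commute)
  with False show ?thesis
    using keys_rsmult[of a c]
    by (simp only: rat_chain_boundary_superset[of "Poly_Mapping.keys c"] rsmult_sum finite_keys order_refl not_False_eq_True)
qed (simp add: rat_chain_boundary_def)

lemma rat_chain_boundary_of_chain:
  fixes c :: "'a chain"
  shows "rat_chain_boundary p (rat_of_chain c) = rat_of_chain (chain_boundary p c)"
proof (cases "p = 0")
  case False
  have *: "rat_of_chain (frag_of f) = Poly_Mapping.single f 1" for f :: "(nat \<Rightarrow> real) \<Rightarrow> 'a"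
    by (rule poly_mapping_eqI) (simp add: lookup_single when_def)
  have "rat_of_chain (frag_cmul a (\<Sum>i\<le>p. frag_cmul ((-1) ^ i) (frag_of (singular_face p i f))))
     = (\<Sum>i\<le>p. Poly_Mapping.single (singular_face p i f) ((-1) ^ i * rat_of_int a))" for a and f :: "(nat \<Rightarrow> real) \<Rightarrow> 'a"
    by (simp only: rat_of_chain_sum rat_of_chain_cmul * rsmult_sum rsmult_single)
       (simp add: mult.commute)
  with False show ?thesis
    by (simp add: rat_chain_boundary_def chain_boundary_def frag_extend_def rat_of_chain_sum)
qed (simp add: rat_chain_boundary_def chain_boundary_def)

text \<open>
  A chain has only finitely many coefficients, so the product of their denominators turns it into an
  integral chain. Through this lemma every statement about rational cycles and boundaries is reduced
  to one about integral chains.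
\<close>

lemma clear_denominators_chain:
  fixes c :: "'a rat_chain"
  obtains N :: int and d where "N > 0" "rat_of_chain d = rsmult (rat_of_int N) c"
    "Poly_Mapping.keys d \<subseteq> Poly_Mapping.keys c"
proof -
  define N where "N = (\<Prod>f\<in>Poly_Mapping.keys c. snd (quotient_of (Poly_Mapping.lookup c f)))"
  have N: "N > 0" unfolding N_def by (intro prod_pos) (simp add: quotient_of_denom_pos')
  have int: "rat_of_int N * Poly_Mapping.lookup c f \<in> \<int>" for f
  proof (cases "f \<in> Poly_Mapping.keys c")
    case True
    obtain a b where ab: "quotient_of (Poly_Mapping.lookup c f) = (a, b)" by force
    have "b dvd N" using True ab unfolding N_def by (metis dvd_prodI finite_keys snd_conv)
    then obtain m where "N = b * m" by blast
    moreover have "Poly_Mapping.lookup c f = rat_of_int a / rat_of_int b" "b > 0"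
      using ab by (rule quotient_of_div, rule quotient_of_denom_pos)
    ultimately have "rat_of_int N * Poly_Mapping.lookup c f = rat_of_int (m * a)" by simp
    then show ?thesis by (metis Ints_of_int)
  qed (simp add: in_keys_iff)
  define d where "d = Poly_Mapping.map (\<lambda>q. \<lfloor>rat_of_int N * q\<rfloor>) c"
  have d: "Poly_Mapping.lookup d f = \<lfloor>rat_of_int N * Poly_Mapping.lookup c f\<rfloor>" for f
    by (simp add: d_def Poly_Mapping.map.rep_eq when_def)
  have "rat_of_chain d = rsmult (rat_of_int N) c"
    by (rule poly_mapping_eqI) (use int in \<open>simp add: d\<close>)
  moreover have "Poly_Mapping.keys d \<subseteq> Poly_Mapping.keys c"
    by (auto simp: in_keys_iff d)
  ultimately show thesis using that N by blast
qed


lemma homology_class_hom: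
  "homologous_rel_set p X {} \<in> hom (relcycle_group p X {}) (homology_group (int p) X)"
proof -
  have "(\<lambda>a. singular_relboundary_set p X {} #>\<^bsub>relcycle_group p X {}\<^esub> a) \<in>
      hom (relcycle_group p X {}) (relcycle_group p X {} Mod singular_relboundary_set p X {})"
    using normal.r_coset_hom_Mod normal_subgroup_singular_relboundary_relcycle by blast
  then show ?thesis
    by (simp add: right_coset_singular_relboundary nontrivial_relative_homology_group)
qed

text \<open>
  An isomorphism from a free abelian group is spelled out as cycles \<open>z i\<close> that represent a basis: every
  cycle is an integral combination of them up to a boundary, and no nontrivial combination bounds.
  In this form the statement can be compared with rational chains.
\<close>

lemma free_homology_basis:
  assumes "free_of_rank (homology_group (int p) X) r"
  obtains z where
    "\<And>i. i < r \<Longrightarrow> singular_relcycle p X {} (z i)"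
    "\<And>c. singular_relcycle p X {} c \<Longrightarrow>
       \<exists>a. singular_relboundary p X {} (c - (\<Sum>i<r. frag_cmul (a i) (z i)))"
    "\<And>a i. singular_relboundary p X {} (\<Sum>i<r. frag_cmul (a i) (z i)) \<Longrightarrow> i < r \<Longrightarrow> a i = 0"
proof -
  let ?H = "homology_group (int p) X" and ?F = "free_Abelian_group {..<r}"
  let ?cls = "homologous_rel_set p X {}"
  obtain h where h: "h \<in> iso ?F ?H"
    using assms by (auto simp: free_of_rank_def is_iso_def)
  have "\<exists>c. singular_relcycle p X {} c \<and> ?cls c = h (frag_of i)" if "i < r" for i
  proof -
    have "h (frag_of i) \<in> carrier ?H" using h that by (auto simp: iso_def hom_def)
    then show ?thesis unfolding carrier_relative_homology_group by (rule imageE) auto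
  qed
  then have "\<forall>i\<in>{..<r}. \<exists>c. singular_relcycle p X {} c \<and> ?cls c = h (frag_of i)"
    by simp
  then obtain z where "\<forall>i\<in>{..<r}. singular_relcycle p X {} (z i) \<and> ?cls (z i) = h (frag_of i)"
    by (rule bchoice[THEN exE])
  then have z: "\<And>i. i < r \<Longrightarrow> singular_relcycle p X {} (z i)"
    "\<And>i. i < r \<Longrightarrow> ?cls (z i) = h (frag_of i)" by simp_all
  define \<phi> where "\<phi> = (\<lambda>a. \<Sum>i<r. frag_cmul (Poly_Mapping.lookup a i) (z i))"
  have \<phi>cyc: "singular_relcycle p X {} (\<phi> a)" for a
    unfolding \<phi>_def by (intro singular_relcycle_sum singular_relcycle_cmul z(1)) simp
  have "\<phi> \<in> hom ?F (relcycle_group p X {})"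
  proof (rule homI)
    show "\<phi> a \<in> carrier (relcycle_group p X {})" for a using \<phi>cyc by simp
    have "\<phi> (a + b) = \<phi> a + \<phi> b" for a b
      unfolding \<phi>_def by (simp only: lookup_add frag_cmul_distrib sum.distrib)
    then show "\<phi> (a \<otimes>\<^bsub>?F\<^esub> b) = \<phi> a \<otimes>\<^bsub>relcycle_group p X {}\<^esub> \<phi> b" for a b by simp
  qed
  then have hom: "?cls \<circ> \<phi> \<in> hom ?F ?H"
    using homology_class_hom by (rule hom_compose)
  have \<phi>_of: "\<phi> (frag_of i) = z i" if "i < r" for i
  proof -
    have "\<phi> (frag_of i) = (\<Sum>j<r. if i = j then z j else 0)"
      unfolding \<phi>_def by (intro sum.cong) simp_all
    then show ?thesis using that by simp
  qed
  have h\<phi>: "h a = ?cls (\<phi> a)" if "Poly_Mapping.keys a \<subseteq> {..<r}" for a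
  proof -
    have "h \<in> hom ?F ?H" using h by (simp add: iso_def)
    moreover have "h (frag_of i) = (?cls \<circ> \<phi>) (frag_of i)" if "i \<in> {..<r}" for i
      using that z(2) \<phi>_of by simp
    ultimately have "h a = (?cls \<circ> \<phi>) a"
      using hom_eq_on_free_Abelian_group[OF group_relative_homology_group _ hom _ that] by blast
    then show ?thesis by simp
  qed
  show thesis
  proof (rule that[of z])
    show "singular_relcycle p X {} (z i)" if "i < r" for i using z(1) that .
  next
    fix c assume "singular_relcycle p X {} c"
    then have "?cls c \<in> carrier ?H" unfolding carrier_relative_homology_group by blast
    moreover have "h ` carrier ?F = carrier ?H" using h by (simp add: iso_def bij_betw_def)
    ultimately have "?cls c \<in> h ` carrier ?F" by simp
    then obtain a where "?cls c = h a" "a \<in> carrier ?F" by (rule imageE)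
    then have a: "Poly_Mapping.keys a \<subseteq> {..<r}" "?cls c = h a" by simp_all
    then have "?cls c = ?cls (\<phi> a)" using h\<phi> by simp
    then have "singular_relboundary p X {} (c - \<phi> a)"
      unfolding homologous_rel_set_eq unfolding homologous_rel_def .
    then show "\<exists>a. singular_relboundary p X {} (c - (\<Sum>i<r. frag_cmul (a i) (z i)))"
      unfolding \<phi>_def by blast
  next
    fix a i assume a: "singular_relboundary p X {} (\<Sum>i<r. frag_cmul (a i) (z i))" and i: "i < r"
    define b where "b = (\<Sum>j<r. frag_cmul (a j) (frag_of j))"
    have b: "Poly_Mapping.lookup b j = a j" if "j < r" for j
    proof -
      have "Poly_Mapping.lookup b j = (\<Sum>l<r. if l = j then a l else 0)"
        unfolding b_def lookup_sum by (intro sum.cong) auto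
      then show ?thesis using that by simp
    qed
    have kb: "Poly_Mapping.keys b \<subseteq> {..<r}"
    proof
      fix j assume "j \<in> Poly_Mapping.keys b"
      show "j \<in> {..<r}"
      proof (rule ccontr)
        assume "j \<notin> {..<r}"
        then have "Poly_Mapping.lookup b j = 0"
          unfolding b_def lookup_sum by (intro sum.neutral) auto
        then show False using \<open>j \<in> Poly_Mapping.keys b\<close> by (simp add: in_keys_iff)
      qed
    qed
    have "\<phi> b = (\<Sum>i<r. frag_cmul (a i) (z i))" unfolding \<phi>_def using b by simp
    then have "?cls (\<phi> b) = singular_relboundary_set p X {}"
      using a by (simp only: homologous_rel_set_eq_relboundary)
    then have "h b = \<one>\<^bsub>?H\<^esub>" using h\<phi>[OF kb] by simp
    moreover have "h 0 = \<one>\<^bsub>?H\<^esub>"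
      using hom_one[of h ?F ?H] h by (simp add: iso_def)
    moreover have "inj_on h (carrier ?F)" using h by (simp add: iso_def bij_betw_def)
    ultimately have "b = 0" using kb inj_onD[of h "carrier ?F" b 0] by simp
    then show "a i = 0" using b[OF i] by simp
  qed
qed

lemma rat_combination_of_integral:
  "rat_of_chain (\<Sum>i<r. frag_cmul (a i) (z i)) = (\<Sum>i<r. rsmult (rat_of_int (a i)) (rat_of_chain (z i)))"
  by (simp add: rat_of_chain_sum rat_of_chain_cmul)

lemma mem_rat_boundaries:
  "c \<in> rat_boundaries p X \<longleftrightarrow>
    (\<exists>d. Poly_Mapping.keys d \<subseteq> singular_simplex_set (Suc p) X \<and> rat_chain_boundary (Suc p) d = c)"
  by (auto simp: rat_boundaries_def rat_chain_module_def)

lemma rat_boundaries_add: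
  assumes "c \<in> rat_boundaries p X" "d \<in> rat_boundaries p X"
  shows "c + d \<in> rat_boundaries p X"
proof -
  obtain c' d' where *: "Poly_Mapping.keys c' \<subseteq> singular_simplex_set (Suc p) X" "rat_chain_boundary (Suc p) c' = c"
    "Poly_Mapping.keys d' \<subseteq> singular_simplex_set (Suc p) X" "rat_chain_boundary (Suc p) d' = d"
    using assms unfolding mem_rat_boundaries by blast
  then have "Poly_Mapping.keys (c' + d') \<subseteq> singular_simplex_set (Suc p) X"
    using keys_add[of c' d'] by blast
  then show ?thesis
    unfolding mem_rat_boundaries using * rat_chain_boundary_add[of "Suc p" c' d'] by blast
qed

lemma rat_boundaries_rsmult:
  assumes "c \<in> rat_boundaries p X"
  shows "rsmult a c \<in> rat_boundaries p X"
proof -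
  obtain d where *: "Poly_Mapping.keys d \<subseteq> singular_simplex_set (Suc p) X" "rat_chain_boundary (Suc p) d = c"
    using assms unfolding mem_rat_boundaries by blast
  then have "Poly_Mapping.keys (rsmult a d) \<subseteq> singular_simplex_set (Suc p) X"
    using keys_rsmult[of a d] by blast
  then show ?thesis
    unfolding mem_rat_boundaries using * rat_chain_boundary_rsmult[of "Suc p" a d] by blast
qed

lemma rat_boundaries_0: "0 \<in> rat_boundaries p X"
  unfolding mem_rat_boundaries by (rule exI[of _ 0]) simp

lemma rat_boundaries_diff:
  assumes "c \<in> rat_boundaries p X" "d \<in> rat_boundaries p X"
  shows "c - d \<in> rat_boundaries p X"
proof -
  have "c + rsmult (-1) d = c - d" by (rule poly_mapping_eqI) (simp add: lookup_add lookup_minus)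
  then show ?thesis
    using rat_boundaries_add[OF assms(1) rat_boundaries_rsmult[OF assms(2), of "-1"]] by simp
qed

lemma rat_boundaries_of_chain:
  assumes "singular_relboundary p X {} c"
  shows "rat_of_chain c \<in> rat_boundaries p X"
proof -
  obtain d where "singular_chain (Suc p) X d" "chain_boundary (Suc p) d = c"
    using assms unfolding singular_boundary by blast
  then show ?thesis
    unfolding mem_rat_boundaries singular_chain_def
    by (intro exI[of _ "rat_of_chain d"]) (simp add: rat_chain_boundary_of_chain)
qed

definition rat_cycles :: "nat \<Rightarrow> 'a topology \<Rightarrow> 'a rat_chain set" where
  "rat_cycles p X = {c. Poly_Mapping.keys c \<subseteq> singular_simplex_set p X \<and> rat_chain_boundary p c = 0}"

lemma rat_cycles_of_chain:
  "rat_of_chain c \<in> rat_cycles p X \<longleftrightarrow> singular_relcycle p X {} c"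
proof -
  have "rat_of_chain (chain_boundary p c) = 0 \<longleftrightarrow> chain_boundary p c = 0"
    using rat_of_chain_inject[of "chain_boundary p c" 0] by simp
  then show ?thesis
    by (simp add: rat_cycles_def singular_cycle singular_chain_def rat_chain_boundary_of_chain)
qed

lemma rat_cycles_add:
  assumes "c \<in> rat_cycles p X" "d \<in> rat_cycles p X"
  shows "c + d \<in> rat_cycles p X"
  using assms keys_add[of c d] unfolding rat_cycles_def
  by (simp add: rat_chain_boundary_add) blast

lemma rat_cycles_rsmult:
  assumes "c \<in> rat_cycles p X"
  shows "rsmult a c \<in> rat_cycles p X"
  using assms keys_rsmult[of a c] unfolding rat_cycles_def
  by (simp add: rat_chain_boundary_rsmult) blast

lemma rat_cycles_0: "0 \<in> rat_cycles p X"
  by (simp add: rat_cycles_def)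

lemma rat_cycles_sum: "(\<And>i. i \<in> I \<Longrightarrow> f i \<in> rat_cycles p X) \<Longrightarrow> sum f I \<in> rat_cycles p X"
  by (induction I rule: infinite_finite_induct) (simp_all add: rat_cycles_add rat_cycles_0)

text \<open>
  A basis of the free integral homology stays a basis over the rationals. If \<open>N c\<close> is integral, its
  coefficients divided by \<open>N\<close> express \<open>c\<close>; and a rational relation becomes an integral relation
  after multiplication by a common denominator of its coefficients and of the chain that it bounds.
\<close>

lemma rational_basis_of_free_homology:
  assumes "free_of_rank (homology_group (int p) X) r"
  obtains w where
    "\<And>i. i < r \<Longrightarrow> w i \<in> rat_cycles p X"
    "\<And>c. c \<in> rat_cycles p X \<Longrightarrow> \<exists>a. c - (\<Sum>i<r. rsmult (a i) (w i)) \<in> rat_boundaries p X"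
    "\<And>a i. (\<Sum>i<r. rsmult (a i) (w i)) \<in> rat_boundaries p X \<Longrightarrow> i < r \<Longrightarrow> a i = 0"
proof -
  obtain z where z: "\<And>i. i < r \<Longrightarrow> singular_relcycle p X {} (z i)"
    and span: "\<And>c. singular_relcycle p X {} c \<Longrightarrow>
       \<exists>a. singular_relboundary p X {} (c - (\<Sum>i<r. frag_cmul (a i) (z i)))"
    and indep: "\<And>a i. singular_relboundary p X {} (\<Sum>i<r. frag_cmul (a i) (z i)) \<Longrightarrow> i < r \<Longrightarrow> a i = 0"
    by (rule free_homology_basis[OF assms]) blast
  define w where "w = (\<lambda>i. rat_of_chain (z i))"
  show thesis
  proof (rule that[of w])
    show "w i \<in> rat_cycles p X" if "i < r" for i
      using z[OF that] by (simp add: w_def rat_cycles_of_chain)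
  next
    fix c assume c: "c \<in> rat_cycles p X"
    obtain N d where N: "N > 0" "rat_of_chain d = rsmult (rat_of_int N) c"
      by (rule clear_denominators_chain)
    have "singular_relcycle p X {} d"
      using rat_cycles_rsmult[OF c, of "rat_of_int N"] unfolding N(2)[symmetric] rat_cycles_of_chain .
    then obtain a where "singular_relboundary p X {} (d - (\<Sum>i<r. frag_cmul (a i) (z i)))"
      using span by blast
    then have "rat_of_chain (d - (\<Sum>i<r. frag_cmul (a i) (z i))) \<in> rat_boundaries p X"
      by (rule rat_boundaries_of_chain)
    moreover have "rat_of_chain (d - (\<Sum>i<r. frag_cmul (a i) (z i)))
        = rsmult (rat_of_int N) c - (\<Sum>i<r. rsmult (rat_of_int (a i)) (w i))"
      using rat_of_chain_add[of "d - (\<Sum>i<r. frag_cmul (a i) (z i))" "\<Sum>i<r. frag_cmul (a i) (z i)"] N(2)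
      by (simp add: rat_combination_of_integral w_def algebra_simps)
    ultimately have "rsmult (1 / rat_of_int N)
        (rsmult (rat_of_int N) c - (\<Sum>i<r. rsmult (rat_of_int (a i)) (w i))) \<in> rat_boundaries p X"
      by (simp only: rat_boundaries_rsmult)
    moreover have "rsmult (1 / rat_of_int N)
        (rsmult (rat_of_int N) c - (\<Sum>i<r. rsmult (rat_of_int (a i)) (w i)))
        = c - (\<Sum>i<r. rsmult (rat_of_int (a i) / rat_of_int N) (w i))"
      using N(1) by (simp add: rsmult_diff rsmult_sum rsmult_rsmult)
    ultimately show "\<exists>a. c - (\<Sum>i<r. rsmult (a i) (w i)) \<in> rat_boundaries p X" by auto
  next
    fix a :: "nat \<Rightarrow> rat" and i assume bd: "(\<Sum>i<r. rsmult (a i) (w i)) \<in> rat_boundaries p X" and i: "i < r"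
    \<comment> \<open>\<open>N\<close> clears the coefficients of the relation; \<open>M\<close>, below, clears the bounding chain.\<close>
    define N where "N = (\<Prod>i<r. snd (quotient_of (a i)))"
    have N: "N > 0" unfolding N_def by (intro prod_pos) (simp add: quotient_of_denom_pos')
    have "\<exists>m. rat_of_int N * a j = rat_of_int m" if "j < r" for j
    proof -
      obtain x b where xb: "quotient_of (a j) = (x, b)" by force
      have "b dvd N" using that xb unfolding N_def by (metis dvd_prodI finite_lessThan lessThan_iff snd_conv)
      then obtain m where "N = b * m" by blast
      moreover have "a j = rat_of_int x / rat_of_int b" "b > 0"
        using xb by (rule quotient_of_div, rule quotient_of_denom_pos)
      ultimately have "rat_of_int N * a j = rat_of_int (m * x)" by simp
      then show ?thesis by blast
    qed
    then obtain m where m: "\<And>j. j < r \<Longrightarrow> rat_of_int N * a j = rat_of_int (m j)" by metis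
    obtain D where D: "Poly_Mapping.keys D \<subseteq> singular_simplex_set (Suc p) X"
      "rat_chain_boundary (Suc p) D = (\<Sum>i<r. rsmult (a i) (w i))"
      using bd unfolding mem_rat_boundaries by blast
    obtain M E where M: "M > 0" "rat_of_chain E = rsmult (rat_of_int M) D"
      "Poly_Mapping.keys E \<subseteq> Poly_Mapping.keys D"
      by (rule clear_denominators_chain)
    have "rat_of_chain (\<Sum>i<r. frag_cmul (M * m i) (z i))
       = (\<Sum>i<r. rsmult (rat_of_int M * (rat_of_int N * a i)) (w i))"
      unfolding rat_combination_of_integral w_def by (intro sum.cong) (simp_all add: m)
    also have "\<dots> = rsmult (rat_of_int N) (rsmult (rat_of_int M) (\<Sum>i<r. rsmult (a i) (w i)))"
      by (simp add: rsmult_sum rsmult_rsmult mult_ac)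
    also have "\<dots> = rat_of_chain (chain_boundary (Suc p) (frag_cmul N E))"
      unfolding D(2)[symmetric]
      by (simp add: chain_boundary_cmul rat_of_chain_cmul M(2) flip: rat_chain_boundary_rsmult rat_chain_boundary_of_chain)
    finally have "chain_boundary (Suc p) (frag_cmul N E) = (\<Sum>i<r. frag_cmul (M * m i) (z i))"
      by (simp only: rat_of_chain_inject)
    moreover have "singular_chain (Suc p) X (frag_cmul N E)"
      using M(3) D(1) by (intro singular_chain_cmul) (auto simp: singular_chain_def)
    ultimately have "singular_relboundary p X {} (\<Sum>i<r. frag_cmul (M * m i) (z i))"
      unfolding singular_boundary by blast
    then have "M * m i = 0" using indep[of "\<lambda>i. M * m i"] i by blast
    then show "a i = 0" using m[OF i] M(1) N by simp
  qed
qed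

text \<open>
  The isomorphism reads off the coordinates of a cycle with respect to the basis. Coordinates are
  linear and vanish exactly on the boundaries, so they are constant on cosets and separate them.
\<close>

lemma module_isomorphic_rat_homology:
  fixes X :: "'a topology"
  assumes fm: "free_of_rank (homology_group (int p) X) r"
  shows "module_isomorphic (class_ring :: rat ring) (rat_homology p X) (module_vec TYPE(rat) r)"
proof -
  obtain w where w: "\<And>i. i < r \<Longrightarrow> w i \<in> rat_cycles p X"
    and span: "\<And>c. c \<in> rat_cycles p X \<Longrightarrow> \<exists>a. c - (\<Sum>i<r. rsmult (a i) (w i)) \<in> rat_boundaries p X"
    and indep: "\<And>a i. (\<Sum>i<r. rsmult (a i) (w i)) \<in> rat_boundaries p X \<Longrightarrow> i < r \<Longrightarrow> a i = 0"
    by (rule rational_basis_of_free_homology[OF fm]) blast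
  let ?B = "rat_boundaries p X" and ?Z = "rat_cycles p X"
  \<comment> \<open>\<open>lc\<close> forms the linear combination with given coordinates, \<open>co\<close> is its inverse up to boundaries.\<close>
  define lc where "lc = (\<lambda>v. \<Sum>i<r. rsmult (v $ i) (w i))"
  have lc_add: "lc (u + v) = lc u + lc v" if "u \<in> carrier_vec r" "v \<in> carrier_vec r" for u v
    using that by (simp add: lc_def rsmult_add_left sum.distrib)
  have lc_smult: "lc (a \<cdot>\<^sub>v v) = rsmult a (lc v)" if "v \<in> carrier_vec r" for a v
    using that by (simp add: lc_def rsmult_sum rsmult_rsmult)
  have lc_cyc: "lc v \<in> ?Z" for v
    unfolding lc_def using w by (auto intro!: rat_cycles_sum rat_cycles_rsmult)
  have uniq: "u = v" if uv: "u \<in> carrier_vec r" "v \<in> carrier_vec r" and B: "lc u - lc v \<in> ?B" for u v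
  proof (rule eq_vecI)
    fix i assume "i < dim_vec v"
    then have i: "i < r" using uv by simp
    have "lc u - lc v = (\<Sum>i<r. rsmult (u $ i - v $ i) (w i))"
    proof -
      have "rsmult (u $ i - v $ i) (w i) = rsmult (u $ i) (w i) - rsmult (v $ i) (w i)" for i
        by (rule poly_mapping_eqI) (simp add: lookup_minus algebra_simps)
      then show ?thesis by (simp add: lc_def sum_subtractf)
    qed
    then show "u $ i = v $ i" using indep[of "\<lambda>i. u $ i - v $ i"] B i by simp
  qed (use uv in simp)
  have "\<exists>v\<in>carrier_vec r. c - lc v \<in> ?B" if c: "c \<in> ?Z" for c
  proof -
    obtain a where "c - (\<Sum>i<r. rsmult (a i) (w i)) \<in> ?B" using span[OF c] by blast
    then have "c - lc (vec r a) \<in> ?B" by (simp add: lc_def)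
    then show ?thesis by (intro bexI[of _ "vec r a"]) auto
  qed
  then obtain co where co: "\<And>c. c \<in> ?Z \<Longrightarrow> co c \<in> carrier_vec r" "\<And>c. c \<in> ?Z \<Longrightarrow> c - lc (co c) \<in> ?B"
    by metis
  have coI: "co c = v" if "c \<in> ?Z" "v \<in> carrier_vec r" "c - lc v \<in> ?B" for c v
  proof (rule uniq)
    show "lc (co c) - lc v \<in> ?B"
      using rat_boundaries_diff[OF that(3) co(2)[OF that(1)]] by simp
  qed (use that co in auto)
  have co_add: "co (c + d) = co c + co d" if "c \<in> ?Z" "d \<in> ?Z" for c d
  proof (rule coI)
    show "c + d - lc (co c + co d) \<in> ?B"
      using rat_boundaries_add[OF co(2)[OF that(1)] co(2)[OF that(2)]] co(1) that
      by (simp add: lc_add algebra_simps)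
  qed (use that co rat_cycles_add in auto)
  have co_smult: "co (rsmult a c) = a \<cdot>\<^sub>v co c" if "c \<in> ?Z" for a c
  proof (rule coI)
    show "rsmult a c - lc (a \<cdot>\<^sub>v co c) \<in> ?B"
      using rat_boundaries_rsmult[OF co(2)[OF that], of a] co(1) that
      by (simp add: lc_smult rsmult_diff)
  qed (use that co rat_cycles_rsmult in auto)
  have BZ: "b \<in> ?Z" if b: "b \<in> ?B" for b
  proof -
    obtain d where d: "Poly_Mapping.keys d \<subseteq> singular_simplex_set (Suc p) X" "rat_chain_boundary (Suc p) d = b"
      using b unfolding mem_rat_boundaries by blast
    obtain N e where N: "N > 0" "rat_of_chain e = rsmult (rat_of_int N) d"
      "Poly_Mapping.keys e \<subseteq> Poly_Mapping.keys d" by (rule clear_denominators_chain)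
    have "singular_relboundary p X {} (chain_boundary (Suc p) e)"
      using d N unfolding singular_boundary singular_chain_def by blast
    then have "rat_of_chain (chain_boundary (Suc p) e) \<in> ?Z"
      unfolding rat_cycles_of_chain by (rule singular_relboundary_imp_relcycle)
    then have "rsmult (rat_of_int N) b \<in> ?Z"
      by (simp only: rat_chain_boundary_of_chain[symmetric] N(2) rat_chain_boundary_rsmult d(2))
    then have "rsmult (1 / rat_of_int N) (rsmult (rat_of_int N) b) \<in> ?Z" by (rule rat_cycles_rsmult)
    then show ?thesis using N(1) by (simp add: rsmult_rsmult)
  qed
  have co_B: "co b = 0\<^sub>v r" if "b \<in> ?B" for b
  proof (rule coI)
    have "lc (0\<^sub>v r) = 0" by (simp add: lc_def)
    then show "b - lc (0\<^sub>v r) \<in> ?B" using that by simp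
  qed (use that BZ in auto)
  define coset where "coset = (\<lambda>c. {b + c | b. b \<in> ?B})"
  let ?M = "rat_cycle_module p X" and ?H = "rat_homology p X"
  have car: "carrier ?M = ?Z" "add ?M = (+)" "smult ?M = (\<lambda>a. rsmult a)"
    by (auto simp: rat_cycle_module_def rat_chain_module_def rat_cycles_def)
  have co_coset: "co x = co c" if c: "c \<in> ?Z" "x \<in> coset c" for x c
  proof -
    obtain b where "b \<in> ?B" "x = b + c" using c(2) unfolding coset_def by blast
    then show ?thesis using co_add[of b c] BZ c(1) co_B co(1) by simp
  qed
  have mem_coset: "c \<in> coset c" for c
    unfolding coset_def using rat_boundaries_0 by force
  have coset_cong: "coset c = coset d" if cd: "c - d \<in> ?B" for c d
  proof (intro Set.set_eqI iffI)
    fix x assume "x \<in> coset c"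
    then obtain b where "b \<in> ?B" "x = b + c" unfolding coset_def by blast
    then have "b + (c - d) \<in> ?B" "x = (b + (c - d)) + d" using rat_boundaries_add[OF _ cd] by auto
    then show "x \<in> coset d" unfolding coset_def by blast
  next
    fix x assume "x \<in> coset d"
    then obtain b where "b \<in> ?B" "x = b + d" unfolding coset_def by blast
    then have "b - (c - d) \<in> ?B" "x = (b - (c - d)) + c" using rat_boundaries_diff[OF _ cd] by auto
    then show "x \<in> coset c" unfolding coset_def by blast
  qed
  have a_r_coset: "?B +>\<^bsub>?M\<^esub> c = coset c" for c
    by (auto simp: a_r_coset_def r_coset_def coset_def car)
  have carH: "carrier ?H = coset ` ?Z"
    by (auto simp: rat_homology_def quotient_module_def A_RCOSETS_def' a_r_coset car(1))
  have addH: "coset c \<oplus>\<^bsub>?H\<^esub> coset d = coset (c + d)" for c d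
  proof -
    have "coset c \<oplus>\<^bsub>?H\<^esub> coset d = {x + y | x y. x \<in> coset c \<and> y \<in> coset d}"
      by (auto simp: rat_homology_def quotient_module_def set_add_def set_mult_def car)
    also have "\<dots> = coset (c + d)"
    proof (intro Set.set_eqI iffI)
      fix x assume "x \<in> {x + y | x y. x \<in> coset c \<and> y \<in> coset d}"
      then obtain b b' where "b \<in> ?B" "b' \<in> ?B" "x = (b + c) + (b' + d)" unfolding coset_def by blast
      then have "b + b' \<in> ?B" "x = (b + b') + (c + d)" using rat_boundaries_add by auto
      then show "x \<in> coset (c + d)" unfolding coset_def by blast
    next
      fix x assume "x \<in> coset (c + d)"
      then obtain b where "b \<in> ?B" "x = (b + c) + d" unfolding coset_def by (auto simp: add.assoc)
      then show "x \<in> {x + y | x y. x \<in> coset c \<and> y \<in> coset d}"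
        using mem_coset[of d] \<open>b \<in> ?B\<close> unfolding coset_def by blast
    qed
    finally show ?thesis .
  qed
  have smultH: "a \<odot>\<^bsub>?H\<^esub> coset c = coset (rsmult a c)" for a c
  proof -
    have "a \<odot>\<^bsub>?H\<^esub> coset c = (\<Union>x\<in>coset c. coset (rsmult a x))"
      by (simp add: rat_homology_def quotient_module_def a_r_coset car)
    also have "\<dots> = (\<Union>x\<in>coset c. coset (rsmult a c))"
    proof (intro SUP_cong refl coset_cong)
      fix x assume "x \<in> coset c"
      then obtain b where "b \<in> ?B" "x = b + c" unfolding coset_def by blast
      then show "rsmult a x - rsmult a c \<in> ?B" using rat_boundaries_rsmult by (simp add: rsmult_add)
    qed
    also have "\<dots> = coset (rsmult a c)" using mem_coset by blast
    finally show ?thesis .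
  qed
  define f where "f = (\<lambda>C. co (SOME x. x \<in> C))"
  have f: "f (coset c) = co c" if "c \<in> ?Z" for c
    unfolding f_def using co_coset[OF that] mem_coset by (metis someI)
  have "f \<in> LinearCombinations.module_hom class_ring ?H (module_vec TYPE(rat) r)"
    unfolding LinearCombinations.module_hom_def
    by (auto simp: carH addH smultH f co co_add co_smult module_vec_simps class_ring_simps
        rat_cycles_add rat_cycles_rsmult)
  moreover have "bij_betw f (carrier ?H) (carrier (module_vec TYPE(rat) r))"
    unfolding bij_betw_def
  proof
    show "inj_on f (carrier ?H)"
    proof (rule inj_onI)
      fix C D assume "C \<in> carrier ?H" "D \<in> carrier ?H" and eq: "f C = f D"
      then obtain c d where cd: "c \<in> ?Z" "d \<in> ?Z" "C = coset c" "D = coset d" by (auto simp: carH)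
      then have "co c = co d" using eq f by simp
      then have "c - d \<in> ?B" using rat_boundaries_diff[OF co(2)[OF cd(1)] co(2)[OF cd(2)]] by simp
      then show "C = D" using coset_cong cd by simp
    qed
    have "v \<in> f ` carrier ?H" if v: "v \<in> carrier_vec r" for v
    proof -
      have "co (lc v) = v" by (rule coI) (use v lc_cyc rat_boundaries_0 in auto)
      then have "f (coset (lc v)) = v" using f[OF lc_cyc] by simp
      moreover have "coset (lc v) \<in> carrier ?H" unfolding carH using lc_cyc by (rule imageI)
      ultimately show ?thesis by (metis imageI)
    qed
    then show "f ` carrier ?H = carrier (module_vec TYPE(rat) r)"
      by (auto simp: carH f co module_vec_simps)
  qed
  ultimately show ?thesis unfolding module_isomorphic_def by blast
qed

section \<open>The Hausdorff topology on sets of points\<close>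


text \<open>
  Unordered configurations are handled as sets of points, and convergence of sets is measured by the
  Hausdorff distance. Only the relation of being at distance less than \<open>e\<close> is needed. For sets whose
  points have mutual distance at least \<open>1\<close> and for \<open>e \<le> 1/2\<close> it says that the points can be matched
  so that partners are closer than \<open>e\<close>, which is convergence of configurations.
\<close>

definition hclose :: "real \<Rightarrow> 'a::metric_space set \<Rightarrow> 'a set \<Rightarrow> bool" where
  "hclose e S T \<longleftrightarrow> (\<forall>p\<in>S. \<exists>q\<in>T. dist p q < e) \<and> (\<forall>q\<in>T. \<exists>p\<in>S. dist p q < e)"

lemma hclose_refl: "0 < e \<Longrightarrow> hclose e S S"
  unfolding hclose_def by force

lemma hclose_sym: "hclose e S T \<Longrightarrow> hclose e T S"
  by (simp add: hclose_def dist_commute)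

lemma hclose_mono: "hclose d S T \<Longrightarrow> d \<le> e \<Longrightarrow> hclose e S T"
  unfolding hclose_def by force

lemma hclose_trans:
  assumes "hclose d S T" "hclose e T U"
  shows "hclose (d + e) S U"
  unfolding hclose_def
proof (intro conjI ballI)
  fix p assume "p \<in> S"
  then obtain q where "q \<in> T" "dist p q < d" using assms(1) unfolding hclose_def by blast
  moreover from \<open>q \<in> T\<close> obtain r where "r \<in> U" "dist q r < e"
    using assms(2) unfolding hclose_def by blast
  ultimately show "\<exists>r\<in>U. dist p r < d + e"
    using dist_triangle_less_add[of p q d r e] by (auto simp: dist_commute)
next
  fix r assume "r \<in> U"
  then obtain q where "q \<in> T" "dist q r < e" using assms(2) unfolding hclose_def by blast
  moreover from \<open>q \<in> T\<close> obtain p where "p \<in> S" "dist p q < d"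
    using assms(1) unfolding hclose_def by blast
  ultimately show "\<exists>p\<in>S. dist p r < d + e"
    using dist_triangle_less_add[of p q d r e] by (auto simp: dist_commute)
qed

lemma hclose_Un: "hclose e S S' \<Longrightarrow> hclose e T T' \<Longrightarrow> hclose e (S \<union> T) (S' \<union> T')"
  unfolding hclose_def by (metis UnE UnI1 UnI2)

definition hausdorff_topology :: "'a::metric_space set topology" where
  "hausdorff_topology = topology (\<lambda>V. \<forall>S\<in>V. \<exists>e>0. \<forall>T. hclose e S T \<longrightarrow> T \<in> V)"

lemma openin_hausdorff_topology:
  "openin hausdorff_topology V \<longleftrightarrow> (\<forall>S\<in>V. \<exists>e>0. \<forall>T. hclose e S T \<longrightarrow> T \<in> V)"
proof -
  have "istopology (\<lambda>V. \<forall>S\<in>V. \<exists>e>0. \<forall>T. hclose e S T \<longrightarrow> T \<in> (V :: 'a set set))"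
    unfolding istopology_def
  proof (intro conjI allI impI ballI)
    fix V W :: "'a set set" and S
    assume V: "\<forall>S\<in>V. \<exists>e>0. \<forall>T. hclose e S T \<longrightarrow> T \<in> V"
      and W: "\<forall>S\<in>W. \<exists>e>0. \<forall>T. hclose e S T \<longrightarrow> T \<in> W" and S: "S \<in> V \<inter> W"
    obtain d where "d > 0" "\<And>T. hclose d S T \<Longrightarrow> T \<in> V" using V S by blast
    moreover obtain e where "e > 0" "\<And>T. hclose e S T \<Longrightarrow> T \<in> W" using W S by blast
    moreover have "hclose d S T \<and> hclose e S T" if "hclose (min d e) S T" for T
      using that by (auto intro: hclose_mono[of "min d e"])
    ultimately show "\<exists>e>0. \<forall>T. hclose e S T \<longrightarrow> T \<in> V \<inter> W"
      by (intro exI[of _ "min d e"] conjI allI impI) simp_all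
  next
    fix \<K> :: "'a set set set" and S
    assume "\<forall>V\<in>\<K>. \<forall>S\<in>V. \<exists>e>0. \<forall>T. hclose e S T \<longrightarrow> T \<in> V" "S \<in> \<Union>\<K>"
    then show "\<exists>e>0. \<forall>T. hclose e S T \<longrightarrow> T \<in> \<Union>\<K>"
      by (metis UnionE UnionI)
  qed
  then show ?thesis
    unfolding hausdorff_topology_def by (simp add: topology_inverse')
qed

lemma topspace_hausdorff_topology [simp]: "topspace hausdorff_topology = UNIV"
proof -
  have "openin hausdorff_topology (UNIV :: 'a set set)"
    by (auto simp: openin_hausdorff_topology intro: exI[of _ 1])
  then show ?thesis
    using openin_subset by blast
qed

text \<open>
  The set \<open>{T. hclose e S T}\<close> itself may fail to be open when \<open>S\<close> is infinite; leaving a margin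
  \<open>d < e\<close> gives a neighbourhood that is open for every \<open>S\<close>.
\<close>

lemma openin_hausdorff_ball: "openin hausdorff_topology {T. \<exists>d<e. hclose d S T}"
  unfolding openin_hausdorff_topology
proof
  fix T assume "T \<in> {T. \<exists>d<e. hclose d S T}"
  then obtain d where d: "d < e" "hclose d S T" by blast
  show "\<exists>r>0. \<forall>T'. hclose r T T' \<longrightarrow> T' \<in> {T. \<exists>d<e. hclose d S T}"
  proof (intro exI[of _ "(e - d) / 2"] conjI allI impI)
    fix T' assume "hclose ((e - d) / 2) T T'"
    then have "hclose (d + (e - d) / 2) S T'" using d(2) hclose_trans by blast
    moreover have "d + (e - d) / 2 < e" using d(1) by (simp add: field_simps)
    ultimately show "T' \<in> {T. \<exists>d<e. hclose d S T}" by blast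
  qed (use d in simp)
qed

lemma openin_subtopology_hausdorff:
  "openin (subtopology hausdorff_topology X) V \<longleftrightarrow>
     V \<subseteq> X \<and> (\<forall>S\<in>V. \<exists>e>0. \<forall>T\<in>X. hclose e S T \<longrightarrow> T \<in> V)" (is "?L \<longleftrightarrow> ?R")
proof
  assume ?L
  then obtain W where W: "openin hausdorff_topology W" "V = W \<inter> X"
    by (auto simp: openin_subtopology)
  show ?R
  proof (intro conjI ballI)
    fix S assume "S \<in> V"
    then obtain e where "e > 0" "\<forall>T. hclose e S T \<longrightarrow> T \<in> W"
      using W unfolding openin_hausdorff_topology by blast
    then show "\<exists>e>0. \<forall>T\<in>X. hclose e S T \<longrightarrow> T \<in> V"
      using W(2) by blast
  qed (use W in simp)
next
  assume R: ?R
  then obtain r where r: "\<And>S. S \<in> V \<Longrightarrow> r S > 0" "\<And>S T. S \<in> V \<Longrightarrow> T \<in> X \<Longrightarrow> hclose (r S) S T \<Longrightarrow> T \<in> V"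
    by metis
  define W where "W = (\<Union>S\<in>V. {T. \<exists>d<r S. hclose d S T})"
  have "openin hausdorff_topology W"
    unfolding W_def by (intro openin_Union ballI) (auto simp: openin_hausdorff_ball)
  moreover have "V = W \<inter> X"
  proof
    show "V \<subseteq> W \<inter> X"
    proof
      fix S assume S: "S \<in> V"
      then have "r S / 2 < r S" "hclose (r S / 2) S S" using r(1) by (auto intro: hclose_refl)
      then show "S \<in> W \<inter> X" using S R unfolding W_def by blast
    qed
    show "W \<inter> X \<subseteq> V"
      unfolding W_def using r(2) hclose_mono less_imp_le by blast
  qed
  ultimately show ?L by (auto simp: openin_subtopology)
qed

lemma continuous_map_into_hausdorff:
  "continuous_map Z hausdorff_topology f \<longleftrightarrow>
    (\<forall>x\<in>topspace Z. \<forall>e>0. \<exists>U. openin Z U \<and> x \<in> U \<and> (\<forall>y\<in>U. hclose e (f x) (f y)))" (is "?L \<longleftrightarrow> ?R")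
proof
  assume L: ?L
  show ?R
  proof (intro ballI allI impI)
    fix x and e :: real assume x: "x \<in> topspace Z" "e > 0"
    let ?U = "{y \<in> topspace Z. f y \<in> {T. \<exists>d<e. hclose d (f x) T}}"
    have "openin Z ?U" using L openin_hausdorff_ball by (rule openin_continuous_map_preimage)
    moreover have "x \<in> ?U" using x by (auto intro!: exI[of _ "e/2"] hclose_refl)
    ultimately show "\<exists>U. openin Z U \<and> x \<in> U \<and> (\<forall>y\<in>U. hclose e (f x) (f y))"
      using hclose_mono less_imp_le by (intro exI[of _ ?U]) blast
  qed
next
  assume R: ?R
  show ?L
    unfolding continuous_map
  proof (intro conjI allI impI)
    fix V :: "'b set set" assume V: "openin hausdorff_topology V"
    show "openin Z {x \<in> topspace Z. f x \<in> V}"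
    proof (subst openin_subopen, intro ballI)
      fix x assume "x \<in> {x \<in> topspace Z. f x \<in> V}"
      then have x: "x \<in> topspace Z" "f x \<in> V" by auto
      then obtain e where e: "e > 0" "\<forall>T. hclose e (f x) T \<longrightarrow> T \<in> V"
        using V unfolding openin_hausdorff_topology by meson
      then obtain U where U: "openin Z U" "x \<in> U" "\<forall>y\<in>U. hclose e (f x) (f y)"
        using R x(1) by meson
      moreover have "U \<subseteq> {x \<in> topspace Z. f x \<in> V}"
        using e(2) U(3) openin_subset[OF U(1)] by auto
      ultimately show "\<exists>T. openin Z T \<and> x \<in> T \<and> T \<subseteq> {x \<in> topspace Z. f x \<in> V}"
        by meson
    qed
  qed auto
qed

lemma continuous_map_hausdorff_insert:
  assumes "continuous_map Z hausdorff_topology f" "continuous_map Z euclidean g"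
  shows "continuous_map Z hausdorff_topology (\<lambda>z. insert (g z) (f z))"
  unfolding continuous_map_into_hausdorff
proof (intro ballI allI impI)
  fix x and e :: real assume x: "x \<in> topspace Z" and e: "e > 0"
  obtain U where U: "openin Z U" "x \<in> U" "\<forall>y\<in>U. hclose e (f x) (f y)"
    using assms(1) x e unfolding continuous_map_into_hausdorff by blast
  let ?V = "{y \<in> topspace Z. g y \<in> ball (g x) e}"
  have "openin Z ?V" using assms(2) by (rule openin_continuous_map_preimage) simp
  then have "openin Z (U \<inter> ?V)" using U(1) by blast
  moreover have "x \<in> U \<inter> ?V" using U x e by simp
  moreover have "hclose e (insert (g x) (f x)) (insert (g y) (f y))" if "y \<in> U \<inter> ?V" for y
  proof -
    have "hclose e {g x} {g y}" using that by (simp add: hclose_def)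
    then show ?thesis using hclose_Un[of e "{g x}" "{g y}" "f x" "f y"] U(3) that by simp
  qed
  ultimately show "\<exists>U. openin Z U \<and> x \<in> U \<and> (\<forall>y\<in>U. hclose e (insert (g x) (f x)) (insert (g y) (f y)))"
    by blast
qed

text \<open>
  All homotopies below move one or two disks along straight segments while the other disks, which form
  the first component, stay fixed.
\<close>

lemma homotopic_with_linear_snd:
  fixes g g' :: "'a \<Rightarrow> 'v::real_normed_vector"
  assumes f: "continuous_map X Y f" and g: "continuous_map X euclidean g"
    and g': "continuous_map X euclidean g'"
    and E: "\<And>x t. x \<in> topspace X \<Longrightarrow> 0 \<le> t \<Longrightarrow> t \<le> 1 \<Longrightarrow> (f x, (1 - t) *\<^sub>R g x + t *\<^sub>R g' x) \<in> E"
  shows "homotopic_with (\<lambda>_. True) X (subtopology (prod_topology Y euclidean) E)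
           (\<lambda>x. (f x, g x)) (\<lambda>x. (f x, g' x))"
  unfolding homotopic_with_def
proof (intro exI conjI)
  let ?h = "\<lambda>z. (f (snd z), (1 - fst z) *\<^sub>R g (snd z) + fst z *\<^sub>R g' (snd z))"
  let ?I = "prod_topology (top_of_set {0..1::real}) X"
  have t: "continuous_map ?I euclideanreal fst"
    using continuous_map_fst[of "top_of_set {0..1::real}" X] continuous_map_in_subtopology by blast
  have *: "continuous_map ?I euclidean (\<lambda>z. (1 - fst z) *\<^sub>R g (snd z) + fst z *\<^sub>R g' (snd z))"
  proof -
    have 1: "continuous_map ?I euclidean (\<lambda>z. g (snd z))" "continuous_map ?I euclidean (\<lambda>z. g' (snd z))"
      using continuous_map_compose[OF continuous_map_snd g] continuous_map_compose[OF continuous_map_snd g']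
      by (auto simp: o_def)
    have "continuous_map ?I (prod_topology euclidean (prod_topology euclidean euclidean)) (\<lambda>z. (fst z, g (snd z), g' (snd z)))"
      by (intro continuous_map_pairedI t 1)
    then have 2: "continuous_map ?I euclidean (\<lambda>z. (fst z, g (snd z), g' (snd z)))" by simp
    have 3: "continuous_map euclidean euclidean (\<lambda>(t::real, a::'v, b). (1 - t) *\<^sub>R a + t *\<^sub>R b)"
      by (auto simp: case_prod_beta intro!: continuous_intros)
    show ?thesis using continuous_map_compose[OF 2 3] by (simp add: o_def)
  qed
  have "continuous_map ?I Y (\<lambda>z. f (snd z))"
    using continuous_map_compose[OF continuous_map_snd f] by (auto simp: o_def)
  then show "continuous_map ?I (subtopology (prod_topology Y euclidean) E) ?h"
    using * E by (auto simp: continuous_map_in_subtopology continuous_map_pairedI)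
qed (auto)

section \<open>Unordered configurations as finite sets of points\<close>


definition strip :: "(real \<times> real) set" where
  "strip = {p. 1 / 2 \<le> snd p \<and> snd p \<le> 3 / 2}"

definition apart :: "real \<times> real \<Rightarrow> real \<times> real \<Rightarrow> bool" where
  "apart p q \<longleftrightarrow> 1 \<le> (fst p - fst q)\<^sup>2 + (snd p - snd q)\<^sup>2"

lemma apart_iff_dist: "apart p q \<longleftrightarrow> 1 \<le> dist p q"
  by (simp add: apart_def dist_prod_def dist_real_def)

lemma apart_commute: "apart p q \<longleftrightarrow> apart q p"
  by (simp add: apart_iff_dist dist_commute)

lemma apart_neq: "apart p q \<Longrightarrow> p \<noteq> q"
  by (auto simp: apart_iff_dist)

text \<open>
  The unordered configurations of \<open>n\<close> unit-diameter disks in the strip of width \<open>2\<close>, given by the set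
  of their centres.
\<close>

definition configs :: "nat \<Rightarrow> (real \<times> real) set set" where
  "configs n = {S. finite S \<and> card S = n \<and> S \<subseteq> strip \<and> (\<forall>p\<in>S. \<forall>q\<in>S. p \<noteq> q \<longrightarrow> apart p q)}"

lemma configsD:
  assumes "S \<in> configs n"
  shows "finite S" "card S = n" "\<And>p. p \<in> S \<Longrightarrow> p \<in> strip"
    "\<And>p q. p \<in> S \<Longrightarrow> q \<in> S \<Longrightarrow> p \<noteq> q \<Longrightarrow> apart p q"
  using assms unfolding configs_def by auto

lemma insert_in_configs:
  assumes "S \<in> configs n" "p \<in> strip" "\<And>q. q \<in> S \<Longrightarrow> apart p q"
  shows "insert p S \<in> configs (Suc n)"
proof -
  have "p \<notin> S" using assms(3) apart_neq by blast
  then show ?thesis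
    using assms apart_commute unfolding configs_def by auto
qed

lemma configs_subset:
  assumes "S \<in> configs n" "T \<subseteq> S" "card T = m"
  shows "T \<in> configs m"
  using assms finite_subset[OF assms(2)] unfolding configs_def by blast

text \<open>
  Since distinct points of a configuration have distance at least \<open>1\<close>, moving each point by less than
  \<open>1/2\<close> cannot make two points meet the same partner.
\<close>

lemma hclose_matching:
  assumes S: "S \<in> configs m" and T: "T \<in> configs n" and d: "d \<le> 1 / 2" and ST: "hclose d S T"
  obtains f where "bij_betw f S T" "\<And>p. p \<in> S \<Longrightarrow> dist p (f p) < d"
proof -
  have "\<forall>p\<in>S. \<exists>q. q \<in> T \<and> dist p q < d" using ST unfolding hclose_def by blast
  then obtain f where f: "\<forall>p\<in>S. f p \<in> T \<and> dist p (f p) < d" by (rule bchoice[THEN exE])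
  have "inj_on f S"
  proof (rule inj_onI, rule ccontr)
    fix p q assume pq: "p \<in> S" "q \<in> S" "f p = f q" "p \<noteq> q"
    have "dist p q \<le> dist p (f p) + dist q (f p)" by (rule dist_triangle2)
    also have "\<dots> < d + d" using f pq by (metis add_strict_mono)
    finally show False using configsD(4)[OF S pq(1,2,4)] d by (simp add: apart_iff_dist)
  qed
  moreover have "f ` S = T"
  proof
    show "f ` S \<subseteq> T" using f by blast
    show "T \<subseteq> f ` S"
    proof
      fix q assume q: "q \<in> T"
      then obtain p where p: "p \<in> S" "dist p q < d" using ST unfolding hclose_def by blast
      have "dist q (f p) \<le> dist p q + dist p (f p)" using dist_triangle3 by blast
      also have "\<dots> < d + d" using f p by (meson add_strict_mono)
      finally have "\<not> apart q (f p)" using d by (simp add: apart_iff_dist)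
      then have "q = f p" using configsD(4)[OF T q] f p(1) by blast
      then show "q \<in> f ` S" using p(1) by blast
    qed
  qed
  ultimately show thesis using that f unfolding bij_betw_def by blast
qed

lemma conf_set_iff:
  "c \<in> conf_set n 2 \<longleftrightarrow> c \<in> {..<n} \<rightarrow>\<^sub>E UNIV \<and> inj_on c {..<n} \<and> c ` {..<n} \<in> configs n"
proof -
  have ap: "(fst (c i) - fst (c j))\<^sup>2 + (snd (c i) - snd (c j))\<^sup>2 \<ge> 1 \<longleftrightarrow> apart (c i) (c j)" for i j
    by (simp add: apart_def)
  show ?thesis
  proof
    assume c: "c \<in> conf_set n 2"
    have apc: "apart (c i) (c j)" if "i < n" "j < n" "i \<noteq> j" for i j
      using c that by (simp add: conf_set_def ap)
    then have inj: "inj_on c {..<n}" by (auto simp: inj_on_def dest: apart_neq)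
    moreover have "c ` {..<n} \<in> configs n"
      using c inj apc unfolding conf_set_def configs_def strip_def by (simp add: card_image image_subset_iff) blast
    ultimately show "c \<in> {..<n} \<rightarrow>\<^sub>E UNIV \<and> inj_on c {..<n} \<and> c ` {..<n} \<in> configs n"
      using c unfolding conf_set_def by blast
  next
    assume c: "c \<in> {..<n} \<rightarrow>\<^sub>E UNIV \<and> inj_on c {..<n} \<and> c ` {..<n} \<in> configs n"
    have "apart (c i) (c j)" if ij: "i < n" "j < n" "i \<noteq> j" for i j
    proof -
      have "c i \<noteq> c j" using c ij by (auto simp: inj_on_def)
      then show ?thesis using configsD(4)[of "c ` {..<n}"] c ij by blast
    qed
    moreover have "1 / 2 \<le> snd (c i) \<and> snd (c i) \<le> 3 / 2" if "i < n" for i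
      using configsD(3)[of "c ` {..<n}" n "c i"] c that by (auto simp: strip_def)
    ultimately show "c \<in> conf_set n 2"
      using c by (simp add: conf_set_def apart_def)
  qed
qed

lemma relabel_orbit_eq_iff:
  assumes c: "c \<in> conf_set n 2" and d: "d \<in> conf_set n 2"
  shows "relabel_orbit n c = relabel_orbit n d \<longleftrightarrow> c ` {..<n} = d ` {..<n}"
proof
  assume "relabel_orbit n c = relabel_orbit n d"
  moreover have "c \<in> relabel_orbit n c"
  proof -
    have "c = c \<circ> id \<and> id permutes {..<n}" by (simp add: permutes_id)
    then show ?thesis unfolding relabel_orbit_def by blast
  qed
  ultimately obtain \<sigma> where "\<sigma> permutes {..<n}" "c = d \<circ> \<sigma>"
    unfolding relabel_orbit_def by blast
  then show "c ` {..<n} = d ` {..<n}" using permutes_image[of \<sigma> "{..<n}"] by (metis image_comp)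
next
  have *: "relabel_orbit n c \<subseteq> relabel_orbit n d"
    if c: "c \<in> conf_set n 2" and d: "d \<in> conf_set n 2" and im: "c ` {..<n} = d ` {..<n}" for c d :: "nat \<Rightarrow> real \<times> real"
  proof -
    have c': "c \<in> {..<n} \<rightarrow>\<^sub>E UNIV" "inj_on c {..<n}" and d': "d \<in> {..<n} \<rightarrow>\<^sub>E UNIV" "inj_on d {..<n}"
      using c d conf_set_iff by blast+
    define \<tau> where "\<tau> = (\<lambda>i. if i < n then the_inv_into {..<n} d (c i) else i)"
    have "bij_betw (the_inv_into {..<n} d \<circ> c) {..<n} {..<n}"
      using c'(2) d'(2) im bij_betw_the_inv_into[of d "{..<n}" "d ` {..<n}"]
      by (intro bij_betw_trans[of c _ "d ` {..<n}"]) (simp_all add: bij_betw_def)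
    then have "bij_betw \<tau> {..<n} {..<n}"
      by (rule bij_betw_cong[THEN iffD1, rotated]) (simp add: \<tau>_def)
    then have \<tau>: "\<tau> permutes {..<n}"
      by (rule bij_imp_permutes) (simp add: \<tau>_def)
    have dt: "c = d \<circ> \<tau>"
    proof
      fix i
      show "c i = (d \<circ> \<tau>) i"
      proof (cases "i < n")
        case True
        then have "c i \<in> d ` {..<n}" using im by blast
        then show ?thesis using True d'(2) by (simp add: \<tau>_def f_the_inv_into_f)
      next
        case False
        then have "c i = undefined" "d i = undefined" using c'(1) d'(1) by (auto simp: PiE_iff extensional_def)
        then show ?thesis using False by (simp add: \<tau>_def)
      qed
    qed
    show ?thesis
    proof
      fix x assume "x \<in> relabel_orbit n c"
      then obtain \<sigma> where s: "\<sigma> permutes {..<n}" "x = c \<circ> \<sigma>" unfolding relabel_orbit_def by blast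
      then have "x = d \<circ> (\<tau> \<circ> \<sigma>)" "(\<tau> \<circ> \<sigma>) permutes {..<n}"
        using permutes_compose[OF s(1) \<tau>] by (simp_all add: dt comp_assoc)
      then show "x \<in> relabel_orbit n d" unfolding relabel_orbit_def by blast
    qed
  qed
  assume im: "c ` {..<n} = d ` {..<n}"
  show "relabel_orbit n c = relabel_orbit n d"
    using *[OF c d im] *[OF d c im[symmetric]] by (rule subset_antisym)
qed

lemma continuous_map_hausdorff_image:
  assumes "\<And>i. i < n \<Longrightarrow> continuous_map X euclidean (\<lambda>x. f x i)"
  shows "continuous_map X hausdorff_topology (\<lambda>x. f x ` {..<n::nat})"
  using assms
proof (induction n)
  case (Suc n)
  then have "continuous_map X hausdorff_topology (\<lambda>x. insert (f x n) (f x ` {..<n}))"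
    by (intro continuous_map_hausdorff_insert) simp_all
  then show ?case by (simp add: lessThan_Suc)
qed simp

lemma openin_Conf_nhd:
  assumes "openin (Conf n w) W" "c \<in> W"
  obtains e where "e > 0" "\<And>d. d \<in> conf_set n w \<Longrightarrow> (\<And>i. i < n \<Longrightarrow> dist (c i) (d i) < e) \<Longrightarrow> d \<in> W"
proof -
  obtain T where T: "openin (product_topology (\<lambda>_. euclidean) {..<n}) T" "W = T \<inter> conf_set n w"
    using assms(1) unfolding Conf_def openin_subtopology by blast
  then obtain U where U: "\<forall>i\<in>{..<n}. open (U i)" "c \<in> Pi\<^sub>E {..<n} U" "Pi\<^sub>E {..<n} U \<subseteq> T"
    using assms(2) unfolding openin_product_topology_alt by auto
  have "\<forall>i\<in>{..<n}. \<exists>e. e > 0 \<and> ball (c i) e \<subseteq> U i"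
  proof
    fix i assume i: "i \<in> {..<n}"
    then have "open (U i)" "c i \<in> U i" using U by auto
    then show "\<exists>e. e > 0 \<and> ball (c i) e \<subseteq> U i" using open_contains_ball by blast
  qed
  then obtain e where e: "\<forall>i\<in>{..<n}. e i > 0 \<and> ball (c i) (e i) \<subseteq> U i" by (rule bchoice[THEN exE])
  define E where "E = Min (insert 1 (e ` {..<n}))"
  have E: "E > 0" unfolding E_def by (subst Min_gr_iff) (use e in auto)
  have Ee: "E \<le> e i" if "i < n" for i unfolding E_def by (rule Min_le) (use that in auto)
  show thesis
  proof (rule that[OF E])
    fix d assume d: "d \<in> conf_set n w" "\<And>i. i < n \<Longrightarrow> dist (c i) (d i) < E"
    have "d i \<in> U i" if i: "i < n" for i
    proof -
      have "d i \<in> ball (c i) (e i)" using d(2)[OF i] Ee[OF i] by simp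
      then show ?thesis using e i by blast
    qed
    moreover have "d \<in> {..<n} \<rightarrow>\<^sub>E UNIV" using d(1) unfolding conf_set_def by blast
    ultimately have "d \<in> Pi\<^sub>E {..<n} U" by (auto simp: PiE_iff)
    then show "d \<in> W" using U(3) T(2) d(1) by blast
  qed
qed

lemma topspace_Conf [simp]: "topspace (Conf n w) = conf_set n w"
  unfolding Conf_def by (auto simp: conf_set_def)

abbreviation config_space :: "nat \<Rightarrow> (real \<times> real) set topology" where
  "config_space n \<equiv> subtopology hausdorff_topology (configs n)"

text \<open>
  Openness of the map that forgets labels is the content: a configuration \<open>T\<close> that is close to the image
  of \<open>c\<close> inherits labels from \<open>c\<close> along the matching of points, and the labelled configuration so
  obtained is close to \<open>c\<close>.
\<close>

lemma quotient_map_Conf_config_space: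
  "quotient_map (Conf n 2) (config_space n) (\<lambda>c. c ` {..<n})"
proof (rule continuous_open_imp_quotient_map)
  have "continuous_map (Conf n 2) euclidean (\<lambda>c. c i)" if "i < n" for i
    unfolding Conf_def using that
    by (intro continuous_map_from_subtopology continuous_map_product_projection) simp
  then show "continuous_map (Conf n 2) (config_space n) (\<lambda>c. c ` {..<n})"
    unfolding continuous_map_in_subtopology
    using conf_set_iff by (auto intro!: continuous_map_hausdorff_image)
  show "open_map (Conf n 2) (config_space n) (\<lambda>c. c ` {..<n})"
    unfolding open_map_def openin_subtopology_hausdorff
  proof (intro allI impI conjI ballI)
    fix W assume W: "openin (Conf n 2) W"
    have Wc: "W \<subseteq> conf_set n 2" using openin_subset[OF W] by simp
    then show "(\<lambda>c. c ` {..<n}) ` W \<subseteq> configs n" using conf_set_iff by blast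
    fix S assume "S \<in> (\<lambda>c. c ` {..<n}) ` W"
    then obtain c where c: "c \<in> W" "S = c ` {..<n}" by blast
    then have cc: "inj_on c {..<n}" "S \<in> configs n" using Wc conf_set_iff by blast+
    obtain e where e: "e > 0" "\<And>d. d \<in> conf_set n 2 \<Longrightarrow> (\<And>i. i < n \<Longrightarrow> dist (c i) (d i) < e) \<Longrightarrow> d \<in> W"
      using openin_Conf_nhd[OF W c(1)] by metis
    show "\<exists>e>0. \<forall>T\<in>configs n. hclose e S T \<longrightarrow> T \<in> (\<lambda>c. c ` {..<n}) ` W"
    proof (intro exI[of _ "min e (1/2)"] conjI ballI impI)
      fix T assume T: "T \<in> configs n" "hclose (min e (1/2)) S T"
      obtain f where f: "bij_betw f S T" "\<And>p. p \<in> S \<Longrightarrow> dist p (f p) < min e (1/2)"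
        using hclose_matching[OF cc(2) T(1) _ T(2)] by (metis min.cobounded2)
      define d where "d = restrict (f \<circ> c) {..<n}"
      have im: "d ` {..<n} = T" using f(1) c(2) unfolding d_def bij_betw_def by auto
      have "inj_on (f \<circ> c) {..<n}" using f(1) cc(1) c(2) by (intro comp_inj_on) (auto simp: bij_betw_def)
      then have "d \<in> conf_set n 2"
        unfolding conf_set_iff im using T(1) by (simp add: d_def inj_on_def)
      moreover have "dist (c i) (d i) < e" if "i < n" for i
        using f(2)[of "c i"] that c(2) by (simp add: d_def)
      ultimately have "d \<in> W" by (rule e(2))
      then show "T \<in> (\<lambda>c. c ` {..<n}) ` W" using im by blast
    qed (use e in simp)
  qed
  have "S \<in> (\<lambda>c. c ` {..<n}) ` conf_set n 2" if S: "S \<in> configs n" for S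
  proof -
    obtain h where h: "bij_betw h {..<n} S"
      using ex_bij_betw_nat_finite[OF configsD(1)[OF S]] configsD(2)[OF S] by (auto simp: lessThan_atLeast0)
    have im: "restrict h {..<n} ` {..<n} = S" using h by (auto simp: bij_betw_def)
    then have "restrict h {..<n} \<in> conf_set n 2"
      unfolding conf_set_iff im using S h by (simp add: bij_betw_def inj_on_def)
    then show ?thesis using im by blast
  qed
  then show "(\<lambda>c. c ` {..<n}) ` topspace (Conf n 2) = topspace (config_space n)"
    using conf_set_iff by auto
qed

text \<open>
  Taking orbits and taking images are quotient maps on the same space with the same fibres.
\<close>

lemma UConf_homeomorphic_config_space: "UConf n 2 homeomorphic_space config_space n"
proof -
  let ?im = "\<lambda>c::nat \<Rightarrow> real \<times> real. c ` {..<n}"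
  define g where "g = (\<lambda>C. ?im (SOME c. c \<in> conf_set n 2 \<and> relabel_orbit n c = C))"
  have g: "(g \<circ> relabel_orbit n) c = ?im c" if c: "c \<in> conf_set n 2" for c
  proof -
    let ?d = "SOME d. d \<in> conf_set n 2 \<and> relabel_orbit n d = relabel_orbit n c"
    have "?d \<in> conf_set n 2 \<and> relabel_orbit n ?d = relabel_orbit n c"
      by (rule someI[of _ c]) (use c in simp)
    then show ?thesis using relabel_orbit_eq_iff c unfolding g_def comp_def by blast
  qed
  have q: "quotient_map (Conf n 2) (UConf n 2) (relabel_orbit n)"
    unfolding UConf_def by (rule quotient_map_quotient_topology)
  have gq: "quotient_map (Conf n 2) (config_space n) (g \<circ> relabel_orbit n)"
    using quotient_map_Conf_config_space quotient_map_eq g by (metis (no_types, lifting) topspace_Conf)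
  then have "continuous_map (UConf n 2) (config_space n) g"
    using q by (metis continuous_compose_quotient_map_eq quotient_imp_continuous_map)
  then have "quotient_map (UConf n 2) (config_space n) g"
    using quotient_map_from_composition[OF quotient_imp_continuous_map[OF q] _ gq] by blast
  moreover have "inj_on g (topspace (UConf n 2))"
  proof (rule inj_onI)
    fix C D assume "C \<in> topspace (UConf n 2)" "D \<in> topspace (UConf n 2)" and eq: "g C = g D"
    then obtain c d where cd: "c \<in> conf_set n 2" "C = relabel_orbit n c" "d \<in> conf_set n 2" "D = relabel_orbit n d"
      unfolding UConf_def by auto
    then have "?im c = ?im d" using eq g by (metis comp_apply)
    then show "C = D" using relabel_orbit_eq_iff cd by blast
  qed
  ultimately have "homeomorphic_map (UConf n 2) (config_space n) g"
    unfolding homeomorphic_map_def by blast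
  then show ?thesis by (rule homeomorphic_map_imp_homeomorphic_space)
qed

section \<open>Detaching the rightmost disk\<close>


lemma continuous_map_into_metric:
  fixes f :: "'a \<Rightarrow> 'b::metric_space"
  shows "continuous_map X euclidean f \<longleftrightarrow>
    (\<forall>x\<in>topspace X. \<forall>e>0. \<exists>U. openin X U \<and> x \<in> U \<and> (\<forall>y\<in>U. dist (f x) (f y) < e))" (is "?L \<longleftrightarrow> ?R")
proof
  assume L: ?L
  show ?R
  proof (intro ballI allI impI)
    fix x and e :: real assume x: "x \<in> topspace X" "e > 0"
    have "openin X {y \<in> topspace X. f y \<in> ball (f x) e}"
      by (rule openin_continuous_map_preimage[OF L]) simp
    then show "\<exists>U. openin X U \<and> x \<in> U \<and> (\<forall>y\<in>U. dist (f x) (f y) < e)"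
      by (intro exI[of _ "{y \<in> topspace X. f y \<in> ball (f x) e}"]) (use x in simp)
  qed
next
  assume R: ?R
  have "openin X {x \<in> topspace X. f x \<in> V}" if V: "open V" for V
  proof (subst openin_subopen, intro ballI)
    fix x assume "x \<in> {x \<in> topspace X. f x \<in> V}"
    then have x: "x \<in> topspace X" "f x \<in> V" by simp_all
    then obtain e where e: "e > 0" "ball (f x) e \<subseteq> V" using V open_contains_ball by blast
    obtain U where U: "openin X U" "x \<in> U" "\<forall>y\<in>U. dist (f x) (f y) < e" using R x(1) e(1) by meson
    have "U \<subseteq> {x \<in> topspace X. f x \<in> V}"
      using U(3) e(2) openin_subset[OF U(1)] by (auto simp: subset_iff)
    then show "\<exists>T. openin X T \<and> x \<in> T \<and> T \<subseteq> {x \<in> topspace X. f x \<in> V}" using U by meson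
  qed
  then show ?L by (simp add: continuous_map)
qed

text \<open>
  Any continuous upper bound for the first coordinates serves as a place to park disks to the right of
  a configuration. Inserting \<open>0\<close> makes the maximum meaningful for the empty configuration.
\<close>

definition rightmost :: "(real \<times> real) set \<Rightarrow> real" where
  "rightmost S = Max (insert 0 (fst ` S))"

lemma le_rightmost: "finite S \<Longrightarrow> p \<in> S \<Longrightarrow> fst p \<le> rightmost S"
  unfolding rightmost_def by (rule Max_ge) auto

lemma rightmost_less:
  assumes "finite S" "finite T" "hclose e S T" "0 < e"
  shows "rightmost S < rightmost T + e"
proof -
  have 0: "0 \<le> rightmost T" unfolding rightmost_def by (rule Max_ge) (use assms in auto)
  have "fst p < rightmost T + e" if p: "p \<in> S" for p
  proof -
    obtain q where q: "q \<in> T" "dist p q < e" using assms(3) p unfolding hclose_def by blast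
    have "fst p - fst q \<le> dist p q"
      using dist_fst_le[of p q] by (simp add: dist_real_def)
    then show ?thesis using q le_rightmost[OF assms(2) q(1)] by linarith
  qed
  then show ?thesis
    using assms(1,4) 0 unfolding rightmost_def[of S] by (subst Max_less_iff) auto
qed

lemma continuous_map_rightmost: "continuous_map (config_space n) euclideanreal rightmost"
  unfolding continuous_map_into_metric
proof (intro ballI allI impI)
  fix S and e :: real assume "S \<in> topspace (config_space n)" and e: "e > 0"
  then have S: "S \<in> configs n" by simp
  let ?U = "{T. \<exists>d<e. hclose d S T} \<inter> configs n"
  have "openin (config_space n) ?U"
    using openin_hausdorff_ball openin_subtopology_Int by blast
  moreover have "S \<in> ?U" using S e hclose_refl[of "e/2" S] by (auto intro!: exI[of _ "e/2"])
  moreover have "dist (rightmost S) (rightmost T) < e" if "T \<in> ?U" for T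
  proof -
    have T: "hclose e S T" "finite T" using that hclose_mono[of _ S T e] configsD(1) by auto
    then show ?thesis
      using rightmost_less[OF _ _ T(1) e] rightmost_less[OF _ _ hclose_sym[OF T(1)] e] configsD(1)[OF S]
      by (simp add: dist_real_def abs_less_iff)
  qed
  ultimately show "\<exists>U. openin (config_space n) U \<and> S \<in> U \<and> (\<forall>T\<in>U. dist (rightmost S) (rightmost T) < e)"
    by blast
qed

abbreviation marked_space :: "((real \<times> real) set \<times> 'v::real_normed_vector) set \<Rightarrow> ((real \<times> real) set \<times> 'v) topology" where
  "marked_space E \<equiv> subtopology (prod_topology hausdorff_topology euclidean) E"

lemma topspace_marked_space [simp]: "topspace (marked_space E) = E"
  by simp

lemma continuous_map_marked_fst: "continuous_map (marked_space E) hausdorff_topology fst"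
  by (intro continuous_map_from_subtopology continuous_map_fst)

lemma continuous_map_marked_snd: "continuous_map (marked_space E) euclidean snd"
  by (intro continuous_map_from_subtopology continuous_map_snd)

lemma continuous_map_marked_comp:
  assumes "continuous_on UNIV h"
  shows "continuous_map (marked_space E) euclidean (\<lambda>z. h (snd z))"
  using continuous_map_compose[OF continuous_map_marked_snd, of euclidean h] assms
  by (simp add: o_def)

lemma openin_marked_nhd:
  assumes V: "openin (marked_space E) V" and z: "(S, v) \<in> V"
  obtains e where "e > 0" "\<And>T w. (T, w) \<in> E \<Longrightarrow> hclose e S T \<Longrightarrow> dist v w < e \<Longrightarrow> (T, w) \<in> V"
proof -
  obtain W where W: "openin (prod_topology hausdorff_topology euclidean) W" "V = W \<inter> E"
    using V unfolding openin_subtopology by blast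
  have "(S, v) \<in> W" using W(2) z by blast
  then obtain P Q where P: "openin hausdorff_topology P" and Q: "open Q" "S \<in> P" "v \<in> Q" "P \<times> Q \<subseteq> W"
    using W(1) unfolding openin_prod_topology_alt open_openin[symmetric] by meson
  obtain d where d: "d > 0" "\<forall>T. hclose d S T \<longrightarrow> T \<in> P"
    using P Q(2) unfolding openin_hausdorff_topology by blast
  obtain r where r: "r > 0" "ball v r \<subseteq> Q" using Q open_contains_ball by blast
  show thesis
  proof (rule that[of "min d r"])
    fix T w assume T: "(T, w) \<in> E" "hclose (min d r) S T" "dist v w < min d r"
    then have "T \<in> P" "w \<in> Q" using d(2) r(2) hclose_mono[OF T(2), of d] by auto
    then show "(T, w) \<in> V" using W Q T(1) by blast
  qed (use d r in simp)
qed

text \<open>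
  Spaces of configurations with some distinguished disks are parametrised by pairs \<open>(S, v)\<close>, where \<open>v\<close>
  lists the distinguished disks and \<open>S\<close> is the set of the others. The assumption \<open>lift\<close> says that the
  distinguished disks can be recognised in every nearby configuration; then putting the disks together
  is an open map.
\<close>

lemma openin_image_marked_space:
  assumes jE: "\<And>S v. (S, v) \<in> E \<Longrightarrow> j (S, v) \<in> Y"
    and lift: "\<And>S v e. (S, v) \<in> E \<Longrightarrow> 0 < e \<Longrightarrow> \<exists>d>0. \<forall>T\<in>Y. hclose d (j (S, v)) T \<longrightarrow>
      (\<exists>S' v'. (S', v') \<in> E \<and> j (S', v') = T \<and> hclose e S S' \<and> dist v v' < e)"
    and V: "openin (marked_space E) V"
  shows "openin (subtopology hausdorff_topology Y) (j ` V)"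
  unfolding openin_subtopology_hausdorff
proof (intro conjI ballI)
  have VE: "V \<subseteq> E" using openin_subset[OF V] by simp
  then show "j ` V \<subseteq> Y" using jE by auto
  fix R assume "R \<in> j ` V"
  then obtain S v where z: "(S, v) \<in> V" "R = j (S, v)" by auto
  obtain e where e: "e > 0" "\<And>T w. (T, w) \<in> E \<Longrightarrow> hclose e S T \<Longrightarrow> dist v w < e \<Longrightarrow> (T, w) \<in> V"
    by (rule openin_marked_nhd[OF V z(1)]) blast
  obtain d where d: "d > 0" "\<forall>T\<in>Y. hclose d (j (S, v)) T \<longrightarrow>
      (\<exists>S' v'. (S', v') \<in> E \<and> j (S', v') = T \<and> hclose e S S' \<and> dist v v' < e)"
    using lift[of S v e] z(1) VE e(1) by blast
  have "T \<in> j ` V" if T: "T \<in> Y" "hclose d R T" for T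
  proof -
    obtain S' v' where "(S', v') \<in> E" "j (S', v') = T" "hclose e S S'" "dist v v' < e"
      using d(2) T z(2) by blast
    then show ?thesis using e(2) by (metis imageI)
  qed
  then show "\<exists>e>0. \<forall>T\<in>Y. hclose e R T \<longrightarrow> T \<in> j ` V" using d(1) by blast
qed

lemma homeomorphic_map_marked_space:
  assumes jE: "\<And>S v. (S, v) \<in> E \<Longrightarrow> j (S, v) \<in> Y"
    and lift: "\<And>S v e. (S, v) \<in> E \<Longrightarrow> 0 < e \<Longrightarrow> \<exists>d>0. \<forall>T\<in>Y. hclose d (j (S, v)) T \<longrightarrow>
      (\<exists>S' v'. (S', v') \<in> E \<and> j (S', v') = T \<and> hclose e S S' \<and> dist v v' < e)"
    and cont: "continuous_map (marked_space E) hausdorff_topology j" and inj: "inj_on j E"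
  shows "homeomorphic_map (marked_space E) (subtopology hausdorff_topology (j ` E)) j"
proof (rule bijective_open_imp_homeomorphic_map)
  show "continuous_map (marked_space E) (subtopology hausdorff_topology (j ` E)) j"
    using cont by (simp add: continuous_map_in_subtopology)
  have jY: "j ` E \<subseteq> Y" using jE by auto
  show "open_map (marked_space E) (subtopology hausdorff_topology (j ` E)) j"
    unfolding open_map_def
  proof (intro allI impI)
    fix V assume V: "openin (marked_space E) V"
    have "openin (subtopology hausdorff_topology Y) (j ` V)"
      by (rule openin_image_marked_space[where E=E and j=j and Y=Y])
        (rule jE, assumption, rule lift, assumption, assumption, rule V)
    then obtain W where W: "openin hausdorff_topology W" "j ` V = W \<inter> Y"
      unfolding openin_subtopology by (elim exE conjE)
    have "j ` V \<subseteq> j ` E" using openin_subset[OF V] by auto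
    then have "j ` V = W \<inter> j ` E" using W(2) jY by auto
    then show "openin (subtopology hausdorff_topology (j ` E)) (j ` V)"
      unfolding openin_subtopology by (intro exI[of _ W] conjI W(1))
  qed
  show "inj_on j (topspace (marked_space E))" using inj by simp
qed simp

lemma uniform_gap:
  fixes h :: "'a \<Rightarrow> real"
  assumes "finite S" "\<And>q. q \<in> S \<Longrightarrow> h q < c"
  obtains g where "g > 0" "\<And>q. q \<in> S \<Longrightarrow> h q + g \<le> c"
proof (cases "S = {}")
  case True
  then show thesis using that[of 1] by simp
next
  case False
  have m: "Max (h ` S) < c" using assms False by simp
  show thesis
  proof (rule that[of "c - Max (h ` S)"])
    fix q assume "q \<in> S"
    then have "h q \<le> Max (h ` S)" using assms(1) by simp
    then show "h q + (c - Max (h ` S)) \<le> c" by simp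
  qed (use m in simp)
qed

text \<open>
  A configuration with a unique rightmost disk \<open>p\<close>, which is kept apart from the set \<open>S\<close> of the others.
\<close>

definition last_split :: "nat \<Rightarrow> ((real \<times> real) set \<times> (real \<times> real)) set" where
  "last_split n = {(S, p). S \<in> configs n \<and> p \<in> strip \<and> (\<forall>r\<in>S. fst r < fst p \<and> apart p r)}"

definition add_last :: "(real \<times> real) set \<times> (real \<times> real) \<Rightarrow> (real \<times> real) set" where
  "add_last z = insert (snd z) (fst z)"

lemma add_last_in_configs: "z \<in> last_split n \<Longrightarrow> add_last z \<in> configs (Suc n)"
  unfolding last_split_def add_last_def by (auto intro: insert_in_configs)

lemma fst_dist_less:
  fixes p q :: "real \<times> real"
  shows "dist p q < d \<Longrightarrow> \<bar>fst p - fst q\<bar> < d" and "dist p q < d \<Longrightarrow> \<bar>snd p - snd q\<bar> < d"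
  using dist_fst_le[of p q] dist_snd_le[of p q] by (auto simp: dist_real_def)

text \<open>
  In a nearby configuration the partner of \<open>p\<close> is again strictly to the right of all other points,
  because the distance is chosen smaller than half of the gap between \<open>p\<close> and the remaining disks.
\<close>

lemma add_last_lift:
  assumes z: "(S, p) \<in> last_split n" and e: "0 < e"
  shows "\<exists>d>0. \<forall>T\<in>configs (Suc n). hclose d (add_last (S, p)) T \<longrightarrow>
      (\<exists>S' p'. (S', p') \<in> last_split n \<and> add_last (S', p') = T \<and> hclose e S S' \<and> dist p p' < e)"
proof -
  have S: "S \<in> configs n" and p: "\<And>r. r \<in> S \<Longrightarrow> fst r < fst p"
    using z unfolding last_split_def by auto
  obtain g where g: "g > 0" "\<And>r. r \<in> S \<Longrightarrow> fst r + g \<le> fst p"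
    using uniform_gap[of S fst "fst p"] configsD(1)[OF S] p by metis
  define d where "d = min (min e (1/2)) (g/2)"
  have d: "d > 0" "d \<le> e" "d \<le> 1/2" "2 * d \<le> g" unfolding d_def using e g(1) by auto
  show ?thesis
  proof (intro exI[of _ d] conjI ballI impI)
    fix T assume T: "T \<in> configs (Suc n)" "hclose d (add_last (S, p)) T"
    obtain f where f: "bij_betw f (insert p S) T" "\<And>r. r \<in> insert p S \<Longrightarrow> dist r (f r) < d"
      using hclose_matching[OF add_last_in_configs[OF z] T(1) d(3) T(2)] by (auto simp: add_last_def)
    have pS: "p \<notin> S" using p by blast
    have im: "insert (f p) (f ` S) = T" and inj: "inj_on f (insert p S)"
      using f(1) by (auto simp: bij_betw_def)
    have less: "fst (f r) < fst (f p)" if r: "r \<in> S" for r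
      using fst_dist_less(1)[OF f(2)[of r]] fst_dist_less(1)[OF f(2)[of p]] g(2)[OF r] d(4) r by auto
    have "f ` S \<in> configs n"
    proof (rule configs_subset[OF T(1)])
      have "inj_on f S" using inj by (rule inj_on_subset) blast
      then show "card (f ` S) = n" using configsD(2)[OF S] by (simp add: card_image)
    qed (use im in blast)
    moreover have "f p \<in> strip" using configsD(3)[OF T(1)] im by blast
    moreover have "apart (f p) (f r)" if r: "r \<in> S" for r
    proof (rule configsD(4)[OF T(1)])
      show "f p \<noteq> f r" using less[OF r] by auto
    qed (use im r in auto)
    ultimately have "(f ` S, f p) \<in> last_split n"
      using less unfolding last_split_def by auto
    moreover have "hclose e S (f ` S)" "dist p (f p) < e"
      using f(2) d(2) less_le_trans unfolding hclose_def by blast+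
    moreover have "add_last (f ` S, f p) = T" using im by (simp add: add_last_def)
    ultimately show "\<exists>S' p'. (S', p') \<in> last_split n \<and> add_last (S', p') = T \<and> hclose e S S' \<and> dist p p' < e"
      by blast
  qed (rule d(1))
qed

lemma inj_on_add_last: "inj_on add_last (last_split n)"
proof (rule inj_onI)
  fix z z' assume z: "z \<in> last_split n" and z': "z' \<in> last_split n" and eq: "add_last z = add_last z'"
  obtain S p S' p' where sp: "z = (S, p)" "z' = (S', p')" by (metis surj_pair)
  have 1: "\<And>r. r \<in> S \<Longrightarrow> fst r < fst p" and 2: "\<And>r. r \<in> S' \<Longrightarrow> fst r < fst p'"
    using z z' unfolding last_split_def sp by auto
  have ins: "insert p S = insert p' S'" using eq by (simp add: add_last_def sp)
  have pp: "p = p'"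
  proof (rule ccontr)
    assume "p \<noteq> p'"
    moreover have "p \<in> insert p' S'" by (subst ins[symmetric]) simp
    moreover have "p' \<in> insert p S" by (subst ins) simp
    ultimately have "p \<in> S'" "p' \<in> S" by simp_all
    then show False using 1[of p'] 2[of p] by simp
  qed
  moreover have "p \<notin> S" "p' \<notin> S'" using 1 2 by blast+
  ultimately show "z = z'" using ins sp by (metis insert_ident)
qed

lemma continuous_map_add_last: "continuous_map (marked_space E) hausdorff_topology add_last"
proof -
  have "continuous_map (marked_space E) hausdorff_topology (\<lambda>z. insert (snd z) (fst z))"
    by (intro continuous_map_hausdorff_insert continuous_map_marked_fst continuous_map_marked_snd)
  then show ?thesis by (simp add: add_last_def[abs_def])
qed

definition unique_last :: "nat \<Rightarrow> (real \<times> real) set set" where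
  "unique_last n = add_last ` last_split n"

lemma unique_last_iff:
  "T \<in> unique_last n \<longleftrightarrow> T \<in> configs (Suc n) \<and> (\<exists>p\<in>T. \<forall>q\<in>T. q \<noteq> p \<longrightarrow> fst q < fst p)" (is "_ \<longleftrightarrow> ?R")
proof
  assume "T \<in> unique_last n"
  then obtain z where z: "z \<in> last_split n" "T = add_last z" unfolding unique_last_def by blast
  obtain S p where sp: "z = (S, p)" by (cases z)
  then have "\<forall>r\<in>S. fst r < fst p" using z(1) unfolding last_split_def by auto
  then have "\<exists>p\<in>T. \<forall>q\<in>T. q \<noteq> p \<longrightarrow> fst q < fst p"
    using z(2) sp by (intro bexI[of _ p]) (simp_all add: add_last_def)
  then show ?R using add_last_in_configs[OF z(1)] z(2) by simp
next
  assume ?R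
  then obtain p where p: "T \<in> configs (Suc n)" "p \<in> T" "\<And>q. q \<in> T \<Longrightarrow> q \<noteq> p \<Longrightarrow> fst q < fst p" by blast
  have "T - {p} \<in> configs n"
    by (rule configs_subset[OF p(1)]) (use configsD(1,2)[OF p(1)] p(2) in auto)
  moreover have "apart p r" if "r \<in> T - {p}" for r
    using configsD(4)[OF p(1), of p r] p(2) that by blast
  ultimately have "(T - {p}, p) \<in> last_split n"
    using p configsD(3)[OF p(1)] unfolding last_split_def by simp
  moreover have "add_last (T - {p}, p) = T" using p(2) by (auto simp: add_last_def)
  ultimately show "T \<in> unique_last n" unfolding unique_last_def by (metis imageI)
qed

lemma homeomorphic_map_add_last:
  "homeomorphic_map (marked_space (last_split n)) (subtopology hausdorff_topology (unique_last n)) add_last"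
  unfolding unique_last_def
  by (rule homeomorphic_map_marked_space[where Y="configs (Suc n)", OF _ _
        continuous_map_add_last inj_on_add_last]) (erule add_last_in_configs, erule add_last_lift, assumption)

lemma openin_unique_last: "openin (config_space (Suc n)) (unique_last n)"
  unfolding unique_last_def
proof (rule openin_image_marked_space[where E="last_split n"])
  show "openin (marked_space (last_split n)) (last_split n)"
    using openin_topspace[of "marked_space (last_split n)"] by simp
qed (erule add_last_in_configs, erule add_last_lift, assumption)

text \<open>
  Disks may move to the right freely as long as all obstacles are on their left.
\<close>

lemma apart_right_shift:
  assumes "apart p r" "fst r \<le> fst p" "fst p \<le> a"
  shows "apart (a, snd p) r"
proof -
  have "(fst p - fst r)\<^sup>2 \<le> (a - fst r)\<^sup>2" using assms by (intro power_mono) auto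
  then show ?thesis using assms(1) by (simp add: apart_def)
qed

lemma apart_if_far:
  assumes "fst r + 1 \<le> fst p"
  shows "apart p r"
proof -
  have "1\<^sup>2 \<le> (fst p - fst r)\<^sup>2" using assms by (intro power_mono) auto
  then show ?thesis unfolding apart_def by (simp add: add_increasing2)
qed

lemma convex_combination_gt:
  fixes x :: real
  assumes "x < u" "x < v" "0 \<le> t" "t \<le> 1"
  shows "x < (1 - t) * u + t * v"
proof (cases "t = 0")
  case False
  then have "0 < t * (v - x)" "0 \<le> (1 - t) * (u - x)" using assms by simp_all
  then show ?thesis by (simp add: algebra_simps)
qed (use assms in simp)

lemma convex_combination_ge:
  fixes x :: real
  assumes "x \<le> u" "x \<le> v" "0 \<le> t" "t \<le> 1"
  shows "x \<le> (1 - t) * u + t * v"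
proof -
  have "0 \<le> t * (v - x)" "0 \<le> (1 - t) * (u - x)" using assms by simp_all
  then show ?thesis by (simp add: algebra_simps)
qed

lemma convex_combination_le:
  fixes x :: real
  assumes "u \<le> x" "v \<le> x" "0 \<le> t" "t \<le> 1"
  shows "(1 - t) * u + t * v \<le> x"
  using convex_combination_ge[of "-x" "-u" "-v" t] assms by simp

text \<open>
  If the distinguished disks can be moved continuously to a standard position beyond the rightmost of
  the other disks, forgetting them is a homotopy equivalence; its inverse puts them at the standard
  position.
\<close>

lemma marked_space_homotopy_equivalence:
  fixes E :: "((real \<times> real) set \<times> 'v::real_normed_vector) set"
  assumes E: "\<And>S v. (S, v) \<in> E \<Longrightarrow> S \<in> configs n"
    and s: "continuous_on UNIV s" "\<And>S. S \<in> configs n \<Longrightarrow> (S, s (rightmost S)) \<in> E"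
    and h: "homotopic_with (\<lambda>_. True) (marked_space E) (marked_space E)
       (\<lambda>z. (fst z, snd z)) (\<lambda>z. (fst z, s (rightmost (fst z))))"
  shows "hom_induced k (marked_space E) {} (config_space n) {} fst
    \<in> iso (homology_group k (marked_space E)) (homology_group k (config_space n))"
proof (rule homotopy_equivalence_homology_group_isomorphism[where g="\<lambda>S. (S, s (rightmost S))"])
  show "continuous_map (marked_space E) (config_space n) fst"
    using E by (auto simp: continuous_map_in_subtopology continuous_map_marked_fst)
  have "continuous_map (config_space n) euclidean (\<lambda>S. s (rightmost S))"
    using continuous_map_compose[OF continuous_map_rightmost, of euclidean s n] s(1) by (simp add: o_def)
  then show *: "continuous_map (config_space n) (marked_space E) (\<lambda>S. (S, s (rightmost S)))"
    using s(2) continuous_map_from_subtopology[OF continuous_map_id, of hausdorff_topology "configs n"]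
    by (auto simp: continuous_map_in_subtopology id_def intro!: continuous_map_pairedI)
  have "homotopic_with (\<lambda>_. True) (marked_space E) (marked_space E)
       (\<lambda>z. (fst z, s (rightmost (fst z)))) (\<lambda>z. (fst z, snd z))"
    using h by (rule homotopic_with_symD)
  then show "homotopic_with (\<lambda>h. True) (marked_space E) (marked_space E) ((\<lambda>S. (S, s (rightmost S))) \<circ> fst) id"
    by (simp add: o_def id_def)
  show "homotopic_with (\<lambda>k. True) (config_space n) (config_space n) (fst \<circ> (\<lambda>S. (S, s (rightmost S)))) id"
    by (simp add: o_def id_def)
qed

lemma continuous_map_marked_rightmost:
  fixes E :: "((real \<times> real) set \<times> 'v::real_normed_vector) set"
  assumes E: "\<And>S v. (S, v) \<in> E \<Longrightarrow> S \<in> configs n" and s: "continuous_on UNIV s"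
  shows "continuous_map (marked_space E) euclidean (\<lambda>z. s (rightmost (fst z)))"
proof -
  have "continuous_map (marked_space E) (config_space n) fst"
    using E by (auto simp: continuous_map_in_subtopology continuous_map_marked_fst)
  then have "continuous_map (marked_space E) euclidean (s \<circ> (rightmost \<circ> fst))"
    using s by (intro continuous_map_compose[of _ euclidean] continuous_map_compose[OF _ continuous_map_rightmost]) simp_all
  then show ?thesis by (simp add: o_def)
qed

text \<open>
  The rightmost disk is first pushed to the right by \<open>1\<close>. From there on its first coordinate exceeds
  those of the others by more than \<open>1\<close>, so its height is unconstrained and a straight segment leads to
  the standard position.
\<close>

lemma last_split_homology:
  "hom_induced k (marked_space (last_split n)) {} (config_space n) {} fst
    \<in> iso (homology_group k (marked_space (last_split n))) (homology_group k (config_space n))"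
proof (rule marked_space_homotopy_equivalence[where s="\<lambda>m. (m + 2, 1)"])
  let ?E = "last_split n"
  show E: "\<And>S v. (S, v) \<in> ?E \<Longrightarrow> S \<in> configs n" by (simp add: last_split_def)
  show s: "continuous_on UNIV (\<lambda>m::real. (m + 2, 1::real))" by (intro continuous_intros)
  show "(S, rightmost S + 2, 1) \<in> ?E" if S: "S \<in> configs n" for S
  proof -
    have "fst r + 1 \<le> rightmost S + 2 \<and> fst r < rightmost S + 2" if "r \<in> S" for r
      using le_rightmost[OF configsD(1)[OF S] that] by simp
    then show ?thesis
      using S unfolding last_split_def by (simp add: strip_def apart_if_far)
  qed
  have sh: "continuous_on UNIV (\<lambda>p::real\<times>real. (fst p + 1, snd p))" by (intro continuous_intros)
  have 1: "homotopic_with (\<lambda>_. True) (marked_space ?E) (marked_space ?E)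
       (\<lambda>z. (fst z, snd z)) (\<lambda>z. (fst z, (\<lambda>p. (fst p + 1, snd p)) (snd z)))"
  proof (rule homotopic_with_linear_snd[OF continuous_map_marked_fst continuous_map_marked_snd
        continuous_map_marked_comp[OF sh]])
    fix z and t :: real assume z: "z \<in> topspace (marked_space ?E)" and t: "0 \<le> t" "t \<le> 1"
    obtain S a b where sab: "z = (S, a, b)" by (metis surj_pair)
    have eq: "(1 - t) *\<^sub>R snd z + t *\<^sub>R (fst (snd z) + 1, snd (snd z)) = (a + t, b)"
      by (simp add: sab algebra_simps)
    have "(S, a + t, b) \<in> ?E"
      using z t apart_right_shift[of "(a, b)" _ "a + t"] unfolding last_split_def sab
      by (auto simp: strip_def)
    then show "(fst z, (1 - t) *\<^sub>R snd z + t *\<^sub>R (fst (snd z) + 1, snd (snd z))) \<in> ?E"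
      unfolding eq by (simp add: sab)
  qed
  have 2: "homotopic_with (\<lambda>_. True) (marked_space ?E) (marked_space ?E)
       (\<lambda>z. (fst z, (\<lambda>p. (fst p + 1, snd p)) (snd z))) (\<lambda>z. (fst z, (\<lambda>m. (m + 2, 1)) (rightmost (fst z))))"
  proof (rule homotopic_with_linear_snd[OF continuous_map_marked_fst 
        continuous_map_marked_comp[OF sh] continuous_map_marked_rightmost[OF E s]])
    fix z and t :: real assume z: "z \<in> topspace (marked_space ?E)" and t: "0 \<le> t" "t \<le> 1"
    obtain S a b where sab: "z = (S, a, b)" by (metis surj_pair)
    let ?a = "(1 - t) * (a + 1) + t * (rightmost S + 2)" and ?b = "(1 - t) * b + t * 1"
    have S: "S \<in> configs n" "1/2 \<le> b" "b \<le> 3/2" "\<And>r. r \<in> S \<Longrightarrow> fst r < a"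
      using z unfolding sab last_split_def by (auto simp: strip_def)
    have a: "fst r + 1 < ?a" if "r \<in> S" for r
      by (rule convex_combination_gt) (use S(4)[OF that] le_rightmost[OF configsD(1)[OF S(1)] that] t in auto)
    then have "apart (?a, ?b) r" if "r \<in> S" for r
      using that by (intro apart_if_far) (simp only: fst_conv less_imp_le)
    moreover have "1/2 \<le> ?b" by (rule convex_combination_ge) (use S t in auto)
    moreover have "?b \<le> 3/2" by (rule convex_combination_le) (use S t in auto)
    ultimately have "(S, ?a, ?b) \<in> ?E" using S(1) a unfolding last_split_def
      by (simp add: strip_def) (smt (verit))
    then show "(fst z, (1 - t) *\<^sub>R (fst (snd z) + 1, snd (snd z)) + t *\<^sub>R (rightmost (fst z) + 2, 1)) \<in> ?E"
      by (simp add: sab)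
  qed
  show "homotopic_with (\<lambda>_. True) (marked_space ?E) (marked_space ?E)
       (\<lambda>z. (fst z, snd z)) (\<lambda>z. (fst z, (\<lambda>m. (m + 2, 1)) (rightmost (fst z))))"
    by (rule homotopic_with_trans[OF 1 2])
qed

section \<open>The rightmost pair of disks\<close>


text \<open>
  A configuration whose last two disks \<open>p\<close> (the upper) and \<open>q\<close> (the lower) are both to the right of the
  set \<open>S\<close> of the others, where the set \<open>D\<close> restricts the horizontal offset of \<open>p\<close> from \<open>q\<close>. With \<open>D\<close> the
  interval from \<open>-1/2\<close> to \<open>1/2\<close> this is a neighbourhood of the configurations that end in two stacked
  disks; the sign of the offset distinguishes its two sides.
\<close>

definition pair_split :: "real set \<Rightarrow> nat \<Rightarrow> ((real \<times> real) set \<times> ((real \<times> real) \<times> (real \<times> real))) set" where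
  "pair_split D n = {(S, p, q). S \<in> configs n \<and> p \<in> strip \<and> q \<in> strip \<and> snd q < snd p \<and>
     fst p - fst q \<in> D \<and> apart p q \<and>
     (\<forall>r\<in>S. fst r < fst p \<and> fst r < fst q \<and> apart p r \<and> apart q r)}"

definition add_pair :: "(real \<times> real) set \<times> ((real \<times> real) \<times> (real \<times> real)) \<Rightarrow> (real \<times> real) set" where
  "add_pair z = insert (fst (snd z)) (insert (snd (snd z)) (fst z))"

lemma pair_splitD:
  assumes "(S, p, q) \<in> pair_split D n"
  shows "S \<in> configs n" "p \<in> strip" "q \<in> strip" "snd q < snd p" "fst p - fst q \<in> D" "apart p q"
    "\<And>r. r \<in> S \<Longrightarrow> fst r < fst p" "\<And>r. r \<in> S \<Longrightarrow> fst r < fst q"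
    "\<And>r. r \<in> S \<Longrightarrow> apart p r" "\<And>r. r \<in> S \<Longrightarrow> apart q r"
  using assms by (simp_all add: pair_split_def)

lemma pair_splitI:
  assumes "S \<in> configs n" "p \<in> strip" "q \<in> strip" "snd q < snd p" "fst p - fst q \<in> D" "apart p q"
    "\<And>r. r \<in> S \<Longrightarrow> fst r < fst p" "\<And>r. r \<in> S \<Longrightarrow> fst r < fst q"
    "\<And>r. r \<in> S \<Longrightarrow> apart p r" "\<And>r. r \<in> S \<Longrightarrow> apart q r"
  shows "(S, p, q) \<in> pair_split D n"
  using assms by (simp add: pair_split_def)

lemma add_pair_in_configs:
  assumes "z \<in> pair_split D n"
  shows "add_pair z \<in> configs (Suc (Suc n))"
proof -
  obtain S p q where z: "z = (S, p, q)" by (metis surj_pair)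
  note d = pair_splitD[OF assms[unfolded z]]
  have "insert q S \<in> configs (Suc n)" using d by (intro insert_in_configs) auto
  then have "insert p (insert q S) \<in> configs (Suc (Suc n))" using d by (intro insert_in_configs) auto
  then show ?thesis by (simp add: add_pair_def z)
qed

text \<open>
  As for a single disk, closeness is chosen below all gaps: between the pair and the other disks,
  between the heights of \<open>p\<close> and \<open>q\<close> (so that upper and lower are not confused), and between the
  offset and the complement of \<open>D\<close>.
\<close>

lemma add_pair_lift:
  assumes D: "open D" and z: "(S, v) \<in> pair_split D n" and e: "0 < e"
  shows "\<exists>d>0. \<forall>T\<in>configs (Suc (Suc n)). hclose d (add_pair (S, v)) T \<longrightarrow>
      (\<exists>S' v'. (S', v') \<in> pair_split D n \<and> add_pair (S', v') = T \<and> hclose e S S' \<and> dist v v' < e)"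
proof -
  obtain p q where v: "v = (p, q)" by (metis surj_pair)
  note zd = pair_splitD[OF z[unfolded v]]
  obtain g where g: "g > 0" "\<And>r. r \<in> S \<Longrightarrow> fst r + g \<le> min (fst p) (fst q)"
    using uniform_gap[of S fst "min (fst p) (fst q)"] configsD(1)[OF zd(1)] zd(7,8)
    by (metis min_less_iff_conj)
  obtain h where h: "h > 0" "ball (fst p - fst q) h \<subseteq> D"
    using D zd(5) open_contains_ball by blast
  define k where "k = snd p - snd q"
  have k: "k > 0" unfolding k_def using zd(4) by simp
  define d where "d = min (min (e/2) (1/2)) (min (g/2) (min (h/2) (k/2)))"
  have d: "d > 0" "2 * d \<le> e" "d \<le> 1/2" "2 * d \<le> g" "2 * d \<le> h" "2 * d \<le> k"
    unfolding d_def using e g(1) h(1) k by auto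
  show ?thesis
  proof (intro exI[of _ d] conjI ballI impI)
    fix T assume T: "T \<in> configs (Suc (Suc n))" "hclose d (add_pair (S, v)) T"
    have ins: "add_pair (S, v) = insert p (insert q S)" by (simp add: add_pair_def v)
    obtain f where f: "bij_betw f (insert p (insert q S)) T"
      "\<And>r. r \<in> insert p (insert q S) \<Longrightarrow> dist r (f r) < d"
      using hclose_matching[OF add_pair_in_configs[OF z] T(1) d(3) T(2)] unfolding ins by blast
    have im: "insert (f p) (insert (f q) (f ` S)) = T" and inj: "inj_on f (insert p (insert q S))"
      using f(1) by (simp_all add: bij_betw_def)
    have fp: "\<bar>fst p - fst (f p)\<bar> < d" "\<bar>snd p - snd (f p)\<bar> < d"
      and fq: "\<bar>fst q - fst (f q)\<bar> < d" "\<bar>snd q - snd (f q)\<bar> < d"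
      using fst_dist_less[OF f(2)[of p]] fst_dist_less[OF f(2)[of q]] by simp_all
    have less: "fst (f r) < fst (f p)" "fst (f r) < fst (f q)" if r: "r \<in> S" for r
      using fst_dist_less(1)[OF f(2)[of r]] fp fq g(2)[OF r] d(4) r by auto
    have mem: "f p \<in> T" "f q \<in> T" "\<And>r. r \<in> S \<Longrightarrow> f r \<in> T" using im by auto
    have yy: "snd (f q) < snd (f p)" using fp(2) fq(2) d(6) unfolding k_def by linarith
    have "(f ` S, f p, f q) \<in> pair_split D n"
    proof (rule pair_splitI)
      show "f ` S \<in> configs n"
      proof (rule configs_subset[OF T(1)])
        have "inj_on f S" using inj by (rule inj_on_subset) blast
        then show "card (f ` S) = n" using configsD(2)[OF zd(1)] by (simp add: card_image)
      qed (use mem in blast)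
      show "f p \<in> strip" "f q \<in> strip" using mem configsD(3)[OF T(1)] by simp_all
      show "snd (f q) < snd (f p)" by (rule yy)
      have "fst (f p) - fst (f q) \<in> ball (fst p - fst q) h"
        using fp(1) fq(1) d(5) by (simp add: dist_real_def)
      then show "fst (f p) - fst (f q) \<in> D" using h(2) by blast
      show "apart (f p) (f q)" using configsD(4)[OF T(1) mem(1,2)] yy by (metis less_irrefl)
    next
      fix r' assume "r' \<in> f ` S"
      then obtain r where r: "r \<in> S" "r' = f r" by blast
      then show l: "fst r' < fst (f p)" "fst r' < fst (f q)" using less by simp_all
      have ne: "f p \<noteq> r'" "f q \<noteq> r'" using l by auto
      have "r' \<in> T" using mem(3)[OF r(1)] r(2) by simp
      then show "apart (f p) r'" "apart (f q) r'"
        using configsD(4)[OF T(1) mem(1) _ ne(1)] configsD(4)[OF T(1) mem(2) _ ne(2)] by simp_all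
    qed
    moreover have "hclose e S (f ` S)"
    proof -
      have "hclose d S (f ` S)" unfolding hclose_def using f(2) by blast
      then show ?thesis using d(1,2) hclose_mono[of d S "f ` S" e] by simp
    qed
    moreover have "dist v (f p, f q) < e"
    proof -
      have "dist v (f p, f q) \<le> dist p (f p) + dist q (f q)"
        unfolding v dist_Pair_Pair by (rule sqrt_sum_squares_le_sum) simp_all
      also have "\<dots> < d + d" using f(2) by (intro add_strict_mono) simp_all
      finally show ?thesis using d(2) by simp
    qed
    moreover have "add_pair (f ` S, f p, f q) = T" using im by (simp add: add_pair_def)
    ultimately show "\<exists>S' v'. (S', v') \<in> pair_split D n \<and> add_pair (S', v') = T \<and> hclose e S S' \<and> dist v v' < e"
      by blast
  qed (rule d(1))
qed

lemma inj_on_add_pair: "inj_on add_pair (pair_split D n)"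
proof (rule inj_onI)
  fix z z' assume z: "z \<in> pair_split D n" and z': "z' \<in> pair_split D n" and eq: "add_pair z = add_pair z'"
  obtain S p q S' p' q' where sp: "z = (S, p, q)" "z' = (S', p', q')" by (metis surj_pair)
  note d = pair_splitD[OF z[unfolded sp]] and d' = pair_splitD[OF z'[unfolded sp]]
  have ins: "insert p (insert q S) = insert p' (insert q' S')" using eq by (simp add: add_pair_def sp)
  have mem1: "p \<in> insert p' (insert q' S')" "q \<in> insert p' (insert q' S')"
    unfolding ins[symmetric] by simp_all
  have mem2: "p' \<in> insert p (insert q S)" "q' \<in> insert p (insert q S)"
    unfolding ins by simp_all
  note mem = mem1 mem2
  have pq: "p \<noteq> q" "p' \<noteq> q'" using d(4) d'(4) by auto
  \<comment> \<open>A point of one pair cannot lie among the remaining points of the other description, for then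
    both points of the other pair would be to its right and would have to form the first pair.\<close>
  have nS: "a \<notin> S" if a: "a = p' \<or> a = q'" for a
  proof
    assume aS: "a \<in> S"
    then have lt: "fst a < fst p" "fst a < fst q" using d(7,8) by simp_all
    moreover have "fst b < fst a" if "b \<in> S'" for b using d'(7,8)[OF that] a by auto
    ultimately have "p \<notin> S'" "q \<notin> S'" using less_asym by blast+
    then have "p \<in> {p', q'}" "q \<in> {p', q'}" using mem by auto
    then have "a = p \<or> a = q" using a pq by auto
    then show False using lt by auto
  qed
  then have "p' \<in> {p, q}" "q' \<in> {p, q}" using mem by auto
  then have pp: "p' = p" "q' = q" using pq d(4) d'(4) by auto
  have "p \<notin> S" "q \<notin> S" "p \<notin> S'" "q \<notin> S'" using d(7,8) d'(7,8) pp by blast+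
  then have "S = S'" using ins pp by (metis insert_ident insert_iff pq(1))
  then show "z = z'" using sp pp by simp
qed

lemma continuous_map_add_pair: "continuous_map (marked_space E) hausdorff_topology add_pair"
proof -
  have "continuous_map (marked_space E) euclidean (\<lambda>z. fst (snd z))"
    "continuous_map (marked_space E) euclidean (\<lambda>z. snd (snd z))"
    by (intro continuous_map_marked_comp continuous_intros)+
  then have "continuous_map (marked_space E) hausdorff_topology
      (\<lambda>z. insert (fst (snd z)) (insert (snd (snd z)) (fst z)))"
    by (intro continuous_map_hausdorff_insert continuous_map_marked_fst)
  then show ?thesis by (simp add: add_pair_def[abs_def])
qed

definition paired_last :: "nat \<Rightarrow> (real \<times> real) set set" where
  "paired_last n = add_pair ` pair_split {-1/2<..<1/2} n"

lemma homeomorphic_map_add_pair: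
  "homeomorphic_map (marked_space (pair_split {-1/2<..<1/2} n))
     (subtopology hausdorff_topology (paired_last n)) add_pair"
  unfolding paired_last_def
  by (rule homeomorphic_map_marked_space[where Y="configs (Suc (Suc n))", OF _ _
        continuous_map_add_pair inj_on_add_pair])
    (erule add_pair_in_configs, rule add_pair_lift[OF open_greaterThanLessThan], assumption, assumption)

lemma openin_paired_last: "openin (config_space (Suc (Suc n))) (paired_last n)"
  unfolding paired_last_def
proof (rule openin_image_marked_space[where E="pair_split {-1/2<..<1/2} n"])
  show "openin (marked_space (pair_split {-1/2<..<1/2} n)) (pair_split {-1/2<..<1/2} n)"
    using openin_topspace[of "marked_space (pair_split {-1/2<..<1/2} n)"] by simp
qed (erule add_pair_in_configs, rule add_pair_lift[OF open_greaterThanLessThan], assumption, assumption)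

lemma pair_split_restrict:
  "pair_split {-1/2<..<1/2} n \<inter> pair_split D n = pair_split ({-1/2<..<1/2} \<inter> D) n"
  by (auto simp: pair_split_def)

lemma openin_pair_split:
  assumes "open D" "D \<subseteq> {-1/2<..<1/2}"
  shows "openin (marked_space (pair_split {-1/2<..<1/2} n)) (pair_split D n)"
proof -
  let ?X = "marked_space (pair_split {-1/2<..<1/2} n)"
  have "continuous_map ?X euclidean (\<lambda>z. fst (fst (snd z)) - fst (snd (snd z)))"
    by (rule continuous_map_marked_comp[where h="\<lambda>v. fst (fst v) - fst (snd v)"]) (intro continuous_intros)
  then have "openin ?X {z \<in> topspace ?X. fst (fst (snd z)) - fst (snd (snd z)) \<in> D}"
    by (rule openin_continuous_map_preimage) (use assms in simp)
  moreover have "{z \<in> topspace ?X. fst (fst (snd z)) - fst (snd (snd z)) \<in> D} = pair_split D n"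
    using assms(2) by (auto simp: pair_split_def)
  ultimately show ?thesis by simp
qed

lemma add_pair_in_unique_last:
  assumes "z \<in> pair_split D n"
  shows "add_pair z \<in> unique_last (Suc n) \<longleftrightarrow> fst (fst (snd z)) \<noteq> fst (snd (snd z))"
proof -
  obtain S p q where z: "z = (S, p, q)" by (metis surj_pair)
  note d = pair_splitD[OF assms[unfolded z]]
  have eq: "add_pair z = insert p (insert q S)" by (simp add: add_pair_def z)
  have pq: "p \<noteq> q" using d(4) by auto
  have "fst p \<noteq> fst q" if "m \<in> insert p (insert q S)" "\<forall>r\<in>insert p (insert q S). r \<noteq> m \<longrightarrow> fst r < fst m" for m
    using that pq d(7)[of m] by auto
  moreover have "\<exists>m\<in>insert p (insert q S). \<forall>r\<in>insert p (insert q S). r \<noteq> m \<longrightarrow> fst r < fst m" if "fst p \<noteq> fst q"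
  proof (cases "fst p < fst q")
    case True
    then show ?thesis using d(8) by (intro bexI[of _ q]) auto
  next
    case False
    then show ?thesis using d(7) that by (intro bexI[of _ p]) auto
  qed
  ultimately have "(\<exists>m\<in>insert p (insert q S). \<forall>r\<in>insert p (insert q S). r \<noteq> m \<longrightarrow> fst r < fst m) \<longleftrightarrow> fst p \<noteq> fst q"
    by meson
  then show ?thesis
    using add_pair_in_configs[OF assms] unfolding unique_last_iff eq by (simp only: z fst_conv snd_conv simp_thms)
qed

text \<open>
  Two disks with the same first coordinate are stacked, and since the centres range over a height of
  \<open>1\<close> only, their heights are \<open>1/2\<close> and \<open>3/2\<close> and no third disk fits on the same vertical line. So
  if the rightmost disk is not unique, the configuration ends in exactly one stacked pair.
\<close>

lemma configs_cover: "configs (Suc (Suc n)) = unique_last (Suc n) \<union> paired_last n"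
proof
  have "paired_last n \<subseteq> configs (Suc (Suc n))" unfolding paired_last_def using add_pair_in_configs by blast
  then show "unique_last (Suc n) \<union> paired_last n \<subseteq> configs (Suc (Suc n))" using unique_last_iff by blast
  show "configs (Suc (Suc n)) \<subseteq> unique_last (Suc n) \<union> paired_last n"
  proof
    fix T assume T: "T \<in> configs (Suc (Suc n))"
    have fin: "finite T" "T \<noteq> {}" using configsD(1,2)[OF T] by auto
    then have "Max (fst ` T) \<in> fst ` T" by (intro Max_in) auto
    then obtain m where m: "m \<in> T" "fst m = Max (fst ` T)" by (metis imageE)
    have le: "fst r \<le> fst m" if "r \<in> T" for r using m(2) fin(1) that by simp
    show "T \<in> unique_last (Suc n) \<union> paired_last n"
    proof (cases "\<forall>q\<in>T. q \<noteq> m \<longrightarrow> fst q < fst m")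
      case True
      then show ?thesis using T m(1) unique_last_iff by blast
    next
      case False
      then obtain l where l': "l \<in> T" "l \<noteq> m" "\<not> fst l < fst m" by blast
      then have l: "l \<in> T" "l \<noteq> m" "fst l = fst m" using le[of l] by simp_all
      have "\<exists>p q. p \<in> T \<and> q \<in> T \<and> fst p = fst m \<and> fst q = fst m \<and> snd q < snd p"
      proof (cases "snd l < snd m")
        case True
        then show ?thesis using m(1) l by blast
      next
        case False
        then have "snd m < snd l" using l prod_eqI[of l m] by force
        then show ?thesis using m(1) l by blast
      qed
      then obtain p q where pq: "p \<in> T" "q \<in> T" "fst p = fst m" "fst q = fst m" "snd q < snd p" by blast
      have vert: "1 \<le> \<bar>snd a - snd b\<bar>" if "a \<in> T" "b \<in> T" "fst a = fst b" "a \<noteq> b" for a b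
        using configsD(4)[OF T that(1,2,4)] that(3)
        by (simp add: apart_def abs_le_square_iff[of 1, simplified])
      have ht: "1/2 \<le> snd a" "snd a \<le> 3/2" if "a \<in> T" for a
        using configsD(3)[OF T that] by (simp_all add: strip_def)
      have ne: "p \<noteq> q" using pq(5) by auto
      have hpq: "snd p = 3/2" "snd q = 1/2"
        using vert[OF pq(1,2) _ ne] pq ht[OF pq(1)] ht[OF pq(2)] by auto
      have rest: "fst r < fst m" if r: "r \<in> T" "r \<noteq> p" "r \<noteq> q" for r
      proof (rule ccontr)
        assume "\<not> fst r < fst m"
        then have "fst r = fst m" using le[OF r(1)] by simp
        then have "1 \<le> \<bar>snd r - snd p\<bar>" "1 \<le> \<bar>snd r - snd q\<bar>"
          using vert[OF r(1) pq(1)] vert[OF r(1) pq(2)] pq r by auto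
        then show False using hpq ht[OF r(1)] by auto
      qed
      have "(T - {p, q}, p, q) \<in> pair_split {-1/2<..<1/2} n"
      proof (rule pair_splitI)
        show "T - {p, q} \<in> configs n"
        proof (rule configs_subset[OF T])
          have "card (T - {p, q}) = card T - card {p, q}" using pq fin by (intro card_Diff_subset) auto
          then show "card (T - {p, q}) = n" using configsD(2)[OF T] ne by simp
        qed blast
        show "p \<in> strip" "q \<in> strip" using configsD(3)[OF T] pq by simp_all
        show "apart p q" by (rule configsD(4)[OF T pq(1,2) ne])
      next
        fix r assume r: "r \<in> T - {p, q}"
        then show "fst r < fst p" "fst r < fst q" using rest pq by auto
        show "apart p r" using configsD(4)[OF T pq(1)] r by blast
        show "apart q r" using configsD(4)[OF T pq(2)] r by blast
      qed (use pq in auto)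
      moreover have "add_pair (T - {p, q}, p, q) = T" using pq(1,2) by (auto simp: add_pair_def)
      ultimately have "T \<in> paired_last n" unfolding paired_last_def by (metis imageI)
      then show ?thesis by blast
    qed
  qed
qed

text \<open>
  The pair is moved to a standard position in three steps: both disks go to the right by \<open>1\<close>, out of
  reach of the others; then they go to the boundary of the strip, which only increases their distance;
  finally they slide horizontally, at vertical distance \<open>1\<close> and hence without restriction on their offset,
  which stays in \<open>D\<close> by convexity. The argument is insensitive to \<open>D\<close>, so it applies to the whole
  neighbourhood and to each of its sides.
\<close>

lemma pair_split_homology:
  assumes D: "convex D" "\<tau> \<in> D" "D \<subseteq> {-1/2<..<1/2}"
  shows "hom_induced k (marked_space (pair_split D n)) {} (config_space n) {} fst
    \<in> iso (homology_group k (marked_space (pair_split D n))) (homology_group k (config_space n))"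
proof (rule marked_space_homotopy_equivalence[where s="\<lambda>m. ((m + 2 + \<tau>, 3/2), (m + 2, 1/2))"])
  let ?E = "pair_split D n"
  have \<tau>: "-1/2 < \<tau>" using D(2,3) by auto
  show E: "\<And>S v. (S, v) \<in> ?E \<Longrightarrow> S \<in> configs n" by (simp add: pair_split_def)
  show s: "continuous_on UNIV (\<lambda>m::real. ((m + 2 + \<tau>, 3/2 :: real), (m + 2, 1/2 :: real)))"
    by (intro continuous_intros)
  show "(S, (rightmost S + 2 + \<tau>, 3/2), (rightmost S + 2, 1/2)) \<in> ?E" if S: "S \<in> configs n" for S
  proof -
    have far: "fst r + 1 \<le> rightmost S + 2 + \<tau>" "fst r + 1 \<le> rightmost S + 2" if "r \<in> S" for r
      using le_rightmost[OF configsD(1)[OF S] that] \<tau> by auto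
    show ?thesis
    proof (rule pair_splitI)
      fix r assume r: "r \<in> S"
      show "apart (rightmost S + 2 + \<tau>, 3/2) r" "apart (rightmost S + 2, 1/2) r"
        by (rule apart_if_far; use far[OF r] in simp)+
      show "fst r < fst (rightmost S + 2 + \<tau>, 3/2::real)" "fst r < fst (rightmost S + 2, 1/2::real)"
        using far[OF r] by simp_all
    qed (use S D(2) in \<open>simp_all add: strip_def apart_def\<close>)
  qed
  let ?g1 = "\<lambda>v::(real\<times>real)\<times>(real\<times>real). ((fst (fst v) + 1, snd (fst v)), (fst (snd v) + 1, snd (snd v)))"
  let ?g2 = "\<lambda>v::(real\<times>real)\<times>(real\<times>real). ((fst (fst v) + 1, 3/2::real), (fst (snd v) + 1, 1/2::real))"
  have g1: "continuous_on UNIV ?g1" and g2: "continuous_on UNIV ?g2" by (intro continuous_intros)+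
  have 1: "homotopic_with (\<lambda>_. True) (marked_space ?E) (marked_space ?E)
       (\<lambda>z. (fst z, snd z)) (\<lambda>z. (fst z, ?g1 (snd z)))"
  proof (rule homotopic_with_linear_snd[OF continuous_map_marked_fst continuous_map_marked_snd
        continuous_map_marked_comp[OF g1]])
    fix z and t :: real assume z: "z \<in> topspace (marked_space ?E)" and t: "0 \<le> t" "t \<le> 1"
    obtain S a b c d where sab: "z = (S, (a, b), (c, d))" by (metis surj_pair)
    have "(S, (a, b), (c, d)) \<in> ?E" using z by (simp add: sab)
    note zd = pair_splitD[OF this, simplified]
    have "(S, (a + t, b), (c + t, d)) \<in> ?E"
    proof (rule pair_splitI)
      fix r assume r: "r \<in> S"
      show "apart (a + t, b) r" using apart_right_shift[OF zd(9)[OF r], of "a + t"] zd(7)[OF r] t by simp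
      show "apart (c + t, d) r" using apart_right_shift[OF zd(10)[OF r], of "c + t"] zd(8)[OF r] t by simp
      show "fst r < fst (a + t, b)" "fst r < fst (c + t, d)" using zd(7,8)[OF r] t by simp_all
    qed (use zd in \<open>simp_all add: strip_def apart_def\<close>)
    moreover have "(1 - t) *\<^sub>R snd z + t *\<^sub>R ?g1 (snd z) = ((a + t, b), (c + t, d))"
      by (simp add: sab algebra_simps)
    ultimately show "(fst z, (1 - t) *\<^sub>R snd z + t *\<^sub>R ?g1 (snd z)) \<in> ?E" by (simp add: sab)
  qed
  have 2: "homotopic_with (\<lambda>_. True) (marked_space ?E) (marked_space ?E)
       (\<lambda>z. (fst z, ?g1 (snd z))) (\<lambda>z. (fst z, ?g2 (snd z)))"
  proof (rule homotopic_with_linear_snd[OF continuous_map_marked_fst continuous_map_marked_comp[OF g1]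
        continuous_map_marked_comp[OF g2]])
    fix z and t :: real assume z: "z \<in> topspace (marked_space ?E)" and t: "0 \<le> t" "t \<le> 1"
    obtain S a b c d where sab: "z = (S, (a, b), (c, d))" by (metis surj_pair)
    have "(S, (a, b), (c, d)) \<in> ?E" using z by (simp add: sab)
    note zd = pair_splitD[OF this, simplified]
    have bd: "1/2 \<le> b" "b \<le> 3/2" "1/2 \<le> d" "d \<le> 3/2" using zd(2,3) by (simp_all add: strip_def)
    let ?b = "(1 - t) * b + t * (3/2)" and ?d = "(1 - t) * d + t * (1/2)"
    have "?b - ?d = (1 - t) * (b - d) + t * 1" by (simp add: field_simps)
    moreover have "b - d \<le> (1 - t) * (b - d) + t * 1"
      by (rule convex_combination_ge) (use bd t in auto)
    ultimately have bd': "b - d \<le> ?b - ?d" by simp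
    have "(b - d)\<^sup>2 \<le> (?b - ?d)\<^sup>2" using bd' zd(4) by (intro power_mono) auto
    then have ap: "apart (a + 1, ?b) (c + 1, ?d)" using zd(6) by (simp add: apart_def)
    have "(S, (a + 1, ?b), (c + 1, ?d)) \<in> ?E"
    proof (rule pair_splitI)
      have "1/2 \<le> ?b" "1/2 \<le> ?d" by (rule convex_combination_ge; use bd t in simp)+
      moreover have "?b \<le> 3/2" "?d \<le> 3/2" by (rule convex_combination_le; use bd t in simp)+
      ultimately show "(a + 1, ?b) \<in> strip" "(c + 1, ?d) \<in> strip" by (simp_all add: strip_def)
      show "snd (c + 1, ?d) < snd (a + 1, ?b)" using bd' zd(4) by simp
      show "apart (a + 1, ?b) (c + 1, ?d)" by (rule ap)
    next
      fix r assume r: "r \<in> S"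
      show "apart (a + 1, ?b) r" "apart (c + 1, ?d) r"
        using zd(7,8)[OF r] by (simp_all add: apart_if_far)
      show "fst r < fst (a + 1, ?b)" "fst r < fst (c + 1, ?d)" using zd(7,8)[OF r] by simp_all
    qed (use zd in simp_all)
    moreover have "(1 - t) *\<^sub>R ?g1 (snd z) + t *\<^sub>R ?g2 (snd z) = ((a + 1, ?b), (c + 1, ?d))"
      by (simp add: sab algebra_simps)
    ultimately show "(fst z, (1 - t) *\<^sub>R ?g1 (snd z) + t *\<^sub>R ?g2 (snd z)) \<in> ?E" by (simp add: sab)
  qed
  have 3: "homotopic_with (\<lambda>_. True) (marked_space ?E) (marked_space ?E)
       (\<lambda>z. (fst z, ?g2 (snd z)))
       (\<lambda>z. (fst z, (\<lambda>m. ((m + 2 + \<tau>, 3/2), (m + 2, 1/2))) (rightmost (fst z))))"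
  proof (rule homotopic_with_linear_snd[OF continuous_map_marked_fst continuous_map_marked_comp[OF g2]
        continuous_map_marked_rightmost[OF E s]])
    fix z and t :: real assume z: "z \<in> topspace (marked_space ?E)" and t: "0 \<le> t" "t \<le> 1"
    obtain S a b c d where sab: "z = (S, (a, b), (c, d))" by (metis surj_pair)
    have "(S, (a, b), (c, d)) \<in> ?E" using z by (simp add: sab)
    note zd = pair_splitD[OF this, simplified]
    let ?a = "(1 - t) * (a + 1) + t * (rightmost S + 2 + \<tau>)" and ?c = "(1 - t) * (c + 1) + t * (rightmost S + 2)"
    have far: "fst r + 1 < ?a" "fst r + 1 < ?c" if r: "r \<in> S" for r
      by (rule convex_combination_gt; use zd(7,8)[OF r] le_rightmost[OF configsD(1)[OF zd(1)] r] \<tau> t in simp)+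
    have "(S, (?a, 3/2), (?c, 1/2)) \<in> ?E"
    proof (rule pair_splitI)
      have "(1 - t) *\<^sub>R (a - c) + t *\<^sub>R \<tau> \<in> D" using D(1,2) zd(5) t by (intro convexD_alt)
      moreover have "?a - ?c = (1 - t) *\<^sub>R (a - c) + t *\<^sub>R \<tau>" by (simp add: algebra_simps)
      ultimately show "fst (?a, 3/2::real) - fst (?c, 1/2::real) \<in> D" by simp
      show "apart (?a, 3/2) (?c, 1/2)" by (simp add: apart_def)
    next
      fix r assume r: "r \<in> S"
      show "apart (?a, 3/2) r" "apart (?c, 1/2) r" 
        using far[OF r] by (simp_all only: apart_if_far fst_conv less_imp_le)
      show "fst r < fst (?a, 3/2::real)" "fst r < fst (?c, 1/2::real)" using far[OF r] by simp_all
    qed (use zd in \<open>simp_all add: strip_def\<close>)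
    moreover have "(1 - t) *\<^sub>R ?g2 (snd z) + t *\<^sub>R ((rightmost (fst z) + 2 + \<tau>, 3/2), (rightmost (fst z) + 2, 1/2))
        = ((?a, 3/2), (?c, 1/2))"
      by (simp add: sab field_simps)
    ultimately show "(fst z, (1 - t) *\<^sub>R ?g2 (snd z) + t *\<^sub>R ((rightmost (fst z) + 2 + \<tau>, 3/2), (rightmost (fst z) + 2, 1/2))) \<in> ?E"
      by (simp only: sab fst_conv)
  qed
  show "homotopic_with (\<lambda>_. True) (marked_space ?E) (marked_space ?E)
       (\<lambda>z. (fst z, snd z)) (\<lambda>z. (fst z, (\<lambda>m. ((m + 2 + \<tau>, 3/2), (m + 2, 1/2))) (rightmost (fst z))))"
    by (rule homotopic_with_trans[OF homotopic_with_trans[OF 1 2] 3])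
qed

section \<open>Homology of a union along a two-sided collar\<close>


lemma iso_cancel_comp:
  assumes gf: "g \<circ> f \<in> iso G K" and g: "g \<in> iso H K" and f: "f \<in> hom G H"
  shows "f \<in> iso G H"
proof -
  have inj: "inj_on f (carrier G)"
    using gf by (auto simp: iso_def bij_betw_def intro: inj_on_imageI2)
  have "y \<in> f ` carrier G" if y: "y \<in> carrier H" for y
  proof -
    have "g y \<in> (g \<circ> f) ` carrier G" using gf g y by (auto simp: iso_def bij_betw_def)
    then obtain x where x: "x \<in> carrier G" "g (f x) = g y" by auto
    have "f x \<in> carrier H" using f x(1) by (rule hom_in_carrier)
    moreover have "inj_on g (carrier H)" using g by (simp add: iso_def bij_betw_def)
    ultimately have "f x = y" using x(2) y by (meson inj_onD)
    then show ?thesis using x(1) by blast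
  qed
  moreover have "f ` carrier G \<subseteq> carrier H" by (rule image_subsetI) (rule hom_in_carrier[OF f])
  ultimately have "f ` carrier G = carrier H" by blast
  then show ?thesis using f inj by (simp add: iso_def bij_betw_def)
qed

lemma trivial_relative_homology_group_inclusion_iso:
  assumes "\<And>p. hom_induced p (subtopology X S) {} X {} id \<in> iso (homology_group p (subtopology X S)) (homology_group p X)"
  shows "trivial_group (relative_homology_group p X S)"
proof (rule exact_seq_imp_triviality)
  show "exact_seq ([homology_group (p-1) X,
                    homology_group (p-1) (subtopology X S),
                    relative_homology_group p X S, homology_group p X, homology_group p (subtopology X S)],
                   [hom_induced (p-1) (subtopology X S) {} X {} id,
                    hom_boundary p X S,
                    hom_induced p X {} X S id,
                    hom_induced p (subtopology X S) {} X {} id])"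
    using homology_exactness_axiom_1 homology_exactness_axiom_2 homology_exactness_axiom_3
    by (metis exact_seq_cons_iff)
qed (rule assms)+

text \<open>
  Let \<open>X\<close> be a neighbourhood with sides \<open>P\<close> and \<open>N\<close>, all with the homology of \<open>Y\<close>. As \<open>N\<close> carries all
  homology of \<open>X\<close>, the sequence of the triple \<open>(X, P \<union> N, N)\<close> identifies \<open>H\<^sub>p(X, P \<union> N)\<close> with
  \<open>H\<^sub>p\<^sub>-\<^sub>1(P \<union> N, N)\<close>, and excision of \<open>N\<close> leaves \<open>H\<^sub>p\<^sub>-\<^sub>1(P)\<close>.
\<close>

lemma relative_homology_two_sided:
  assumes P: "openin X P" and N: "openin X N" and disj: "P \<inter> N = {}"
    and f: "continuous_map X Y f"
    and isoX: "\<And>p. hom_induced p X {} Y {} f \<in> iso (homology_group p X) (homology_group p Y)"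
    and isoP: "\<And>p. hom_induced p (subtopology X P) {} Y {} f \<in> iso (homology_group p (subtopology X P)) (homology_group p Y)"
    and isoN: "\<And>p. hom_induced p (subtopology X N) {} Y {} f \<in> iso (homology_group p (subtopology X N)) (homology_group p Y)"
  shows "homology_group (p - 1) Y \<cong> relative_homology_group p X (P \<union> N)"
proof -
  let ?O = "P \<union> N"
  have "hom_induced p (subtopology X N) {} X {} id \<in> iso (homology_group p (subtopology X N)) (homology_group p X)" for p
  proof (rule iso_cancel_comp[OF _ isoX])
    have "hom_induced p X {} Y {} f \<circ> hom_induced p (subtopology X N) {} X {} id
        = hom_induced p (subtopology X N) {} Y {} (f \<circ> id)"
      by (rule hom_induced_compose_empty[symmetric]) (auto intro: f continuous_map_from_subtopology)
    then show "hom_induced p X {} Y {} f \<circ> hom_induced p (subtopology X N) {} X {} id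
        \<in> iso (homology_group p (subtopology X N)) (homology_group p Y)"
      using isoN by simp
  qed (rule hom_induced_hom)
  then have triv: "trivial_group (relative_homology_group p X N)" for p
    by (rule trivial_relative_homology_group_inclusion_iso)
  have rb: "hom_relboundary p X ?O N
      \<in> iso (relative_homology_group p X ?O) (relative_homology_group (p - 1) (subtopology X ?O) N)"
  proof (rule very_short_exact_sequence)
    show "exact_seq ([relative_homology_group (p-1) X N, relative_homology_group (p-1) (subtopology X ?O) N,
        relative_homology_group p X ?O, relative_homology_group p X N],
      [hom_induced (p-1) (subtopology X ?O) N X N id, hom_relboundary p X ?O N, hom_induced p X N X ?O id])"
      using homology_exactness_triple_1[of N ?O p X, OF Un_upper2] homology_exactness_triple_2[of N ?O p X, OF Un_upper2]
      by (simp only: exact_seq_cons_iff exact_seq_end_iff simp_thms)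
  qed (rule triv)+
  have 1: "relative_homology_group (p - 1) (subtopology X ?O) N \<cong> relative_homology_group p X ?O"
    by (rule group.iso_sym[OF _ is_isoI[OF rb]]) simp
  let ?Y = "subtopology X ?O"
  have top: "topspace ?Y = ?O" using openin_subset[OF P] openin_subset[OF N] by auto
  have oN: "openin ?Y N" and oP: "openin ?Y P"
    using P N by (auto simp: openin_subtopology_alt openin_open_subtopology openin_Un)
  have cN: "closedin ?Y N"
  proof -
    have "topspace ?Y - N = P" using top disj by auto
    then show ?thesis using oP top by (simp add: closedin_def)
  qed
  have "hom_induced (p-1) (subtopology ?Y (?O - N)) (N - N) (subtopology ?Y ?O) N id
    \<in> iso (relative_homology_group (p-1) (subtopology ?Y (?O - N)) (N - N))
          (relative_homology_group (p-1) (subtopology ?Y ?O) N)"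
    by (rule homology_excision_axiom) (use cN oN in \<open>simp_all add: closure_of_closedin interior_of_openin\<close>)
  moreover have "?O - N = P" using disj by auto
  moreover have "subtopology ?Y ?O = ?Y" "subtopology ?Y P = subtopology X P"
    by (simp_all add: subtopology_subtopology Int_absorb1)
  ultimately have "homology_group (p-1) (subtopology X P) \<cong> relative_homology_group (p-1) ?Y N"
    by (auto intro: is_isoI)
  moreover have "homology_group (p-1) Y \<cong> homology_group (p-1) (subtopology X P)"
    by (rule group.iso_sym[OF _ is_isoI[OF isoP]]) simp
  ultimately show ?thesis using 1 iso_trans by blast
qed

text \<open>
  The space \<open>U\<close> arises from its open subset \<open>A\<close> by adding a piece \<open>B\<close>, parametrised by \<open>j\<close>, that meets \<open>A\<close>
  in two sides \<open>P\<close> and \<open>N\<close>. By excision \<open>H\<^sub>p(U, A)\<close> is \<open>H\<^sub>p(X, P \<union> N)\<close>, that is \<open>H\<^sub>p\<^sub>-\<^sub>1(Y)\<close>. The map \<open>r\<close>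
  is the hypothesis that makes the long exact sequence of \<open>(U, A)\<close> fall apart: on \<open>P \<union> N\<close> it agrees up
  to homotopy with \<open>j\<close>, but it is defined on all of \<open>X\<close>. So the boundary map into \<open>H\<^sub>p\<^sub>-\<^sub>1(A)\<close> factors
  through two consecutive maps of the exact sequence of \<open>(X, P \<union> N)\<close> and vanishes.
\<close>

lemma free_homology_of_collared_union:
  assumes A: "openin U A" and B: "openin U B" and AB: "A \<union> B = topspace U"
    and j: "homeomorphic_map X (subtopology U B) j"
    and P: "openin X P" and N: "openin X N" and disj: "P \<inter> N = {}" and jO: "j ` (P \<union> N) = A \<inter> B"
    and f: "continuous_map X Y f"
    and isoX: "\<And>p. hom_induced p X {} Y {} f \<in> iso (homology_group p X) (homology_group p Y)"
    and isoP: "\<And>p. hom_induced p (subtopology X P) {} Y {} f \<in> iso (homology_group p (subtopology X P)) (homology_group p Y)"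
    and isoN: "\<And>p. hom_induced p (subtopology X N) {} Y {} f \<in> iso (homology_group p (subtopology X N)) (homology_group p Y)"
    and r: "continuous_map X (subtopology U A) r"
    and rP: "homotopic_with (\<lambda>_. True) (subtopology X P) (subtopology U A) j r"
    and rN: "homotopic_with (\<lambda>_. True) (subtopology X N) (subtopology U A) j r"
    and a: "free_of_rank (homology_group p (subtopology U A)) a"
    and b: "free_of_rank (homology_group (p - 1) Y) b"
  shows "free_of_rank (homology_group p U) (a + b)"
proof -
  let ?O = "P \<union> N" and ?UA = "subtopology U A" and ?UB = "subtopology U B"
  have AU: "A \<subseteq> topspace U" and BU: "B \<subseteq> topspace U" using A B openin_subset by auto
  have PX: "P \<subseteq> topspace X" and NX: "N \<subseteq> topspace X" using P N openin_subset by auto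
  have jc: "continuous_map X ?UB j" using j by (rule homeomorphic_imp_continuous_map)
  then have jU: "continuous_map X U j" by (simp add: continuous_map_in_subtopology)
  have jOA: "j \<in> ?O \<rightarrow> A" "j \<in> ?O \<rightarrow> A \<inter> B" using jO by auto
  let ?e = "\<lambda>q. hom_induced q X ?O U A j"
  have e: "?e q \<in> iso (relative_homology_group q X ?O) (relative_homology_group q U A)" for q
  proof -
    let ?C = "topspace U - B"
    have "hom_induced q (subtopology U (topspace U - ?C)) (A - ?C) (subtopology U (topspace U)) A id
      \<in> iso (relative_homology_group q (subtopology U (topspace U - ?C)) (A - ?C))
            (relative_homology_group q (subtopology U (topspace U)) A)"
    proof (rule homology_excision_axiom)
      have "U closure_of ?C = ?C" using B by (simp add: closure_of_closedin openin_closedin_eq)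
      moreover have "?C \<subseteq> A" using AB by auto
      ultimately show "U closure_of ?C \<subseteq> U interior_of A" using A by (simp add: interior_of_openin)
    qed (rule AU)
    moreover have "topspace U - ?C = B" "A - ?C = A \<inter> B" using BU AU by auto
    ultimately have ex: "hom_induced q ?UB (A \<inter> B) U A id
      \<in> iso (relative_homology_group q ?UB (A \<inter> B)) (relative_homology_group q U A)" by simp
    have "hom_induced q X ?O ?UB (A \<inter> B) j
      \<in> iso (relative_homology_group q X ?O) (relative_homology_group q ?UB (A \<inter> B))"
      by (rule homeomorphic_map_relative_homology_iso[OF j _ jO]) (use PX NX in auto)
    then have "hom_induced q ?UB (A \<inter> B) U A id \<circ> hom_induced q X ?O ?UB (A \<inter> B) j
      \<in> iso (relative_homology_group q X ?O) (relative_homology_group q U A)"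
      using ex by (rule iso_set_trans)
    moreover have "hom_induced q X ?O U A (id \<circ> j)
        = hom_induced q ?UB (A \<inter> B) U A id \<circ> hom_induced q X ?O ?UB (A \<inter> B) j"
      by (rule hom_induced_compose[OF jc jOA(2)]) (auto intro: continuous_map_from_subtopology)
    ultimately show ?thesis by simp
  qed
  \<comment> \<open>As \<open>P\<close> and \<open>N\<close> are open and disjoint, classes of \<open>P \<union> N\<close> are sums of classes of the sides,
    and the homotopies on the two sides need not be glued.\<close>
  have ext: "hom_induced q (subtopology X ?O) {} ?UA {} j c = hom_induced q (subtopology X ?O) {} ?UA {} r c"
    if c: "c \<in> carrier (homology_group q (subtopology X ?O))" for q c
  proof -
    let ?Z = "subtopology X ?O" and ?H = "homology_group q (subtopology X ?O)" and ?K = "homology_group q ?UA"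
    have sP: "subtopology ?Z P = subtopology X P" and sN: "subtopology ?Z N = subtopology X N"
      by (simp_all add: subtopology_subtopology Int_absorb1)
    let ?p = "hom_induced q (subtopology X P) {} ?Z {} id" and ?n = "hom_induced q (subtopology X N) {} ?Z {} id"
    have "openin ?Z P" "openin ?Z N"
      using P N by (auto simp: openin_subtopology_alt openin_open_subtopology openin_Un)
    then have "(\<lambda>(x, y). hom_induced q (subtopology ?Z P) {} ?Z {} id x \<otimes>\<^bsub>?H\<^esub> hom_induced q (subtopology ?Z N) {} ?Z {} id y)
      \<in> iso (homology_group q (subtopology ?Z P) \<times>\<times> homology_group q (subtopology ?Z N)) ?H"
      by (rule homology_additivity_explicit) (use disj PX NX in \<open>auto simp: disjnt_def\<close>)
    then have "(\<lambda>(x, y). ?p x \<otimes>\<^bsub>?H\<^esub> ?n y)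
        ` carrier (homology_group q (subtopology X P) \<times>\<times> homology_group q (subtopology X N)) = carrier ?H"
      unfolding sP sN by (simp add: iso_def bij_betw_def)
    then have "c \<in> (\<lambda>(x, y). ?p x \<otimes>\<^bsub>?H\<^esub> ?n y)
        ` carrier (homology_group q (subtopology X P) \<times>\<times> homology_group q (subtopology X N))"
      using c by simp
    then obtain x y where xy: "c = ?p x \<otimes>\<^bsub>?H\<^esub> ?n y" by auto
    have split: "hom_induced q ?Z {} ?UA {} g c
       = hom_induced q (subtopology X P) {} ?UA {} g x \<otimes>\<^bsub>?K\<^esub> hom_induced q (subtopology X N) {} ?UA {} g y"
      if g: "continuous_map ?Z ?UA g" for g
    proof -
      have "?p x \<in> carrier ?H" "?n y \<in> carrier ?H" by (simp_all add: hom_induced_carrier)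
      then have "hom_induced q ?Z {} ?UA {} g c = hom_induced q ?Z {} ?UA {} g (?p x) \<otimes>\<^bsub>?K\<^esub> hom_induced q ?Z {} ?UA {} g (?n y)"
        unfolding xy by (rule hom_mult[OF hom_induced_hom])
      moreover have "hom_induced q ?Z {} ?UA {} g (?p x) = hom_induced q (subtopology X P) {} ?UA {} (g \<circ> id) x"
        by (rule hom_induced_compose'[OF _ _ g]) (auto simp flip: sP intro: continuous_map_from_subtopology)
      moreover have "hom_induced q ?Z {} ?UA {} g (?n y) = hom_induced q (subtopology X N) {} ?UA {} (g \<circ> id) y"
        by (rule hom_induced_compose'[OF _ _ g]) (auto simp flip: sN intro: continuous_map_from_subtopology)
      ultimately show ?thesis by simp
    qed
    have "continuous_map ?Z ?UA j"
      using jU jOA(1) PX NX by (auto simp: continuous_map_in_subtopology continuous_map_from_subtopology)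
    moreover have "continuous_map ?Z ?UA r" using r by (rule continuous_map_from_subtopology)
    ultimately show ?thesis
      using split[of j] split[of r] homology_homotopy_empty[OF rP] homology_homotopy_empty[OF rN] by simp
  qed
  have triv: "trivial_homomorphism (relative_homology_group q U A) (homology_group (q - 1) ?UA) (hom_boundary q U A)" for q
    unfolding trivial_homomorphism_def
  proof (intro conjI ballI hom_boundary_hom)
    fix y assume "y \<in> carrier (relative_homology_group q U A)"
    moreover have "?e q ` carrier (relative_homology_group q X ?O) = carrier (relative_homology_group q U A)"
      using e[of q] by (simp add: iso_def bij_betw_def)
    ultimately obtain x where x: "x \<in> carrier (relative_homology_group q X ?O)" "y = ?e q x" by blast
    let ?Z = "subtopology X ?O" and ?c = "hom_boundary q X ?O x"
    have "hom_boundary q U A y = hom_induced (q - 1) ?Z {} ?UA {} j ?c"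
      using naturality_hom_induced[OF jU jOA(1), of q] unfolding x(2) by (metis comp_apply)
    also have "\<dots> = hom_induced (q - 1) ?Z {} ?UA {} r ?c"
      by (rule ext) (rule hom_boundary_carrier)
    also have "\<dots> = hom_induced (q - 1) X {} ?UA {} r (hom_induced (q - 1) ?Z {} X {} id ?c)"
      using hom_induced_compose'[of ?Z X id "{}" "{}" ?UA r "{}" "q - 1" ?c] r
      by (simp add: continuous_map_from_subtopology)
    also have "hom_induced (q - 1) ?Z {} X {} id ?c = \<one>\<^bsub>homology_group (q - 1) X\<^esub>"
    proof -
      have "hom_boundary q X ?O ` carrier (relative_homology_group q X ?O)
          = kernel (homology_group (q - 1) ?Z) (homology_group (q - 1) X) (hom_induced (q - 1) ?Z {} X {} id)"
        using homology_exactness_axiom_2[of q X ?O] by (simp only: exact_seq_cons_iff exact_seq_end_iff)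
      then have "?c \<in> kernel (homology_group (q - 1) ?Z) (homology_group (q - 1) X) (hom_induced (q - 1) ?Z {} X {} id)"
        using x(1) by blast
      then show ?thesis by (simp add: kernel_def)
    qed
    also have "hom_induced (q - 1) X {} ?UA {} r \<one>\<^bsub>homology_group (q - 1) X\<^esub> = \<one>\<^bsub>homology_group (q - 1) ?UA\<^esub>"
      by (rule hom_one[OF hom_induced_hom]) simp_all
    finally show "hom_boundary q U A y = \<one>\<^bsub>homology_group (q - 1) ?UA\<^esub>" .
  qed
  \<comment> \<open>With both neighbouring boundary maps zero, the long exact sequence yields a short one.\<close>
  let ?i = "hom_induced p ?UA {} U {} id" and ?q = "hom_induced p U {} U A id"
  have "exact_seq ([homology_group p U, homology_group p ?UA, relative_homology_group (p + 1) U A, homology_group (p + 1) U],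
     [?i, hom_boundary (p + 1) U A, hom_induced (p + 1) U {} U A id])"
    using homology_exactness_axiom_1[of "p + 1" U A] homology_exactness_axiom_2[of "p + 1" U A]
    by simp
  then have inj: "inj_on ?i (carrier (homology_group p ?UA))"
    by (rule exact_seq_mon_eq_triviality[THEN iffD2]) (use triv[of "p + 1"] in simp)
  have "exact_seq ([homology_group (p - 1) U, homology_group (p - 1) ?UA, relative_homology_group p U A, homology_group p U],
     [hom_induced (p - 1) ?UA {} U {} id, hom_boundary p U A, ?q])"
    using homology_exactness_axiom_1[of p U A] homology_exactness_axiom_2[of p U A]
    by simp
  then have surj: "?q ` carrier (homology_group p U) = carrier (relative_homology_group p U A)"
    using triv[of p] exact_seq_epi_eq_triviality by blast
  have ker: "?i ` carrier (homology_group p ?UA) = kernel (homology_group p U) (relative_homology_group p U A) ?q"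
    using homology_exactness_axiom_3[of p U A] by (simp only: exact_seq_cons_iff exact_seq_end_iff)
  have "relative_homology_group p X ?O \<cong> relative_homology_group p U A" using e by (rule is_isoI)
  then have "free_of_rank (relative_homology_group p U A) b"
    by (rule free_of_rank_iso[OF free_of_rank_iso[OF b relative_homology_two_sided[OF P N disj f isoX isoP isoN]]])
  then show ?thesis
    by (intro free_of_rank_short_exact[OF _ _ hom_induced_hom hom_induced_hom inj surj ker a]) simp_all
qed

section \<open>Homology of the unordered configuration spaces\<close>


text \<open>
  Configurations whose last two disks \<open>l\<close> and \<open>r\<close> have distinct first coordinates. Homotopies of pairs
  that stay in this set are homotopies of configurations with a unique rightmost disk.
\<close>

definition ordered_split :: "nat \<Rightarrow> ((real \<times> real) set \<times> ((real \<times> real) \<times> (real \<times> real))) set" where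
  "ordered_split n = {(S, l, r). S \<in> configs n \<and> l \<in> strip \<and> r \<in> strip \<and> fst l < fst r \<and> apart r l \<and>
     (\<forall>s\<in>S. fst s < fst l \<and> apart l s \<and> apart r s)}"

lemma ordered_splitI:
  assumes "S \<in> configs n" "l \<in> strip" "r \<in> strip" "fst l < fst r" "apart r l"
    "\<And>s. s \<in> S \<Longrightarrow> fst s < fst l" "\<And>s. s \<in> S \<Longrightarrow> apart l s" "\<And>s. s \<in> S \<Longrightarrow> apart r s"
  shows "(S, l, r) \<in> ordered_split n"
  using assms by (simp add: ordered_split_def)

lemma add_pair_ordered_split:
  assumes "z \<in> ordered_split n"
  shows "add_pair z \<in> unique_last (Suc n)"
proof -
  obtain S l r where z: "z = (S, l, r)" by (metis surj_pair)
  have d: "S \<in> configs n" "l \<in> strip" "r \<in> strip" "fst l < fst r" "apart r l"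
    "\<And>s. s \<in> S \<Longrightarrow> fst s < fst l" "\<And>s. s \<in> S \<Longrightarrow> apart l s" "\<And>s. s \<in> S \<Longrightarrow> apart r s"
    using assms by (simp_all add: z ordered_split_def)
  have "insert l S \<in> configs (Suc n)" using d(1,2,7) by (rule insert_in_configs)
  moreover have "fst s < fst r \<and> apart r s" if "s \<in> insert l S" for s
  proof (cases "s = l")
    case False
    then have "s \<in> S" using that by simp
    then show ?thesis using d(4) d(6)[of s] d(8)[of s] by simp
  qed (use d(4,5) in simp)
  ultimately have "(insert l S, r) \<in> last_split (Suc n)"
    using d(3) by (simp add: last_split_def)
  then have "add_last (insert l S, r) \<in> unique_last (Suc n)" unfolding unique_last_def by (rule imageI)
  moreover have "add_last (insert l S, r) = add_pair z" by (simp add: add_last_def add_pair_def z insert_commute)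
  ultimately show ?thesis by simp
qed

lemma homotopic_add_pair:
  fixes g g' :: "(real \<times> real) \<times> (real \<times> real) \<Rightarrow> (real \<times> real) \<times> (real \<times> real)"
  assumes g: "continuous_on UNIV g" and g': "continuous_on UNIV g'"
    and E: "\<And>S v t. (S, v) \<in> E \<Longrightarrow> 0 \<le> t \<Longrightarrow> t \<le> 1 \<Longrightarrow> (S, (1 - t) *\<^sub>R g v + t *\<^sub>R g' v) \<in> ordered_split n"
  shows "homotopic_with (\<lambda>_. True) (marked_space E) (subtopology hausdorff_topology (unique_last (Suc n)))
    (\<lambda>z. add_pair (fst z, g (snd z))) (\<lambda>z. add_pair (fst z, g' (snd z)))"
proof -
  have "homotopic_with (\<lambda>_. True) (marked_space E) (marked_space (ordered_split n))
      (\<lambda>z. (fst z, g (snd z))) (\<lambda>z. (fst z, g' (snd z)))"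
  proof (rule homotopic_with_linear_snd[OF continuous_map_marked_fst continuous_map_marked_comp[OF g]
        continuous_map_marked_comp[OF g']])
    fix z and t :: real assume "z \<in> topspace (marked_space E)" "0 \<le> t" "t \<le> 1"
    then show "(fst z, (1 - t) *\<^sub>R g (snd z) + t *\<^sub>R g' (snd z)) \<in> ordered_split n"
      using E[of "fst z" "snd z" t] by simp
  qed
  moreover have "continuous_map (marked_space (ordered_split n)) (subtopology hausdorff_topology (unique_last (Suc n))) add_pair"
    using continuous_map_add_pair add_pair_ordered_split by (auto simp: continuous_map_in_subtopology)
  ultimately have "homotopic_with (\<lambda>_. True) (marked_space E) (subtopology hausdorff_topology (unique_last (Suc n)))
    (add_pair \<circ> (\<lambda>z. (fst z, g (snd z)))) (add_pair \<circ> (\<lambda>z. (fst z, g' (snd z))))"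
    by (rule homotopic_with_compose_continuous_map_left) simp
  then show ?thesis by (simp add: o_def)
qed

text \<open>
  The upper disk \<open>p\<close> is pulled out of the pair and becomes the rightmost disk. Shifting \<open>q\<close> by \<open>1\<close> takes it
  out of reach of the other disks, and the further shift of \<open>p\<close> by \<open>2\<close> exceeds the offset by more than
  \<open>1\<close>, so this makes sense on both sides of the neighbourhood and across it.
\<close>

definition spread :: "(real \<times> real) \<times> (real \<times> real) \<Rightarrow> (real \<times> real) \<times> (real \<times> real)" where
  "spread v = ((fst (snd v) + 1, snd (snd v)), (fst (fst v) + 3, snd (fst v)))"

lemma continuous_on_spread: "continuous_on UNIV spread"
  unfolding spread_def by (intro continuous_intros)

lemma spread_in_ordered_split:
  assumes "(S, v) \<in> pair_split {-1/2<..<1/2} n"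
  shows "(S, spread v) \<in> ordered_split n"
proof -
  obtain a b c d where v: "v = ((a, b), (c, d))" by (metis surj_pair)
  note z = pair_splitD[OF assms[unfolded v], simplified]
  have ac: "c + 1 + 1 \<le> a + 3" using z(5) by linarith
  show ?thesis
    unfolding v spread_def fst_conv snd_conv
  proof (rule ordered_splitI)
    show "fst (c + 1, d) < fst (a + 3, b)" using ac by simp
    show "apart (a + 3, b) (c + 1, d)" by (rule apart_if_far) (use ac in simp)
  next
    fix s assume s: "s \<in> S"
    show "fst s < fst (c + 1, d)" using z(8)[OF s] by simp
    show "apart (c + 1, d) s" by (rule apart_if_far) (use z(8)[OF s] in simp)
    show "apart (a + 3, b) s" by (rule apart_if_far) (use z(7)[OF s] in simp)
  qed (use z in \<open>simp_all add: strip_def\<close>)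
qed

text \<open>
  If the upper disk already is the rightmost, moving both disks to the right at speeds \<open>3\<close> and \<open>1\<close> only
  increases their distance.
\<close>

lemma homotopic_add_pair_spread_pos:
  "homotopic_with (\<lambda>_. True) (marked_space (pair_split {0<..<1/2} n))
     (subtopology hausdorff_topology (unique_last (Suc n))) add_pair (\<lambda>z. add_pair (fst z, spread (snd z)))"
proof -
  let ?g = "\<lambda>v::(real \<times> real) \<times> (real \<times> real). (snd v, fst v)"
  have "homotopic_with (\<lambda>_. True) (marked_space (pair_split {0<..<1/2} n))
     (subtopology hausdorff_topology (unique_last (Suc n)))
     (\<lambda>z. add_pair (fst z, ?g (snd z))) (\<lambda>z. add_pair (fst z, spread (snd z)))"
  proof (rule homotopic_add_pair[OF _ continuous_on_spread])
    show "continuous_on UNIV ?g" by (intro continuous_intros)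
    fix S v and t :: real assume vE: "(S, v) \<in> pair_split {0<..<1/2} n" and t: "0 \<le> t" "t \<le> 1"
    obtain a b c d where v: "v = ((a, b), (c, d))" by (metis surj_pair)
    note z = pair_splitD[OF vE[unfolded v], simplified]
    have eq: "(1 - t) *\<^sub>R ?g v + t *\<^sub>R spread v = ((c + t, d), (a + 3 * t, b))"
      by (simp add: v spread_def algebra_simps)
    show "(S, (1 - t) *\<^sub>R ?g v + t *\<^sub>R spread v) \<in> ordered_split n"
      unfolding eq
    proof (rule ordered_splitI)
      show "fst (c + t, d) < fst (a + 3 * t, b)" using z(5) t by simp
      have "(a - c)\<^sup>2 \<le> (a + 3 * t - (c + t))\<^sup>2" using z(5) t by (intro power_mono) auto
      then show "apart (a + 3 * t, b) (c + t, d)" using z(6) by (simp add: apart_def)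
    next
      fix s assume s: "s \<in> S"
      show "fst s < fst (c + t, d)" using z(8)[OF s] t by simp
      show "apart (c + t, d) s" using apart_right_shift[OF z(10)[OF s], of "c + t"] z(8)[OF s] t by simp
      show "apart (a + 3 * t, b) s" using apart_right_shift[OF z(9)[OF s], of "a + 3 * t"] z(7)[OF s] t by simp
    qed (use z in \<open>simp_all add: strip_def\<close>)
  qed
  moreover have "(\<lambda>z. add_pair (fst z, ?g (snd z))) = add_pair"
    by (rule ext) (simp add: add_pair_def insert_commute)
  ultimately show ?thesis by simp
qed

text \<open>
  If the lower disk is the rightmost, it is first moved far to the right. The two disks are then more
  than \<open>1\<close> apart horizontally and can exchange their places, up to the horizontal shift, along straight
  segments: the left one travels between the two old positions while the right one does the opposite.
\<close>

lemma homotopic_add_pair_spread_neg: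
  "homotopic_with (\<lambda>_. True) (marked_space (pair_split {-1/2<..<0} n))
     (subtopology hausdorff_topology (unique_last (Suc n))) add_pair (\<lambda>z. add_pair (fst z, spread (snd z)))"
proof (rule homotopic_with_trans)
  let ?E = "pair_split {-1/2<..<0} n"
  let ?g = "\<lambda>v::(real \<times> real) \<times> (real \<times> real). ((fst (fst v) + 1, snd (fst v)), (fst (snd v) + 3, snd (snd v)))"
  have g: "continuous_on UNIV ?g" by (intro continuous_intros)
  have "homotopic_with (\<lambda>_. True) (marked_space ?E) (subtopology hausdorff_topology (unique_last (Suc n)))
     (\<lambda>z. add_pair (fst z, (\<lambda>v. v) (snd z))) (\<lambda>z. add_pair (fst z, ?g (snd z)))"
  proof (rule homotopic_add_pair[OF continuous_on_id g])
    fix S v and t :: real assume vE: "(S, v) \<in> ?E" and t: "0 \<le> t" "t \<le> 1"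
    obtain a b c d where v: "v = ((a, b), (c, d))" by (metis surj_pair)
    note z = pair_splitD[OF vE[unfolded v], simplified]
    have eq: "(1 - t) *\<^sub>R v + t *\<^sub>R ?g v = ((a + t, b), (c + 3 * t, d))"
      by (simp add: v algebra_simps)
    show "(S, (1 - t) *\<^sub>R v + t *\<^sub>R ?g v) \<in> ordered_split n"
      unfolding eq
    proof (rule ordered_splitI)
      show "fst (a + t, b) < fst (c + 3 * t, d)" using z(5) t by simp
      have "(c - a)\<^sup>2 \<le> (c + 3 * t - (a + t))\<^sup>2" using z(5) t by (intro power_mono) auto
      then show "apart (c + 3 * t, d) (a + t, b)"
        using z(6) by (simp add: apart_def power2_commute)
    next
      fix s assume s: "s \<in> S"
      show "fst s < fst (a + t, b)" using z(7)[OF s] t by simp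
      show "apart (a + t, b) s" using apart_right_shift[OF z(9)[OF s], of "a + t"] z(7)[OF s] t by simp
      show "apart (c + 3 * t, d) s" using apart_right_shift[OF z(10)[OF s], of "c + 3 * t"] z(8)[OF s] t by simp
    qed (use z in \<open>simp_all add: strip_def\<close>)
  qed
  then show "homotopic_with (\<lambda>_. True) (marked_space ?E) (subtopology hausdorff_topology (unique_last (Suc n)))
     add_pair (\<lambda>z. add_pair (fst z, ?g (snd z)))" by simp
  show "homotopic_with (\<lambda>_. True) (marked_space ?E) (subtopology hausdorff_topology (unique_last (Suc n)))
     (\<lambda>z. add_pair (fst z, ?g (snd z))) (\<lambda>z. add_pair (fst z, spread (snd z)))"
  proof (rule homotopic_add_pair[OF g continuous_on_spread])
    fix S v and t :: real assume vE: "(S, v) \<in> ?E" and t: "0 \<le> t" "t \<le> 1"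
    obtain a b c d where v: "v = ((a, b), (c, d))" by (metis surj_pair)
    note z = pair_splitD[OF vE[unfolded v], simplified]
    let ?l = "(1 - t) * (a + 1) + t * (c + 1)" and ?r = "(1 - t) * (c + 3) + t * (a + 3)"
    let ?y = "(1 - t) * b + t * d" and ?y' = "(1 - t) * d + t * b"
    have eq: "(1 - t) *\<^sub>R ?g v + t *\<^sub>R spread v = ((?l, ?y), (?r, ?y'))"
      by (simp add: v spread_def)
    have "?r - ?l = (1 - t) * (c - a + 2) + t * (a - c + 2)" by (simp add: algebra_simps)
    also have "1 \<le> \<dots>" by (rule convex_combination_ge) (use z(5) t in auto)
    finally have lr: "?l + 1 \<le> ?r" by simp
    show "(S, (1 - t) *\<^sub>R ?g v + t *\<^sub>R spread v) \<in> ordered_split n"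
      unfolding eq
    proof (rule ordered_splitI)
      have bd: "1/2 \<le> b" "b \<le> 3/2" "1/2 \<le> d" "d \<le> 3/2" using z(2,3) by (simp_all add: strip_def)
      have "1/2 \<le> ?y" "1/2 \<le> ?y'" by (rule convex_combination_ge; use bd t in simp)+
      moreover have "?y \<le> 3/2" "?y' \<le> 3/2" by (rule convex_combination_le; use bd t in simp)+
      ultimately show "(?l, ?y) \<in> strip" "(?r, ?y') \<in> strip" by (simp_all add: strip_def)
      show "fst (?l, ?y) < fst (?r, ?y')" unfolding fst_conv using lr by linarith
      show "apart (?r, ?y') (?l, ?y)" by (rule apart_if_far) (unfold fst_conv, rule lr)
    next
      fix s assume s: "s \<in> S"
      have 1: "fst s + 1 < ?l" by (rule convex_combination_gt) (use z(7,8)[OF s] t in auto)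
      have 2: "fst s + 1 < ?r" by (rule convex_combination_gt) (use z(7,8)[OF s] t in auto)
      show "fst s < fst (?l, ?y)" unfolding fst_conv using 1 by linarith
      show "apart (?l, ?y) s" by (rule apart_if_far) (unfold fst_conv, rule less_imp_le[OF 1])
      show "apart (?r, ?y') s" by (rule apart_if_far) (unfold fst_conv, rule less_imp_le[OF 2])
    qed (rule z(1))
  qed
qed

lemma free_homology_unique_last:
  assumes "free_of_rank (homology_group k (config_space n)) r"
  shows "free_of_rank (homology_group k (subtopology hausdorff_topology (unique_last n))) r"
proof -
  have "homology_group k (config_space n) \<cong> homology_group k (marked_space (last_split n))"
    by (rule group.iso_sym[OF _ is_isoI[OF last_split_homology]]) simp
  moreover have "homology_group k (marked_space (last_split n)) \<cong> homology_group k (subtopology hausdorff_topology (unique_last n))"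
    by (rule is_isoI[OF homeomorphic_map_homology_iso[OF homeomorphic_map_add_last]])
  ultimately show ?thesis by (intro free_of_rank_iso[OF free_of_rank_iso[OF assms]])
qed

lemma subtopology_marked_pair_split:
  assumes "D \<subseteq> {-1/2<..<1/2}"
  shows "subtopology (marked_space (pair_split {-1/2<..<1/2} n)) (pair_split D n) = marked_space (pair_split D n)"
  using assms by (simp only: subtopology_subtopology pair_split_restrict Int_absorb1)

text \<open>
  Adding the configurations that end in a close pair to those with a unique rightmost disk is an
  instance of the union along a two-sided collar. The former look like configurations of \<open>n\<close> disks, the
  latter like configurations of \<open>n + 1\<close> disks.
\<close>

lemma free_homology_step:
  assumes a: "free_of_rank (homology_group k (config_space (Suc n))) a"
    and b: "free_of_rank (homology_group (k - 1) (config_space n)) b"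
  shows "free_of_rank (homology_group k (config_space (Suc (Suc n)))) (a + b)"
proof -
  let ?U = "config_space (Suc (Suc n))" and ?A = "unique_last (Suc n)" and ?B = "paired_last n"
  let ?X = "marked_space (pair_split {-1/2<..<1/2} n)"
  let ?P = "pair_split {0<..<1/2} n" and ?N = "pair_split {-1/2<..<0} n"
  have sA: "subtopology ?U ?A = subtopology hausdorff_topology ?A"
    and sB: "subtopology ?U ?B = subtopology hausdorff_topology ?B"
    by (simp_all add: subtopology_subtopology configs_cover Int_absorb1)
  have sP: "subtopology ?X ?P = marked_space ?P" and sN: "subtopology ?X ?N = marked_space ?N"
    by (rule subtopology_marked_pair_split; auto)+
  show ?thesis
  proof (rule free_homology_of_collared_union[of ?U ?A ?B ?X add_pair ?P ?N "config_space n" fst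
        "\<lambda>z. add_pair (fst z, spread (snd z))"])
    show "openin ?U ?A" by (rule openin_unique_last)
    show "openin ?U ?B" by (rule openin_paired_last)
    show "?A \<union> ?B = topspace ?U" by (simp add: configs_cover)
    show "homeomorphic_map ?X (subtopology ?U ?B) add_pair"
      unfolding sB by (rule homeomorphic_map_add_pair)
    show "openin ?X ?P" "openin ?X ?N" by (rule openin_pair_split; auto)+
    show "?P \<inter> ?N = {}" by (auto simp: pair_split_def)
    show "add_pair ` (?P \<union> ?N) = ?A \<inter> ?B"
    proof
      show "add_pair ` (?P \<union> ?N) \<subseteq> ?A \<inter> ?B"
      proof (rule image_subsetI)
        fix z assume z: "z \<in> ?P \<union> ?N"
        then have "z \<in> pair_split {-1/2<..<1/2} n" "fst (fst (snd z)) \<noteq> fst (snd (snd z))"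
          by (auto simp: pair_split_def)
        then show "add_pair z \<in> ?A \<inter> ?B"
          using add_pair_in_unique_last unfolding paired_last_def by blast
      qed
      show "?A \<inter> ?B \<subseteq> add_pair ` (?P \<union> ?N)"
      proof
        fix T assume T: "T \<in> ?A \<inter> ?B"
        then obtain z where z: "z \<in> pair_split {-1/2<..<1/2} n" "T = add_pair z"
          unfolding paired_last_def by blast
        then have "fst (fst (snd z)) \<noteq> fst (snd (snd z))" using T add_pair_in_unique_last by blast
        then have "z \<in> ?P \<union> ?N" using z(1) by (auto simp: pair_split_def)
        then show "T \<in> add_pair ` (?P \<union> ?N)" using z(2) by blast
      qed
    qed
    show "continuous_map ?X (config_space n) fst"
      by (auto simp: continuous_map_in_subtopology continuous_map_marked_fst pair_split_def)
    show "hom_induced p ?X {} (config_space n) {} fst \<in> iso (homology_group p ?X) (homology_group p (config_space n))" for p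
      by (rule pair_split_homology[of _ 0]) auto
    show "hom_induced p (subtopology ?X ?P) {} (config_space n) {} fst
        \<in> iso (homology_group p (subtopology ?X ?P)) (homology_group p (config_space n))" for p
      unfolding sP by (rule pair_split_homology[of _ "1/4"]) auto
    show "hom_induced p (subtopology ?X ?N) {} (config_space n) {} fst
        \<in> iso (homology_group p (subtopology ?X ?N)) (homology_group p (config_space n))" for p
      unfolding sN by (rule pair_split_homology[of _ "-1/4"]) auto
    have "homotopic_with (\<lambda>_. True) ?X (subtopology hausdorff_topology ?A)
        (\<lambda>z. add_pair (fst z, spread (snd z))) (\<lambda>z. add_pair (fst z, spread (snd z)))"
    proof (rule homotopic_add_pair[OF continuous_on_spread continuous_on_spread])
      fix S v and t :: real assume "(S, v) \<in> pair_split {-1/2<..<1/2} n"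
      then have "(S, spread v) \<in> ordered_split n" by (rule spread_in_ordered_split)
      then show "(S, (1 - t) *\<^sub>R spread v + t *\<^sub>R spread v) \<in> ordered_split n"
        by (simp flip: scaleR_left_distrib)
    qed
    then show "continuous_map ?X (subtopology ?U ?A) (\<lambda>z. add_pair (fst z, spread (snd z)))"
      unfolding sA using homotopic_with_imp_continuous_maps by blast
    show "homotopic_with (\<lambda>_. True) (subtopology ?X ?P) (subtopology ?U ?A) add_pair (\<lambda>z. add_pair (fst z, spread (snd z)))"
      unfolding sP sA by (rule homotopic_add_pair_spread_pos)
    show "homotopic_with (\<lambda>_. True) (subtopology ?X ?N) (subtopology ?U ?A) add_pair (\<lambda>z. add_pair (fst z, spread (snd z)))"
      unfolding sN sA by (rule homotopic_add_pair_spread_neg)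
    show "free_of_rank (homology_group k (subtopology ?U ?A)) a"
      unfolding sA using a by (rule free_homology_unique_last)
    show "free_of_rank (homology_group (k - 1) (config_space n)) b" by (rule b)
  qed
qed

lemma binomial_matching_recurrence:
  "(Suc (Suc n) - Suc k) choose Suc k = ((Suc n - Suc k) choose Suc k) + ((n - k) choose k)"
proof (cases "k \<le> n")
  case True
  then have "Suc (Suc n) - Suc k = Suc (n - k)" by simp
  then show ?thesis by simp
qed simp

text \<open>
  The ranks satisfy \<open>r(n+2, k) = r(n+1, k) + r(n, k-1)\<close>, which is Pascal's rule for \<open>n - k\<close> over \<open>k\<close>.
  Integral degrees make the recursion uniform: in negative degrees all groups are trivial.
\<close>

lemma free_homology_configs:
  "free_of_rank (homology_group k (config_space n)) (if k < 0 then 0 else (n - nat k) choose nat k)"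
proof (induction n arbitrary: k rule: less_induct)
  case (less n)
  have neg: "free_of_rank (homology_group k (config_space n)) 0" if "k < 0" for k
    using that by (intro free_of_rank_0) simp
  have base: "free_of_rank (homology_group k (config_space 0)) (if k = 0 then 1 else 0)" for k
  proof -
    have "configs 0 = {{}}" unfolding configs_def by auto
    then have top: "topspace (config_space 0) = {{}}" by simp
    show ?thesis
    proof (cases "k = 0")
      case True
      have "free_Abelian_group {0::nat} \<cong> integer_group"
        using group.iso_sym[OF _ isomorphic_group_integer_free_Abelian_group_singleton] by simp
      then have "free_of_rank integer_group 1"
        using free_of_rank_iff[of "{0::nat}" 1 integer_group] by simp
      moreover have "integer_group \<cong> homology_group 0 (config_space 0)"
        using group.iso_sym[OF _ homology_coefficients[OF top]] by simp
      ultimately show ?thesis using True free_of_rank_iso by simp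
    next
      case False
      then show ?thesis using homology_dimension_axiom[OF top False] by (simp add: free_of_rank_0)
    qed
  qed
  have small: "(if k = 0 then 1 else 0) = (if k < 0 then 0 else (m - nat k) choose nat k)"
    if "m \<le> 1" for m and k :: int
    using that by (auto simp: binomial_eq_0)
  consider "n = 0" | "n = 1" | m where "n = Suc (Suc m)"
    by (metis One_nat_def not0_implies_Suc)
  then show ?case
  proof cases
    case 1
    show ?thesis using base[of k] unfolding 1 small[of 0 k, OF zero_le_one] .
  next
    case 2
    have "unique_last 0 = configs 1"
    proof
      show "unique_last 0 \<subseteq> configs 1" using unique_last_iff by auto
      show "configs 1 \<subseteq> unique_last 0"
      proof
        fix T assume T: "T \<in> configs 1"
        then obtain p where "T = {p}" using configsD(2)[OF T] by (metis card_1_singletonE)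
        then show "T \<in> unique_last 0" using T by (simp add: unique_last_iff)
      qed
    qed
    then show ?thesis
      using free_homology_unique_last[OF base[of k]] unfolding small[of 1 k, OF order_refl] 2 by (simp only:)
  next
    case (3 m)
    show ?thesis
    proof (cases "k < 0")
      case True
      then show ?thesis using neg by simp
    next
      case False
      then obtain l where l: "k = int l" using nonneg_int_cases by (metis not_less)
      have step: "free_of_rank (homology_group k (config_space n))
         ((if k < 0 then 0 else (Suc m - nat k) choose nat k) +
          (if k - 1 < 0 then 0 else (m - nat (k - 1)) choose nat (k - 1)))"
        unfolding 3 by (rule free_homology_step) (rule less; simp add: 3)+
      show ?thesis
      proof (cases l)
        case 0
        then show ?thesis using step l by simp
      next
        case (Suc j)
        then have "nat k = Suc j" "nat (k - 1) = j" "\<not> k < 0" "\<not> k - 1 < 0" using l by simp_all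
        then show ?thesis using step binomial_matching_recurrence[of m j] 3 by simp
      qed
    qed
  qed
qed

theorem corollary1p3:
  fixes n k :: nat
  assumes "n \<ge> 1"
  shows "module_isomorphic (class_ring :: rat ring)
           (rat_homology k (UConf n 2))
           (module_vec TYPE(rat) (if n < 2 * k then 0 else (n - k) choose k))"
proof (rule module_isomorphic_rat_homology)
  have iso: "homology_group (int k) (config_space n) \<cong> homology_group (int k) (UConf n 2)"
    by (rule homeomorphic_space_imp_isomorphic_homology_groups
        [OF homeomorphic_space_sym[THEN iffD1, OF UConf_homeomorphic_config_space]])
  have "free_of_rank (homology_group (int k) (config_space n)) ((n - k) choose k)"
    using free_homology_configs[of "int k" n] by simp
  from free_of_rank_iso[OF this iso]
  have "free_of_rank (homology_group (int k) (UConf n 2)) ((n - k) choose k)" .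
  moreover have "(if n < 2 * k then 0 else (n - k) choose k) = (n - k) choose k"
    using binomial_eq_0[of "n - k" k] by (cases "n < 2 * k") simp_all
  ultimately show "free_of_rank (homology_group (int k) (UConf n 2)) (if n < 2 * k then 0 else (n - k) choose k)"
    by (simp only:)
qed

end
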